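(* Let $P$ be a planar or symmetric set-operad with a nice grading $\psi$ such that: (1) either any morphism in the category $P(1)$ has at most one left inverse, or (2) petals of operations of arity $1$ factor through inputs. Let $\mathrm{Tw}(P)_0$ be one of the subcategories $Lower$, $Lower\circ Perm$ or $Inert$ of $\mathrm{Tw}(P)$, and $i:El(\mathrm{Tw}(P)_0)\to\mathrm{Tw}(P)_0$ be the inclusion. Then the right Kan extension $i_*:Psh(El(\mathrm{Tw}(P)_0))\to Sh(\mathrm{Tw}(P)_0)$ is an equivalence of categories, where sheaves are taken for the Segal coverage $S_\psi$.
   Context: Operads are coloured operads in sets with identity operations. $P(1)$ is the category whose objects are colours and whose morphisms $a\to b$ are the unary operations in $P(a;b)$. A grading $\psi$ assigns to each operation an integer with $\psi(p\circ_i q)=\psi(p)+\psi(q)$, $\psi(\mathrm{id}_c)=0$, $\psi(p^\sigma)=\psi(p)$; it is nice if $\psi\ge-1$, operations of grading $-1$ have arity $0$, and arity $0$ operations $e$ such that $m\circ_1e$ or $m\circ_2 e$ is an identity for some binary $m$ have grading $-1$. **Twisted arrow category $\mathrm{Tw}(P)$, symmetric case.** Objects: operations of $P$. A morphism with source $p\in P(c_1,\dots,c_n;c_0)$ is (uniquely) a tuple $f=(q_0;q_1,\dots,q_n;\lambda)$, where $q_0\in P$ has arity $m_0\ge 1$ and first input colour $c_0$, $q_i\in P$ ($1\le i\le n$) has arity $m_i\ge 0$ and output colour $c_i$, and $\lambda$ is a bijection from the set of leaves $\{(i,k):1\le i\le n,1\le k\le m_i\}\cup\{(0,k):2\le k\le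 m_0\}$ onto $\{1,\dots,N\}$ with $k\mapsto\lambda(i,k)$ increasing for each fixed $i$. The target is the operation $t$ with $t(x_1,\dots,x_N)=q_0\bigl(p(q_1(x_{\lambda(1,1)},\dots,x_{\lambda(1,m_1)}),\dots,q_n(x_{\lambda(n,1)},\dots)),x_{\lambda(0,2)},\dots,x_{\lambda(0,m_0)}\bigr)$. The composite of $f:p\to t$ with $g=(r_0;r_1,\dots,r_N;\mu):t\to u$ has upper vertices $q_i(r_{\lambda(i,1)},\dots,r_{\lambda(i,m_i)})$ and lower vertex $r_0\circ_1 q_0(\mathrm{id},r_{\lambda(0,2)},\dots,r_{\lambda(0,m_0)})$, with leaves numbered by $\mu$, and with inputs of each vertex (other than the first input of the lower one) then permuted so that the numbers increase. **Planar case.** A morphism from $p$ is a tuple $(q_0,i;q_1,\dots,q_n)$ where the $i$-th input of $q_0$ has colour $c_0$, with target $q_0\circ_ip(q_1,\dots,q_n)$, and composition by grafting; leaves are numbered in planar order. **Subcategories.** $Lower$: morphisms with $q_1,\dots,q_n$ identities and (symmetric case) $\lambda(1,1)<\dots<\lambda(n,1)$. $Perm$: morphisms with all $q_0,\dots,q_n$ identities. $Lower\circ Perm$: composites of a morphism in $Perm$ followed by a morphism in $Lower$. $Inert$: composites of lower morphisms and isomorphisms. The $j$-th input map of $p\in P(c_1,\dots,c_n;c_0)$ is the lower morphism $\mathrm{id}_{c_j}\to p$ such that the leaf above the source vertex is numbered by $j$. A petal map (petal) of $t$ is a morphism $q\to t$ in $\mathrm{Tw}(P)$ with $\psi(q)=-1$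 (it is automatically lower). Petals of operations of arity $1$ factor through inputs if any petal map $q\to t$ with $t$ of arity $1$ factors as $q\to\mathrm{id}_c\to t$ with $\mathrm{id}_c\to t$ an input map. **Elementary objects** are identity operations and operations of grading $-1$. $El(\mathrm{Tw}(P)_0)$ is the full subcategory of $\mathrm{Tw}(P)_0$ on elementary objects. **Segal coverage $S_\psi$** on $\mathrm{Tw}(P)_0$ assigns to each operation $p$ the single family consisting of all input maps and all petal maps of $p$. A presheaf of sets $X$ on $\mathrm{Tw}(P)_0$ is a sheaf if for each $p$ with this family $(f_i:p_i\to p)_{i}$ and each family $s_i\in X(p_i)$ which is compatible ($g^*(s_i)=h^*(s_j)$ whenever $g:v\to p_i$, $h:v\to p_j$ in $\mathrm{Tw}(P)_0$ satisfy $f_i\circ g=f_j\circ h$) there is exactly one $s\in X(p)$ with $f_i^*(s)=s_i$ for all $i$. $Psh$ and $Sh$ denote categories of presheaves and of sheaves; the right Kan extension along $i$ takes values in sheaves. *)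

theory Defs
  imports Main "HOL-Library.FuncSet"
begin

section \<open>Categories, functors, equivalences\<close>

text \<open>In \<open>compo C g f\<close> the arrow \<open>f\<close> comes first.\<close>

record ('a, 'm) category_data =
  obj :: "'a set"
  arr :: "'m set"
  dom :: "'m \<Rightarrow> 'a"
  cod :: "'m \<Rightarrow> 'a"
  idt :: "'a \<Rightarrow> 'm"
  compo :: "'m \<Rightarrow> 'm \<Rightarrow> 'm"

definition hom :: "('a, 'm) category_data \<Rightarrow> 'a \<Rightarrow> 'a \<Rightarrow> 'm set" where
  "hom C a b = {f \<in> arr C. dom C f = a \<and> cod C f = b}"

locale category =
  fixes C :: "('a, 'm) category_data"
  assumes dom_obj: "f \<in> arr C \<Longrightarrow> dom C f \<in> obj C"
    and cod_obj: "f \<in> arr C \<Longrightarrow> cod C f \<in> obj C"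
    and idt_hom: "a \<in> obj C \<Longrightarrow> idt C a \<in> hom C a a"
    and compo_hom: "f \<in> hom C a b \<Longrightarrow> g \<in> hom C b c \<Longrightarrow> compo C g f \<in> hom C a c"
    and idt_left: "f \<in> hom C a b \<Longrightarrow> compo C (idt C b) f = f"
    and idt_right: "f \<in> hom C a b \<Longrightarrow> compo C f (idt C a) = f"
    and compo_assoc: "f \<in> hom C a b \<Longrightarrow> g \<in> hom C b c \<Longrightarrow> h \<in> hom C c d \<Longrightarrow>
      compo C h (compo C g f) = compo C (compo C h g) f"

definition wide_sub :: "('a, 'm) category_data \<Rightarrow> 'm set \<Rightarrow> ('a, 'm) category_data" where
  "wide_sub C A = C\<lparr>arr := arr C \<inter> A\<rparr>"

definition full_sub :: "('a, 'm) category_data \<Rightarrow> 'a set \<Rightarrow> ('a, 'm) category_data" where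
  "full_sub C S = C\<lparr>obj := obj C \<inter> S, arr := {f \<in> arr C. dom C f \<in> S \<and> cod C f \<in> S}\<rparr>"

definition iso :: "('a, 'm) category_data \<Rightarrow> 'm \<Rightarrow> bool" where
  "iso C f \<longleftrightarrow> f \<in> arr C \<and> (\<exists>g \<in> hom C (cod C f) (dom C f).
     compo C g f = idt C (dom C f) \<and> compo C f g = idt C (cod C f))"

record ('a, 'm, 'b, 'n) functor_data =
  on_obj :: "'a \<Rightarrow> 'b"
  on_arr :: "'m \<Rightarrow> 'n"

definition inclusion :: "('a, 'm, 'a, 'm) functor_data" where
  "inclusion = \<lparr>on_obj = \<lambda>a. a, on_arr = \<lambda>f. f\<rparr>"

definition functor_comp ::
  "('b, 'n, 'd, 'k) functor_data \<Rightarrow> ('a, 'm, 'b, 'n) functor_data \<Rightarrow> ('a, 'm, 'd, 'k) functor_data" where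
  "functor_comp G F = \<lparr>on_obj = \<lambda>a. on_obj G (on_obj F a), on_arr = \<lambda>f. on_arr G (on_arr F f)\<rparr>"

definition is_functor ::
  "('a, 'm) category_data \<Rightarrow> ('b, 'n) category_data \<Rightarrow> ('a, 'm, 'b, 'n) functor_data \<Rightarrow> bool" where
  "is_functor C D F \<longleftrightarrow> category C \<and> category D \<and>
     (\<forall>a \<in> obj C. on_obj F a \<in> obj D) \<and>
     (\<forall>f \<in> arr C. on_arr F f \<in> hom D (on_obj F (dom C f)) (on_obj F (cod C f))) \<and>
     (\<forall>a \<in> obj C. on_arr F (idt C a) = idt D (on_obj F a)) \<and>
     (\<forall>f \<in> arr C. \<forall>g \<in> arr C. cod C f = dom C g \<longrightarrow>
        on_arr F (compo C g f) = compo D (on_arr F g) (on_arr F f))"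

definition naturally_isomorphic ::
  "('a, 'm) category_data \<Rightarrow> ('b, 'n) category_data \<Rightarrow>
   ('a, 'm, 'b, 'n) functor_data \<Rightarrow> ('a, 'm, 'b, 'n) functor_data \<Rightarrow> bool" where
  "naturally_isomorphic C D F G \<longleftrightarrow> (\<exists>\<eta>.
     (\<forall>a \<in> obj C. \<eta> a \<in> hom D (on_obj F a) (on_obj G a) \<and> iso D (\<eta> a)) \<and>
     (\<forall>f \<in> arr C. compo D (\<eta> (cod C f)) (on_arr F f) = compo D (on_arr G f) (\<eta> (dom C f))))"

definition is_equivalence ::
  "('a, 'm) category_data \<Rightarrow> ('b, 'n) category_data \<Rightarrow> ('a, 'm, 'b, 'n) functor_data \<Rightarrow> bool" where
  "is_equivalence C D F \<longleftrightarrow> is_functor C D F \<and> (\<exists>G. is_functor D C G \<and>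
     naturally_isomorphic C C inclusion (functor_comp G F) \<and>
     naturally_isomorphic D D (functor_comp F G) inclusion)"


section \<open>Presheaves of sets, sheaves, right Kan extension\<close>

text \<open>The values of a presheaf are subsets of a type \<open>'u\<close>, which plays the role of the universe
  of sets.  Presheaves and natural transformations are \<open>undefined\<close> outside of their domain, so
  that equality of them is the mathematical one.\<close>

record ('a, 'm, 'u) presheaf =
  sec :: "'a \<Rightarrow> 'u set"
  res :: "'m \<Rightarrow> 'u \<Rightarrow> 'u"

definition is_presheaf :: "('a, 'm) category_data \<Rightarrow> ('a, 'm, 'u) presheaf \<Rightarrow> bool" where
  "is_presheaf C X \<longleftrightarrow>
     sec X \<in> extensional (obj C) \<and> res X \<in> extensional (arr C) \<and>
     (\<forall>f \<in> arr C. res X f \<in> sec X (cod C f) \<rightarrow>\<^sub>E sec X (dom C f)) \<and>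
     (\<forall>a \<in> obj C. \<forall>x \<in> sec X a. res X (idt C a) x = x) \<and>
     (\<forall>f \<in> arr C. \<forall>g \<in> arr C. cod C f = dom C g \<longrightarrow>
        (\<forall>x \<in> sec X (cod C g). res X (compo C g f) x = res X f (res X g x)))"

record ('a, 'm, 'u) nat_trans =
  source :: "('a, 'm, 'u) presheaf"
  target :: "('a, 'm, 'u) presheaf"
  component :: "'a \<Rightarrow> 'u \<Rightarrow> 'u"

definition is_nat_trans :: "('a, 'm) category_data \<Rightarrow> ('a, 'm, 'u) nat_trans \<Rightarrow> bool" where
  "is_nat_trans C \<eta> \<longleftrightarrow>
     is_presheaf C (source \<eta>) \<and> is_presheaf C (target \<eta>) \<and>
     component \<eta> \<in> extensional (obj C) \<and>
     (\<forall>a \<in> obj C. component \<eta> a \<in> sec (source \<eta>) a \<rightarrow>\<^sub>E sec (target \<eta>) a) \<and>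
     (\<forall>f \<in> arr C. \<forall>x \<in> sec (source \<eta>) (cod C f).
        component \<eta> (dom C f) (res (source \<eta>) f x) = res (target \<eta>) f (component \<eta> (cod C f) x))"

definition Psh :: "('a, 'm) category_data \<Rightarrow>
    (('a, 'm, 'u) presheaf, ('a, 'm, 'u) nat_trans) category_data" where
  "Psh C = \<lparr>obj = {X. is_presheaf C X}, arr = {\<eta>. is_nat_trans C \<eta>}, dom = source, cod = target,
     idt = \<lambda>X. \<lparr>source = X, target = X, component = \<lambda>a\<in>obj C. \<lambda>x\<in>sec X a. x\<rparr>,
     compo = \<lambda>\<theta> \<eta>. \<lparr>source = source \<eta>, target = target \<theta>,
       component = \<lambda>a\<in>obj C. compose (sec (source \<eta>) a) (component \<theta> a) (component \<eta> a)\<rparr>\<rparr>"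

text \<open>A coverage with a single covering family for each object is given by the set
  \<open>cov p\<close> of the arrows of the family covering \<open>p\<close>.\<close>

definition compatible ::
  "('a, 'm) category_data \<Rightarrow> 'm set \<Rightarrow> ('a, 'm, 'u) presheaf \<Rightarrow> ('m \<Rightarrow> 'u) \<Rightarrow> bool" where
  "compatible C A X s \<longleftrightarrow> (\<forall>f \<in> A. s f \<in> sec X (dom C f)) \<and>
     (\<forall>f \<in> A. \<forall>f' \<in> A. \<forall>g \<in> arr C. \<forall>g' \<in> arr C.
        dom C g = dom C g' \<and> cod C g = dom C f \<and> cod C g' = dom C f' \<and>
        compo C f g = compo C f' g' \<longrightarrow> res X g (s f) = res X g' (s f'))"

definition is_sheaf ::
  "('a, 'm) category_data \<Rightarrow> ('a \<Rightarrow> 'm set) \<Rightarrow> ('a, 'm, 'u) presheaf \<Rightarrow> bool" where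
  "is_sheaf C cov X \<longleftrightarrow> is_presheaf C X \<and>
     (\<forall>p \<in> obj C. \<forall>s. compatible C (cov p) X s \<longrightarrow>
        (\<exists>!x. x \<in> sec X p \<and> (\<forall>f \<in> cov p. res X f x = s f)))"

definition Sh :: "('a, 'm) category_data \<Rightarrow> ('a \<Rightarrow> 'm set) \<Rightarrow>
    (('a, 'm, 'u) presheaf, ('a, 'm, 'u) nat_trans) category_data" where
  "Sh C cov = full_sub (Psh C) {X. is_sheaf C cov X}"

text \<open>Precomposition with a functor \<open>i\<close> from \<open>A\<close>, that is, \<open>i\<^sup>*\<close>.\<close>

definition pull_presheaf :: "('a, 'm) category_data \<Rightarrow> ('a, 'm, 'b, 'n) functor_data \<Rightarrow>
    ('b, 'n, 'u) presheaf \<Rightarrow> ('a, 'm, 'u) presheaf" where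
  "pull_presheaf A i X =
     \<lparr>sec = \<lambda>a\<in>obj A. sec X (on_obj i a), res = \<lambda>f\<in>arr A. res X (on_arr i f)\<rparr>"

definition pull_nat_trans :: "('a, 'm) category_data \<Rightarrow> ('a, 'm, 'b, 'n) functor_data \<Rightarrow>
    ('b, 'n, 'u) nat_trans \<Rightarrow> ('a, 'm, 'u) nat_trans" where
  "pull_nat_trans A i \<eta> =
     \<lparr>source = pull_presheaf A i (source \<eta>), target = pull_presheaf A i (target \<eta>),
      component = \<lambda>a\<in>obj A. component \<eta> (on_obj i a)\<rparr>"

type_synonym ('a, 'm, 'b, 'n, 'u) psh_functor =
  "(('a, 'm, 'u) presheaf, ('a, 'm, 'u) nat_trans,
    ('b, 'n, 'u) presheaf, ('b, 'n, 'u) nat_trans) functor_data"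

text \<open>\<open>R\<close> is a functor of right Kan extension along \<open>i\<close> from \<open>A\<close> to \<open>C\<close>, with universal
  transformations \<open>\<epsilon> Y\<close> from \<open>i\<^sup>* (R Y)\<close> to \<open>Y\<close>.\<close>

definition is_right_Kan_extension ::
  "('a, 'm) category_data \<Rightarrow> ('b, 'n) category_data \<Rightarrow> ('a, 'm, 'b, 'n) functor_data \<Rightarrow>
   ('a, 'm, 'b, 'n, 'u) psh_functor \<Rightarrow>
   (('a, 'm, 'u) presheaf \<Rightarrow> ('a, 'm, 'u) nat_trans) \<Rightarrow> bool" where
  "is_right_Kan_extension A C i R \<epsilon> \<longleftrightarrow> is_functor A C i \<and> is_functor (Psh A) (Psh C) R \<and>
     (\<forall>Y \<in> obj (Psh A). \<epsilon> Y \<in> hom (Psh A) (pull_presheaf A i (on_obj R Y)) Y) \<and>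
     (\<forall>Y \<in> obj (Psh A). \<forall>X \<in> obj (Psh C). \<forall>\<alpha> \<in> hom (Psh A) (pull_presheaf A i X) Y.
        \<exists>!\<beta>. \<beta> \<in> hom (Psh C) X (on_obj R Y) \<and>
             compo (Psh A) (\<epsilon> Y) (pull_nat_trans A i \<beta>) = \<alpha>) \<and>
     (\<forall>\<phi> \<in> arr (Psh A). compo (Psh A) (\<epsilon> (target \<phi>)) (pull_nat_trans A i (on_arr R \<phi>)) =
        compo (Psh A) \<phi> (\<epsilon> (source \<phi>)))"

text \<open>Sets of functions from \<open>'k\<close> to the universe \<open>'u\<close> have to exist in \<open>'u\<close> again for the
  right Kan extension to exist.  There are arbitrarily large such universes.\<close>

definition closed_under_powers :: "'k itself \<Rightarrow> 'u itself \<Rightarrow> bool" where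
  "closed_under_powers _ _ \<longleftrightarrow> (\<exists>h :: ('k \<Rightarrow> 'u) \<Rightarrow> 'u. inj h)"

lemma closed_under_powers_list: "closed_under_powers TYPE('k) TYPE('k list \<Rightarrow> 'v)"
proof -
  have "inj (\<lambda>F :: 'k \<Rightarrow> 'k list \<Rightarrow> 'v. \<lambda>xs. case xs of [] \<Rightarrow> undefined | x # ys \<Rightarrow> F x ys)"
    by (rule injI) (metis (no_types, lifting) ext list.simps(5))
  then show ?thesis
    unfolding closed_under_powers_def by blast
qed


section \<open>Operads\<close>

text \<open>Positions are numbered from 0.  \<open>cmp P p [q\<^sub>0, \<dots>, q\<^sub>n]\<close> is \<open>p(q\<^sub>0, \<dots>, q\<^sub>n)\<close>.\<close>

record ('c, 'o) operad_data =
  Col :: "'c set"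
  Ops :: "'o set"
  inp :: "'o \<Rightarrow> 'c list"
  outp :: "'o \<Rightarrow> 'c"
  ident :: "'c \<Rightarrow> 'o"
  cmp :: "'o \<Rightarrow> 'o list \<Rightarrow> 'o"

definition arity :: "('c, 'o, 'z) operad_data_scheme \<Rightarrow> 'o \<Rightarrow> nat" where
  "arity P p = length (inp P p)"

definition composable :: "('c, 'o, 'z) operad_data_scheme \<Rightarrow> 'o \<Rightarrow> 'o list \<Rightarrow> bool" where
  "composable P p qs \<longleftrightarrow> p \<in> Ops P \<and> set qs \<subseteq> Ops P \<and> map (outp P) qs = inp P p"

definition identities :: "('c, 'o, 'z) operad_data_scheme \<Rightarrow> 'o set" where
  "identities P = ident P ` Col P"

locale planar_operad =
  fixes P :: "('c, 'o, 'z) operad_data_scheme"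
  assumes inp_Col: "p \<in> Ops P \<Longrightarrow> set (inp P p) \<subseteq> Col P"
    and outp_Col: "p \<in> Ops P \<Longrightarrow> outp P p \<in> Col P"
    and ident_Ops: "c \<in> Col P \<Longrightarrow> ident P c \<in> Ops P"
    and inp_ident: "c \<in> Col P \<Longrightarrow> inp P (ident P c) = [c]"
    and outp_ident: "c \<in> Col P \<Longrightarrow> outp P (ident P c) = c"
    and cmp_Ops: "composable P p qs \<Longrightarrow> cmp P p qs \<in> Ops P"
    and inp_cmp: "composable P p qs \<Longrightarrow> inp P (cmp P p qs) = concat (map (inp P) qs)"
    and outp_cmp: "composable P p qs \<Longrightarrow> outp P (cmp P p qs) = outp P p"
    and cmp_ident_right: "p \<in> Ops P \<Longrightarrow> cmp P p (map (ident P) (inp P p)) = p"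
    and cmp_ident_left: "p \<in> Ops P \<Longrightarrow> cmp P (ident P (outp P p)) [p] = p"
    and cmp_assoc: "composable P p qs \<Longrightarrow> list_all2 (composable P) qs rss \<Longrightarrow>
      cmp P (cmp P p qs) (concat rss) = cmp P p (map2 (cmp P) qs rss)"

text \<open>A permutation of \<open>{..<n}\<close> is represented by the list of its values.  With
  \<open>p\<^sup>s = act P p s\<close>, the convention is
  \<open>p\<^sup>s(x\<^sub>0, \<dots>, x\<^sub>n\<^sub>-\<^sub>1) = p(x\<^bsub>s!0\<^esub>, \<dots>, x\<^bsub>s!(n-1)\<^esub>)\<close>.\<close>

record ('c, 'o) sym_operad_data = "('c, 'o) operad_data" +
  act :: "'o \<Rightarrow> nat list \<Rightarrow> 'o"

definition is_perm :: "nat \<Rightarrow> nat list \<Rightarrow> bool" where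
  "is_perm n s \<longleftrightarrow> distinct s \<and> set s = {..<n}"

text \<open>The consecutive intervals of lengths \<open>ns\<close>, that is, the numbers of the inputs
  of \<open>q\<^sub>0, q\<^sub>1, \<dots>\<close> among those of \<open>p(q\<^sub>0, q\<^sub>1, \<dots>)\<close> if \<open>ns\<close> are the arities of the \<open>q\<^sub>i\<close>.\<close>

definition blocks :: "nat list \<Rightarrow> nat list list" where
  "blocks ns = map (\<lambda>i. [sum_list (take i ns)..<sum_list (take (Suc i) ns)]) [0..<length ns]"

locale symmetric_operad = planar_operad P for P :: "('c, 'o, 'z) sym_operad_data_scheme" +
  assumes act_Ops: "p \<in> Ops P \<Longrightarrow> is_perm (arity P p) s \<Longrightarrow> act P p s \<in> Ops P"
    and outp_act: "p \<in> Ops P \<Longrightarrow> is_perm (arity P p) s \<Longrightarrow> outp P (act P p s) = outp P p"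
    and arity_act: "p \<in> Ops P \<Longrightarrow> is_perm (arity P p) s \<Longrightarrow> arity P (act P p s) = arity P p"
    and inp_act: "p \<in> Ops P \<Longrightarrow> is_perm (arity P p) s \<Longrightarrow> j < arity P p \<Longrightarrow>
      inp P (act P p s) ! (s ! j) = inp P p ! j"
    and act_id: "p \<in> Ops P \<Longrightarrow> act P p [0..<arity P p] = p"
    and act_act: "p \<in> Ops P \<Longrightarrow> is_perm (arity P p) s \<Longrightarrow> is_perm (arity P p) t \<Longrightarrow>
      act P (act P p s) t = act P p (map ((!) t) s)"
    and cmp_act_left: "p \<in> Ops P \<Longrightarrow> is_perm (arity P p) s \<Longrightarrow> composable P (act P p s) qs \<Longrightarrow>
      cmp P (act P p s) qs =
        act P (cmp P p (map ((!) qs) s)) (concat (map ((!) (blocks (map (arity P) qs))) s))"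
    and cmp_act_right: "composable P p qs \<Longrightarrow> list_all2 (\<lambda>q s. is_perm (arity P q) s) qs ss \<Longrightarrow>
      cmp P p (map2 (act P) qs ss) =
        act P (cmp P p qs) (concat (map2 (\<lambda>b s. map ((!) b) s) (blocks (map (arity P) qs)) ss))"

text \<open>\<open>pcmp P p i q\<close> is \<open>p \<circ>\<^sub>i q\<close> (with \<open>i\<close> counted from 0).\<close>

definition pcmp :: "('c, 'o, 'z) operad_data_scheme \<Rightarrow> 'o \<Rightarrow> nat \<Rightarrow> 'o \<Rightarrow> 'o" where
  "pcmp P p i q = cmp P p ((map (ident P) (inp P p))[i := q])"

definition pcomposable :: "('c, 'o, 'z) operad_data_scheme \<Rightarrow> 'o \<Rightarrow> nat \<Rightarrow> 'o \<Rightarrow> bool" where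
  "pcomposable P p i q \<longleftrightarrow>
     p \<in> Ops P \<and> q \<in> Ops P \<and> i < arity P p \<and> outp P q = inp P p ! i"

definition planar_grading :: "('c, 'o, 'z) operad_data_scheme \<Rightarrow> ('o \<Rightarrow> int) \<Rightarrow> bool" where
  "planar_grading P \<psi> \<longleftrightarrow>
     (\<forall>p q i. pcomposable P p i q \<longrightarrow> \<psi> (pcmp P p i q) = \<psi> p + \<psi> q) \<and>
     (\<forall>c \<in> Col P. \<psi> (ident P c) = 0)"

definition symmetric_grading :: "('c, 'o, 'z) sym_operad_data_scheme \<Rightarrow> ('o \<Rightarrow> int) \<Rightarrow> bool" where
  "symmetric_grading P \<psi> \<longleftrightarrow> planar_grading P \<psi> \<and>
     (\<forall>p \<in> Ops P. \<forall>s. is_perm (arity P p) s \<longrightarrow> \<psi> (act P p s) = \<psi> p)"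

definition nice :: "('c, 'o, 'z) operad_data_scheme \<Rightarrow> ('o \<Rightarrow> int) \<Rightarrow> bool" where
  "nice P \<psi> \<longleftrightarrow>
     (\<forall>p \<in> Ops P. \<psi> p \<ge> -1) \<and>
     (\<forall>p \<in> Ops P. \<psi> p = -1 \<longrightarrow> arity P p = 0) \<and>
     (\<forall>e \<in> Ops P. arity P e = 0 \<and>
        (\<exists>m i. arity P m = 2 \<and> i \<in> {0, 1} \<and> pcomposable P m i e \<and> pcmp P m i e \<in> identities P) \<longrightarrow>
        \<psi> e = -1)"

definition unary_category :: "('c, 'o, 'z) operad_data_scheme \<Rightarrow> ('c, 'o) category_data" where
  "unary_category P = \<lparr>obj = Col P, arr = {p \<in> Ops P. arity P p = 1},
     dom = \<lambda>p. hd (inp P p), cod = outp P, idt = ident P, compo = \<lambda>q p. cmp P q [p]\<rparr>"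

definition at_most_one_left_inverse :: "('a, 'm) category_data \<Rightarrow> bool" where
  "at_most_one_left_inverse C \<longleftrightarrow>
     (\<forall>f \<in> arr C. \<forall>g \<in> hom C (cod C f) (dom C f). \<forall>g' \<in> hom C (cod C f) (dom C f).
        compo C g f = idt C (dom C f) \<and> compo C g' f = idt C (dom C f) \<longrightarrow> g = g')"


section \<open>The twisted arrow category of a planar operad\<close>

text \<open>An arrow is a tuple \<open>(q\<^sub>0, i; q\<^sub>1, \<dots>, q\<^sub>n)\<close> together with its source \<open>p\<close>.\<close>

record 'o planar_arrow =
  src :: 'o
  lower :: 'o
  pos :: nat
  uppers :: "'o list"

definition planar_target :: "('c, 'o, 'z) operad_data_scheme \<Rightarrow> 'o planar_arrow \<Rightarrow> 'o" where
  "planar_target P f = pcmp P (lower f) (pos f) (cmp P (src f) (uppers f))"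

text \<open>For the composite of \<open>f\<close> and \<open>g\<close>: the leaves of \<open>f\<close> are, in planar order, the \<open>i\<close> inputs
  of its lower vertex before the \<open>i\<close>-th one, then the inputs of its \<open>n\<close> upper vertices
  (\<open>k\<close> inputs in total), then the remaining inputs of the lower vertex.\<close>

definition planar_compo ::
  "('c, 'o, 'z) operad_data_scheme \<Rightarrow> 'o planar_arrow \<Rightarrow> 'o planar_arrow \<Rightarrow> 'o planar_arrow" where
  "planar_compo P g f =
     (let i = pos f; ns = map (arity P) (uppers f); k = sum_list ns; rs = uppers g in
      \<lparr>src = src f,
       lower = pcmp P (lower g) (pos g)
         (cmp P (lower f) (take i rs @ ident P (outp P (src f)) # drop (i + k) rs)),
       pos = pos g + sum_list (map (arity P) (take i rs)),
       uppers = map2 (\<lambda>q b. cmp P q (map (\<lambda>j. rs ! (i + j)) b)) (uppers f) (blocks ns)\<rparr>)"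

definition planar_Tw :: "('c, 'o, 'z) operad_data_scheme \<Rightarrow> ('o, 'o planar_arrow) category_data" where
  "planar_Tw P =
     \<lparr>obj = Ops P,
      arr = {f. composable P (src f) (uppers f) \<and> pcomposable P (lower f) (pos f) (src f)},
      dom = src,
      cod = planar_target P,
      idt = \<lambda>p. \<lparr>src = p, lower = ident P (outp P p), pos = 0, uppers = map (ident P) (inp P p)\<rparr>,
      compo = planar_compo P\<rparr>"

definition planar_Lower :: "('c, 'o, 'z) operad_data_scheme \<Rightarrow> 'o planar_arrow set" where
  "planar_Lower P = {f \<in> arr (planar_Tw P). set (uppers f) \<subseteq> identities P}"

definition planar_Perm :: "('c, 'o, 'z) operad_data_scheme \<Rightarrow> 'o planar_arrow set" where
  "planar_Perm P =
     {f \<in> arr (planar_Tw P). lower f \<in> identities P \<and> set (uppers f) \<subseteq> identities P}"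

definition planar_input_maps :: "('c, 'o, 'z) operad_data_scheme \<Rightarrow> 'o \<Rightarrow> 'o planar_arrow set" where
  "planar_input_maps P p = {f. \<exists>j < arity P p. f \<in> planar_Lower P \<and>
     src f = ident P (inp P p ! j) \<and> planar_target P f = p \<and> pos f = j}"


section \<open>The twisted arrow category of a symmetric operad\<close>

text \<open>An arrow is a tuple \<open>(q\<^sub>0; q\<^sub>1, \<dots>, q\<^sub>n; \<lambda>)\<close> together with its source \<open>p\<close>.  The bijection
  \<open>\<lambda>\<close>, with values in \<open>{0..<N}\<close>, is given by the lists \<open>slow_leaves f = [\<lambda>(0,2), \<dots>, \<lambda>(0,m\<^sub>0)]\<close> and
  \<open>sup_leaves f = [[\<lambda>(1,1), \<dots>, \<lambda>(1,m\<^sub>1)], \<dots>, [\<lambda>(n,1), \<dots>, \<lambda>(n,m\<^sub>n)]]\<close>.\<close>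

record 'o sym_arrow =
  ssrc :: 'o
  slower :: 'o
  suppers :: "'o list"
  slow_leaves :: "nat list"
  sup_leaves :: "nat list list"

definition leaf_list :: "'o sym_arrow \<Rightarrow> nat list" where
  "leaf_list f = concat (sup_leaves f) @ slow_leaves f"

definition is_sym_arrow :: "('c, 'o, 'z) sym_operad_data_scheme \<Rightarrow> 'o sym_arrow \<Rightarrow> bool" where
  "is_sym_arrow P f \<longleftrightarrow>
     composable P (ssrc f) (suppers f) \<and> pcomposable P (slower f) 0 (ssrc f) \<and>
     map length (sup_leaves f) = map (arity P) (suppers f) \<and>
     length (slow_leaves f) = arity P (slower f) - 1 \<and>
     (\<forall>L \<in> set (sup_leaves f). sorted_wrt (<) L) \<and> sorted_wrt (<) (slow_leaves f) \<and>
     is_perm (length (leaf_list f)) (leaf_list f)"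

definition sym_target :: "('c, 'o, 'z) sym_operad_data_scheme \<Rightarrow> 'o sym_arrow \<Rightarrow> 'o" where
  "sym_target P f =
     act P (pcmp P (slower f) 0 (cmp P (ssrc f) (suppers f))) (leaf_list f)"

text \<open>If the inputs of \<open>p\<close> carry the distinct numbers \<open>K\<close>, then \<open>sort_inputs P p K\<close> is \<open>p\<close> with
  its inputs permuted so that these numbers increase; \<open>sort_inputs_tail\<close> leaves the first input
  in its place, and \<open>K\<close> are the numbers of the others.\<close>

definition ranks :: "nat list \<Rightarrow> nat list" where
  "ranks K = map (\<lambda>x. card {y \<in> set K. y < x}) K"

definition sort_inputs :: "('c, 'o, 'z) sym_operad_data_scheme \<Rightarrow> 'o \<Rightarrow> nat list \<Rightarrow> 'o" where
  "sort_inputs P p K = act P p (ranks K)"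

definition sort_inputs_tail :: "('c, 'o, 'z) sym_operad_data_scheme \<Rightarrow> 'o \<Rightarrow> nat list \<Rightarrow> 'o" where
  "sort_inputs_tail P p K = act P p (0 # map Suc (ranks K))"

definition sym_compo ::
  "('c, 'o, 'z) sym_operad_data_scheme \<Rightarrow> 'o sym_arrow \<Rightarrow> 'o sym_arrow \<Rightarrow> 'o sym_arrow" where
  "sym_compo P g f =
     (let grafted = (\<lambda>L. map ((!) (suppers g)) L);
          leaves = (\<lambda>L. concat (map ((!) (sup_leaves g)) L));
          K0 = leaves (slow_leaves f) @ slow_leaves g in
      \<lparr>ssrc = ssrc f,
       slower = sort_inputs_tail P
         (pcmp P (slower g) 0
           (cmp P (slower f) (ident P (outp P (ssrc f)) # grafted (slow_leaves f)))) K0,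
       suppers = map2 (\<lambda>q L. sort_inputs P (cmp P q (grafted L)) (leaves L))
         (suppers f) (sup_leaves f),
       slow_leaves = sort K0,
       sup_leaves = map (\<lambda>L. sort (leaves L)) (sup_leaves f)\<rparr>)"

definition sym_Tw :: "('c, 'o, 'z) sym_operad_data_scheme \<Rightarrow> ('o, 'o sym_arrow) category_data" where
  "sym_Tw P =
     \<lparr>obj = Ops P,
      arr = {f. is_sym_arrow P f},
      dom = ssrc,
      cod = sym_target P,
      idt = \<lambda>p. \<lparr>ssrc = p, slower = ident P (outp P p), suppers = map (ident P) (inp P p),
                 slow_leaves = [], sup_leaves = map (\<lambda>j. [j]) [0..<arity P p]\<rparr>,
      compo = sym_compo P\<rparr>"

definition sym_Lower :: "('c, 'o, 'z) sym_operad_data_scheme \<Rightarrow> 'o sym_arrow set" where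
  "sym_Lower P = {f \<in> arr (sym_Tw P). set (suppers f) \<subseteq> identities P \<and>
     sorted_wrt (<) (map hd (sup_leaves f))}"

definition sym_Perm :: "('c, 'o, 'z) sym_operad_data_scheme \<Rightarrow> 'o sym_arrow set" where
  "sym_Perm P =
     {f \<in> arr (sym_Tw P). slower f \<in> identities P \<and> set (suppers f) \<subseteq> identities P}"

definition sym_input_maps :: "('c, 'o, 'z) sym_operad_data_scheme \<Rightarrow> 'o \<Rightarrow> 'o sym_arrow set" where
  "sym_input_maps P p = {f. \<exists>j < arity P p. f \<in> sym_Lower P \<and>
     ssrc f = ident P (inp P p ! j) \<and> sym_target P f = p \<and> sup_leaves f = [[j]]}"


section \<open>Subcategories and Segal coverage\<close>

text \<open>In the following, \<open>T\<close> is one of the two twisted arrow categories.\<close>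

definition composites :: "('a, 'm) category_data \<Rightarrow> 'm set \<Rightarrow> 'm set \<Rightarrow> 'm set" where
  "composites T B A = {compo T g f | f g. f \<in> A \<and> g \<in> B \<and> cod T f = dom T g}"

inductive_set Inert :: "('a, 'm) category_data \<Rightarrow> 'm set \<Rightarrow> 'm set"
  for T :: "('a, 'm) category_data" and Lower :: "'m set" where
  lower: "f \<in> Lower \<Longrightarrow> f \<in> Inert T Lower"
| isom: "iso T f \<Longrightarrow> f \<in> Inert T Lower"
| compo: "f \<in> Inert T Lower \<Longrightarrow> g \<in> Inert T Lower \<Longrightarrow> cod T f = dom T g \<Longrightarrow>
    compo T g f \<in> Inert T Lower"

definition petal_maps :: "('a, 'm) category_data \<Rightarrow> ('a \<Rightarrow> int) \<Rightarrow> 'a \<Rightarrow> 'm set" where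
  "petal_maps T \<psi> t = {f \<in> arr T. cod T f = t \<and> \<psi> (dom T f) = -1}"

definition segal_coverage ::
  "('a, 'm) category_data \<Rightarrow> ('a \<Rightarrow> 'm set) \<Rightarrow> ('a \<Rightarrow> int) \<Rightarrow> 'a \<Rightarrow> 'm set" where
  "segal_coverage T inputs \<psi> p = inputs p \<union> petal_maps T \<psi> p"

definition petals_factor_through_inputs :: "('c, 'o, 'z) operad_data_scheme \<Rightarrow>
    ('o, 'm) category_data \<Rightarrow> ('o \<Rightarrow> 'm set) \<Rightarrow> ('o \<Rightarrow> int) \<Rightarrow> bool" where
  "petals_factor_through_inputs P T inputs \<psi> \<longleftrightarrow>
     (\<forall>t \<in> Ops P. arity P t = 1 \<longrightarrow> (\<forall>f \<in> petal_maps T \<psi> t.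
        \<exists>h \<in> inputs t. \<exists>g \<in> arr T. cod T g = dom T h \<and> compo T h g = f))"

definition elementary :: "('c, 'o, 'z) operad_data_scheme \<Rightarrow> ('o \<Rightarrow> int) \<Rightarrow> 'o set" where
  "elementary P \<psi> = identities P \<union> {p \<in> Ops P. \<psi> p = -1}"

end

theory Submission
  imports Defs "HOL-Library.Multiset" "HOL-Library.Nat_Bijection"
begin

text \<open>
  An arrow \<open>v \<rightarrow> p\<close> of a twisted arrow category exhibits \<open>v\<close> as part of a decomposition of \<open>p\<close>.  The
  covering family of \<open>p\<close> consists of arrows from elementary objects, and it is cofinal among all of
  these: in each of the three subcategories, every arrow from an elementary object \<open>e\<close> to \<open>p\<close> factors
  through a covering arrow.  This implies the theorem, by the following two arguments.

  The right Kan extension of a presheaf \<open>Y\<close> has as sections over \<open>p\<close> the families that assign to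
  each arrow \<open>e \<rightarrow> p\<close> from an elementary object an element of \<open>Y(e)\<close>, compatibly.  Because of the
  factorizations such a family can be recovered from its restrictions to the covering arrows, and any
  compatible system of restrictions comes from one.  Thus the extension is a sheaf
  (\<open>ran_is_sheaf\<close>).  As the inclusion of elementary objects is fully faithful, restricting the
  extension of \<open>Y\<close> gives back \<open>Y\<close> (\<open>counit_iso\<close>).

  Conversely, for a sheaf \<open>X\<close> the unit from \<open>X\<close> to the extension of its restriction is a map of
  sheaves that is bijective on elementary objects.  Such a map is invertible
  (\<open>iso_of_sheaves_if_bij_on_covering_objects\<close>): sections of a sheaf are separated by the covering
  arrows, which yields injectivity at every object, and injectivity at every object in turn yields
  the compatibility that is needed to glue preimages.  The two arguments are combined in
  \<open>elementary_objects_equivalence\<close>, for any category with a coverage by arrows from a class of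
  objects through which all arrows from these objects factor.

  It remains to study twisted arrow categories.  An arrow from an operation of grading \<open>-1\<close> is a
  petal map, hence a covering arrow.  For an arrow from an identity there is one upper vertex \<open>u\<close>.  If
  it is an identity, the arrow is an input map.  For inert arrows \<open>u\<close> is at least an invertible unary
  operation: for isomorphisms one compares arities (\<open>mutually_right_invertible\<close>), and the property is
  inherited by composites.  Then \<open>u\<close> can be moved below the source, and the arrow becomes an
  isomorphism between identity operations followed by an input map (\<open>planar_Inert_factor\<close>,
  \<open>sym_Inert_factor\<close>).

  That twisted arrows form a category is clear from pictures of trees, but composition in the
  symmetric case involves sorting the inputs of all vertices.  The proof avoids calculations with
  permutations by labelling inputs: an arrow is presented by any tree with labelled leaves from which
  it arises by sorting, composites are presented by grafting such trees (\<open>presents_compo\<close>), and a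
  presentation determines the arrow (\<open>presents_unique\<close>).  The category laws are thereby reduced to
  those for grafting in planar operads.
\<close>

section \<open>Categories and natural isomorphisms\<close>

context category
begin

lemma idt_arr: "a \<in> obj C \<Longrightarrow> idt C a \<in> arr C"
  and dom_idt: "a \<in> obj C \<Longrightarrow> dom C (idt C a) = a"
  and cod_idt: "a \<in> obj C \<Longrightarrow> cod C (idt C a) = a"
  using idt_hom by (auto simp: hom_def)

lemma compo_arr:
  assumes "f \<in> arr C" "g \<in> arr C" "cod C f = dom C g"
  shows "compo C g f \<in> arr C" "dom C (compo C g f) = dom C f" "cod C (compo C g f) = cod C g"
  using compo_hom[of f "dom C f" "cod C f" g "cod C g"] assms by (auto simp: hom_def)

lemma compo_idt_left: "f \<in> arr C \<Longrightarrow> compo C (idt C (cod C f)) f = f"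
  and compo_idt_right: "f \<in> arr C \<Longrightarrow> compo C f (idt C (dom C f)) = f"
  by (auto intro: idt_left idt_right simp: hom_def)

lemma compo_assoc_arr:
  assumes "f \<in> arr C" "g \<in> arr C" "h \<in> arr C" "cod C f = dom C g" "cod C g = dom C h"
  shows "compo C h (compo C g f) = compo C (compo C h g) f"
  using compo_assoc[of f "dom C f" "cod C f" g "cod C g" h "cod C h"] assms by (auto simp: hom_def)

lemma wide_sub_category:
  assumes "A \<subseteq> arr C" and "\<And>a. a \<in> obj C \<Longrightarrow> idt C a \<in> A"
    and "\<And>f g. f \<in> A \<Longrightarrow> g \<in> A \<Longrightarrow> cod C f = dom C g \<Longrightarrow> compo C g f \<in> A"
  shows "category (wide_sub C A)"
proof
  fix a b f assume "f \<in> hom (wide_sub C A) a b"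
  then show "compo (wide_sub C A) (idt (wide_sub C A) b) f = f"
    "compo (wide_sub C A) f (idt (wide_sub C A) a) = f"
    by (auto simp: wide_sub_def hom_def compo_idt_left compo_idt_right)
next
  fix a b c d f g h
  assume "f \<in> hom (wide_sub C A) a b" "g \<in> hom (wide_sub C A) b c" "h \<in> hom (wide_sub C A) c d"
  then show "compo (wide_sub C A) h (compo (wide_sub C A) g f) =
      compo (wide_sub C A) (compo (wide_sub C A) h g) f"
    by (auto simp: wide_sub_def hom_def intro!: compo_assoc_arr)
qed (use assms in \<open>auto simp: wide_sub_def hom_def dom_obj cod_obj idt_arr dom_idt cod_idt compo_arr\<close>)

lemma full_sub_category: "category (full_sub C E)"
proof
  fix a b f assume "f \<in> hom (full_sub C E) a b"
  then show "compo (full_sub C E) (idt (full_sub C E) b) f = f"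
    "compo (full_sub C E) f (idt (full_sub C E) a) = f"
    by (auto simp: full_sub_def hom_def compo_idt_left compo_idt_right)
next
  fix a b c d f g h
  assume "f \<in> hom (full_sub C E) a b" "g \<in> hom (full_sub C E) b c" "h \<in> hom (full_sub C E) c d"
  then show "compo (full_sub C E) h (compo (full_sub C E) g f) =
      compo (full_sub C E) (compo (full_sub C E) h g) f"
    by (auto simp: full_sub_def hom_def intro!: compo_assoc_arr)
qed (auto simp: full_sub_def hom_def dom_obj cod_obj idt_arr dom_idt cod_idt compo_arr)

lemma inverse_exists:
  assumes "iso C f"
  obtains g where "g \<in> arr C" "dom C g = cod C f" "cod C g = dom C f"
    "compo C g f = idt C (dom C f)" "compo C f g = idt C (cod C f)" "iso C g"
proof -
  obtain g where "f \<in> arr C" "g \<in> hom C (cod C f) (dom C f)"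
      "compo C g f = idt C (dom C f)" "compo C f g = idt C (cod C f)"
    using assms unfolding iso_def by blast
  then show thesis
    by (intro that[of g]) (auto simp: iso_def hom_def)
qed

lemma iso_arr: "iso C f \<Longrightarrow> f \<in> arr C"
  by (simp add: iso_def)

end

text \<open>An equivalence asks for transformations from the identity on one side and to the identity on
  the other; the counit and the unit of an adjunction point in the opposite directions.\<close>

lemma naturally_isomorphic_sym:
  assumes F: "is_functor C D F" and G: "is_functor C D G"
    and iso: "naturally_isomorphic C D F G"
  shows "naturally_isomorphic C D G F"
proof -
  interpret C: category C using F by (simp add: is_functor_def)
  interpret D: category D using F by (simp add: is_functor_def)
  obtain \<eta> where nt: "\<forall>a \<in> obj C. \<eta> a \<in> hom D (on_obj F a) (on_obj G a) \<and> iso D (\<eta> a)"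
      "\<forall>f \<in> arr C. compo D (\<eta> (cod C f)) (on_arr F f) = compo D (on_arr G f) (\<eta> (dom C f))"
    using iso unfolding naturally_isomorphic_def by (elim exE conjE)
  have \<eta>: "\<And>a. a \<in> obj C \<Longrightarrow> \<eta> a \<in> hom D (on_obj F a) (on_obj G a)"
      "\<And>a. a \<in> obj C \<Longrightarrow> iso D (\<eta> a)"
      "\<And>f. f \<in> arr C \<Longrightarrow> compo D (\<eta> (cod C f)) (on_arr F f) = compo D (on_arr G f) (\<eta> (dom C f))"
    using nt(1) bspec[OF nt(2)] by auto
  have "\<forall>a \<in> obj C. \<exists>g. g \<in> hom D (on_obj G a) (on_obj F a) \<and> iso D g \<and>
      compo D g (\<eta> a) = idt D (on_obj F a) \<and> compo D (\<eta> a) g = idt D (on_obj G a)"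
  proof
    fix a assume a: "a \<in> obj C"
    show "\<exists>g. g \<in> hom D (on_obj G a) (on_obj F a) \<and> iso D g \<and>
      compo D g (\<eta> a) = idt D (on_obj F a) \<and> compo D (\<eta> a) g = idt D (on_obj G a)"
      by (rule D.inverse_exists[OF \<eta>(2)[OF a]]) (use \<eta>(1)[OF a] in \<open>auto simp: hom_def\<close>)
  qed
  from bchoice[OF this] obtain \<theta> where th: "\<forall>a \<in> obj C. \<theta> a \<in> hom D (on_obj G a) (on_obj F a) \<and> iso D (\<theta> a) \<and>
      compo D (\<theta> a) (\<eta> a) = idt D (on_obj F a) \<and> compo D (\<eta> a) (\<theta> a) = idt D (on_obj G a)" ..
  have \<theta>: "\<And>a. a \<in> obj C \<Longrightarrow> \<theta> a \<in> hom D (on_obj G a) (on_obj F a)"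
      "\<And>a. a \<in> obj C \<Longrightarrow> iso D (\<theta> a)"
      "\<And>a. a \<in> obj C \<Longrightarrow> compo D (\<theta> a) (\<eta> a) = idt D (on_obj F a)"
      "\<And>a. a \<in> obj C \<Longrightarrow> compo D (\<eta> a) (\<theta> a) = idt D (on_obj G a)"
    using th by auto
  have "compo D (\<theta> (cod C f)) (on_arr G f) = compo D (on_arr F f) (\<theta> (dom C f))"
    if f: "f \<in> arr C" for f
  proof -
    let ?a = "dom C f" and ?b = "cod C f"
    have ab: "?a \<in> obj C" "?b \<in> obj C" using f C.dom_obj C.cod_obj by auto
    have Ff: "on_arr F f \<in> hom D (on_obj F ?a) (on_obj F ?b)"
      and Gf: "on_arr G f \<in> hom D (on_obj G ?a) (on_obj G ?b)"
      using F G f by (auto simp: is_functor_def)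
    note hs = Ff Gf \<eta>(1)[OF ab(1)] \<eta>(1)[OF ab(2)] \<theta>(1)[OF ab(1)] \<theta>(1)[OF ab(2)]
    have "compo D (\<theta> ?b) (on_arr G f) =
        compo D (\<theta> ?b) (compo D (on_arr G f) (compo D (\<eta> ?a) (\<theta> ?a)))"
      using hs \<theta>(4)[OF ab(1)] D.idt_right by metis
    also have "\<dots> = compo D (\<theta> ?b) (compo D (compo D (on_arr G f) (\<eta> ?a)) (\<theta> ?a))"
      using hs D.compo_assoc by metis
    also have "\<dots> = compo D (\<theta> ?b) (compo D (\<eta> ?b) (compo D (on_arr F f) (\<theta> ?a)))"
      using hs \<eta>(3)[OF f] D.compo_assoc by metis
    also have "\<dots> = compo D (compo D (\<theta> ?b) (\<eta> ?b)) (compo D (on_arr F f) (\<theta> ?a))"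
      using hs D.compo_assoc D.compo_hom by metis
    also have "\<dots> = compo D (on_arr F f) (\<theta> ?a)"
      using hs \<theta>(3)[OF ab(2)] D.idt_left D.compo_hom by metis
    finally show ?thesis .
  qed
  then show ?thesis
    unfolding naturally_isomorphic_def using \<theta> by blast
qed

section \<open>Presheaves and sheaves\<close>

lemma bij_betw_the_inv_into_facts:
  assumes "bij_betw f A B" "y \<in> B"
  shows "the_inv_into A f y \<in> A" "f (the_inv_into A f y) = y"
  using assms by (auto simp: bij_betw_def the_inv_into_into f_the_inv_into_f)

lemma Psh_simps [simp]:
  "X \<in> obj (Psh C) \<longleftrightarrow> is_presheaf C X"
  "\<eta> \<in> arr (Psh C) \<longleftrightarrow> is_nat_trans C \<eta>"
  "dom (Psh C) = source" "cod (Psh C) = target"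
  by (auto simp: Psh_def)

lemma presheafD:
  assumes "is_presheaf C X"
  shows "sec X \<in> extensional (obj C)" "res X \<in> extensional (arr C)"
    "f \<in> arr C \<Longrightarrow> res X f \<in> extensional (sec X (cod C f))"
    "f \<in> arr C \<Longrightarrow> x \<in> sec X (cod C f) \<Longrightarrow> res X f x \<in> sec X (dom C f)"
    "a \<in> obj C \<Longrightarrow> x \<in> sec X a \<Longrightarrow> res X (idt C a) x = x"
    "f \<in> arr C \<Longrightarrow> g \<in> arr C \<Longrightarrow> cod C f = dom C g \<Longrightarrow> x \<in> sec X (cod C g) \<Longrightarrow>
       res X (compo C g f) x = res X f (res X g x)"
  using assms by (auto simp: is_presheaf_def PiE_def)

lemma nat_transD:
  assumes "is_nat_trans C \<eta>"
  shows "is_presheaf C (source \<eta>)" "is_presheaf C (target \<eta>)"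
    "component \<eta> \<in> extensional (obj C)"
    "a \<in> obj C \<Longrightarrow> component \<eta> a \<in> extensional (sec (source \<eta>) a)"
    "a \<in> obj C \<Longrightarrow> x \<in> sec (source \<eta>) a \<Longrightarrow> component \<eta> a x \<in> sec (target \<eta>) a"
    "f \<in> arr C \<Longrightarrow> x \<in> sec (source \<eta>) (cod C f) \<Longrightarrow>
       component \<eta> (dom C f) (res (source \<eta>) f x) = res (target \<eta>) f (component \<eta> (cod C f) x)"
  using assms by (auto simp: is_nat_trans_def PiE_def)

lemma nat_trans_eqI:
  assumes "is_nat_trans C \<eta>" "is_nat_trans C \<theta>" "source \<eta> = source \<theta>" "target \<eta> = target \<theta>"
    and "\<And>a x. a \<in> obj C \<Longrightarrow> x \<in> sec (source \<eta>) a \<Longrightarrow> component \<eta> a x = component \<theta> a x"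
  shows "\<eta> = \<theta>"
proof -
  have "component \<eta> a = component \<theta> a" if "a \<in> obj C" for a
    using nat_transD(4)[OF assms(1) that] nat_transD(4)[OF assms(2) that] assms(3,5) that
    by (auto intro!: extensionalityI)
  then have "component \<eta> = component \<theta>"
    using nat_transD(3)[OF assms(1)] nat_transD(3)[OF assms(2)] by (auto intro: extensionalityI)
  then show ?thesis
    using assms by (intro nat_trans.equality) auto
qed

lemma Psh_compo_simps [simp]:
  "source (compo (Psh C) \<theta> \<eta>) = source \<eta>"
  "target (compo (Psh C) \<theta> \<eta>) = target \<theta>"
  "source (idt (Psh C) X) = X" "target (idt (Psh C) X) = X"
  "a \<in> obj C \<Longrightarrow> x \<in> sec X a \<Longrightarrow> component (idt (Psh C) X) a x = x"
  "a \<in> obj C \<Longrightarrow> x \<in> sec (source \<eta>) a \<Longrightarrow>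
     component (compo (Psh C) \<theta> \<eta>) a x = component \<theta> a (component \<eta> a x)"
  by (auto simp: Psh_def compose_def)

context category
begin

lemma nat_trans_idt: "is_presheaf C X \<Longrightarrow> is_nat_trans C (idt (Psh C) X)"
  by (auto simp: is_nat_trans_def Psh_def dom_obj cod_obj presheafD)

lemma nat_trans_compo:
  assumes "is_nat_trans C \<eta>" "is_nat_trans C \<theta>" "target \<eta> = source \<theta>"
  shows "is_nat_trans C (compo (Psh C) \<theta> \<eta>)"
  unfolding is_nat_trans_def
proof (intro conjI ballI)
  show "component (compo (Psh C) \<theta> \<eta>) \<in> extensional (obj C)" by (simp add: Psh_def)
next
  fix a assume a: "a \<in> obj C"
  show "component (compo (Psh C) \<theta> \<eta>) a
      \<in> sec (source (compo (Psh C) \<theta> \<eta>)) a \<rightarrow>\<^sub>E sec (target (compo (Psh C) \<theta> \<eta>)) a"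
    using a nat_transD(5)[OF assms(1) a] nat_transD(5)[OF assms(2) a] assms(3)
    by (auto simp: Psh_def compose_def)
next
  fix f x assume f: "f \<in> arr C" and x: "x \<in> sec (source (compo (Psh C) \<theta> \<eta>)) (cod C f)"
  have "res (source \<eta>) f x \<in> sec (source \<eta>) (dom C f)"
    using x f presheafD(4)[OF nat_transD(1)[OF assms(1)]] by simp
  then show "component (compo (Psh C) \<theta> \<eta>) (dom C f) (res (source (compo (Psh C) \<theta> \<eta>)) f x) =
      res (target (compo (Psh C) \<theta> \<eta>)) f (component (compo (Psh C) \<theta> \<eta>) (cod C f) x)"
    using f x dom_obj[OF f] cod_obj[OF f] nat_transD(5,6)[OF assms(1)] nat_transD(6)[OF assms(2)] assms(3)
    by simp
qed (use assms in \<open>auto dest: nat_transD\<close>)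

lemma Psh_category: "category (Psh C)"
proof
  fix a b f assume "f \<in> hom (Psh C) a b"
  then show "compo (Psh C) (idt (Psh C) b) f = f" "compo (Psh C) f (idt (Psh C) a) = f"
    by (auto simp: hom_def nat_trans_idt nat_transD intro!: nat_trans_eqI[where C = C] nat_trans_compo)
next
  fix a b c d f g h
  assume "f \<in> hom (Psh C) a b" "g \<in> hom (Psh C) b c" "h \<in> hom (Psh C) c d"
  then show "compo (Psh C) h (compo (Psh C) g f) = compo (Psh C) (compo (Psh C) h g) f"
    by (auto simp: hom_def nat_transD(5)[where C = C] intro!: nat_trans_eqI[where C = C] nat_trans_compo)
qed (auto simp: hom_def nat_trans_idt nat_trans_compo nat_transD)

interpretation Psh: category "Psh C"
  by (rule Psh_category)

lemma Sh_category: "category (Sh C cov)"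
  unfolding Sh_def by (rule Psh.full_sub_category)

lemma iso_Psh_bij:
  assumes "iso (Psh C) \<eta>" "a \<in> obj C"
  shows "bij_betw (component \<eta> a) (sec (source \<eta>) a) (sec (target \<eta>) a)"
proof -
  obtain \<theta> where \<theta>: "is_nat_trans C \<theta>" "source \<theta> = target \<eta>" "target \<theta> = source \<eta>"
      "compo (Psh C) \<theta> \<eta> = idt (Psh C) (source \<eta>)" "compo (Psh C) \<eta> \<theta> = idt (Psh C) (target \<eta>)"
    using Psh.inverse_exists[OF assms(1)] by (metis Psh_simps(2-4))
  have \<eta>: "is_nat_trans C \<eta>" using Psh.iso_arr[OF assms(1)] by simp
  show ?thesis
  proof (rule bij_betw_byWitness[where f' = "component \<theta> a"])
    show "\<forall>x\<in>sec (source \<eta>) a. component \<theta> a (component \<eta> a x) = x"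
      using assms(2) Psh_compo_simps(5)[OF assms(2)] Psh_compo_simps(6)[OF assms(2)] \<theta>(4) by metis
    show "\<forall>x\<in>sec (target \<eta>) a. component \<eta> a (component \<theta> a x) = x"
      using assms(2) Psh_compo_simps(5)[OF assms(2)] Psh_compo_simps(6)[OF assms(2)] \<theta>(2,5) by metis
  qed (use nat_transD(5)[OF \<eta> assms(2)] nat_transD(5)[OF \<theta>(1) assms(2)] \<theta> in auto)
qed

lemma bij_iso_Psh:
  assumes \<eta>: "is_nat_trans C \<eta>"
    and bij: "\<And>a. a \<in> obj C \<Longrightarrow> bij_betw (component \<eta> a) (sec (source \<eta>) a) (sec (target \<eta>) a)"
  shows "iso (Psh C) \<eta>"
proof -
  define \<theta> where "\<theta> = \<lparr>source = target \<eta>, target = source \<eta>,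
    component = \<lambda>a\<in>obj C. \<lambda>x\<in>sec (target \<eta>) a. the_inv_into (sec (source \<eta>) a) (component \<eta> a) x\<rparr>"
  have mem: "the_inv_into (sec (source \<eta>) a) (component \<eta> a) x \<in> sec (source \<eta>) a"
    "component \<eta> a (the_inv_into (sec (source \<eta>) a) (component \<eta> a) x) = x"
    if "a \<in> obj C" "x \<in> sec (target \<eta>) a" for a x
    using bij_betw_the_inv_into_facts[OF bij[OF that(1)] that(2)] by auto
  have inv: "the_inv_into (sec (source \<eta>) a) (component \<eta> a) (component \<eta> a x) = x"
    if "a \<in> obj C" "x \<in> sec (source \<eta>) a" for a x
    using bij[OF that(1)] that(2) by (auto simp: bij_betw_def the_inv_into_f_f)
  have \<theta>: "is_nat_trans C \<theta>"
    unfolding is_nat_trans_def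
  proof (intro conjI ballI)
    fix f x assume f: "f \<in> arr C" and x: "x \<in> sec (source \<theta>) (cod C f)"
    define y where "y = component \<theta> (cod C f) x"
    have y: "y \<in> sec (source \<eta>) (cod C f)" "x = component \<eta> (cod C f) y"
      using x mem[OF cod_obj[OF f]] cod_obj[OF f] by (auto simp: y_def \<theta>_def)
    have "res (target \<eta>) f x = component \<eta> (dom C f) (res (source \<eta>) f y)"
      using nat_transD(6)[OF \<eta> f y(1)] y(2) by simp
    moreover have "res (source \<eta>) f y \<in> sec (source \<eta>) (dom C f)"
      using presheafD(4)[OF nat_transD(1)[OF \<eta>]] f y by blast
    ultimately have "component \<theta> (dom C f) (res (target \<eta>) f x) = res (source \<eta>) f y"
      using inv[OF dom_obj[OF f]] dom_obj[OF f] nat_transD(5)[OF \<eta> dom_obj[OF f]]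
      by (simp add: \<theta>_def)
    then show "component \<theta> (dom C f) (res (source \<theta>) f x) =
        res (target \<theta>) f (component \<theta> (cod C f) x)"
      using y_def by (simp add: \<theta>_def)
  qed (use \<eta> mem in \<open>auto simp: \<theta>_def dest: nat_transD\<close>)
  have "\<theta> \<in> hom (Psh C) (target \<eta>) (source \<eta>)"
    using \<theta> by (auto simp: hom_def \<theta>_def)
  moreover have "compo (Psh C) \<theta> \<eta> = idt (Psh C) (source \<eta>)"
    using \<theta> \<eta> inv nat_transD(5)[OF \<eta>]
    by (intro nat_trans_eqI[where C = C] nat_trans_compo nat_trans_idt)
       (auto simp: \<theta>_def dest: nat_transD)
  moreover have "compo (Psh C) \<eta> \<theta> = idt (Psh C) (target \<eta>)"
    using \<theta> \<eta> mem
    by (intro nat_trans_eqI[where C = C] nat_trans_compo nat_trans_idt)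
       (auto simp: \<theta>_def dest: nat_transD)
  ultimately show ?thesis
    using \<eta> unfolding iso_def by auto
qed

lemma compatible_restrictions:
  assumes "is_presheaf C X" "x \<in> sec X p" "\<And>f. f \<in> A \<Longrightarrow> f \<in> arr C \<and> cod C f = p"
  shows "compatible C A X (\<lambda>f. res X f x)"
  unfolding compatible_def
proof (intro conjI ballI impI)
  fix f f' g g'
  assume *: "f \<in> A" "f' \<in> A" "g \<in> arr C" "g' \<in> arr C" "dom C g = dom C g' \<and> cod C g = dom C f \<and>
    cod C g' = dom C f' \<and> compo C f g = compo C f' g'"
  then have "res X g (res X f x) = res X (compo C f g) x" "res X g' (res X f' x) = res X (compo C f' g') x"
    using assms presheafD(6)[OF assms(1), of g f x] presheafD(6)[OF assms(1), of g' f' x] by auto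
  then show "res X g (res X f x) = res X g' (res X f' x)" using * by simp
next
  fix f assume "f \<in> A"
  then show "res X f x \<in> sec X (dom C f)" using assms(2,3) presheafD(4)[OF assms(1), of f x] by auto
qed

lemma sheaf_iso:
  assumes X: "is_sheaf C cov X" and \<eta>: "iso (Psh C) \<eta>" "source \<eta> = X"
    and cov: "\<And>p f. p \<in> obj C \<Longrightarrow> f \<in> cov p \<Longrightarrow> f \<in> arr C \<and> cod C f = p"
  shows "is_sheaf C cov (target \<eta>)"
  unfolding is_sheaf_def
proof (intro conjI ballI allI impI)
  have nt: "is_nat_trans C \<eta>" using Psh.iso_arr[OF \<eta>(1)] by simp
  show "is_presheaf C (target \<eta>)" using nat_transD[OF nt] by simp
  have psh: "is_presheaf C X" using X by (simp add: is_sheaf_def)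
  fix p s assume p: "p \<in> obj C" and s: "compatible C (cov p) (target \<eta>) s"
  let ?inv = "\<lambda>a. the_inv_into (sec X a) (component \<eta> a)"
  have bij: "bij_betw (component \<eta> a) (sec X a) (sec (target \<eta>) a)" if "a \<in> obj C" for a
    using iso_Psh_bij[OF \<eta>(1) that] \<eta>(2) by simp
  have inv: "?inv a x \<in> sec X a" "component \<eta> a (?inv a x) = x" if "a \<in> obj C" "x \<in> sec (target \<eta>) a" for a x
    using bij_betw_the_inv_into_facts[OF bij[OF that(1)] that(2)] by auto
  have inj: "x = y" if "a \<in> obj C" "x \<in> sec X a" "y \<in> sec X a" "component \<eta> a x = component \<eta> a y" for a x y
    using bij[OF that(1)] that by (auto simp: bij_betw_def inj_on_def)
  note nat = nat_transD(6)[OF nt, unfolded \<eta>(2)]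
  define t where "t f = ?inv (dom C f) (s f)" for f
  have t: "t f \<in> sec X (dom C f)" "component \<eta> (dom C f) (t f) = s f" if "f \<in> cov p" for f
    using inv[of "dom C f" "s f"] that cov[OF p that] dom_obj s by (auto simp: t_def compatible_def)
  have "compatible C (cov p) X t"
    unfolding compatible_def
  proof (intro conjI ballI impI)
    fix f f' g g'
    assume *: "f \<in> cov p" "f' \<in> cov p" "g \<in> arr C" "g' \<in> arr C"
      and eq: "dom C g = dom C g' \<and> cod C g = dom C f \<and> cod C g' = dom C f' \<and> compo C f g = compo C f' g'"
    have "component \<eta> (dom C g) (res X g (t f)) = res (target \<eta>) g (s f)"
      using nat[OF *(3), of "t f"] t[OF *(1)] eq by simp
    moreover have "component \<eta> (dom C g') (res X g' (t f')) = res (target \<eta>) g' (s f')"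
      using nat[OF *(4), of "t f'"] t[OF *(2)] eq by simp
    moreover have "res (target \<eta>) g (s f) = res (target \<eta>) g' (s f')"
      using s * eq unfolding compatible_def by blast
    ultimately show "res X g (t f) = res X g' (t f')"
      using inj[of "dom C g" "res X g (t f)" "res X g' (t f')"] eq * t[OF *(1)] t[OF *(2)]
        dom_obj presheafD(4)[OF psh] by metis
  qed (use t in auto)
  then obtain x where x: "x \<in> sec X p" "\<And>f. f \<in> cov p \<Longrightarrow> res X f x = t f"
      and uniq: "\<And>y. y \<in> sec X p \<Longrightarrow> (\<And>f. f \<in> cov p \<Longrightarrow> res X f y = t f) \<Longrightarrow> y = x"
    using X p unfolding is_sheaf_def by (metis (no_types, lifting))
  show "\<exists>!x. x \<in> sec (target \<eta>) p \<and> (\<forall>f\<in>cov p. res (target \<eta>) f x = s f)"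
  proof (rule ex1I[of _ "component \<eta> p x"], intro conjI ballI)
    show "component \<eta> p x \<in> sec (target \<eta>) p"
      using nat_transD(5)[OF nt p] x \<eta>(2) by simp
    fix f assume f: "f \<in> cov p"
    then show "res (target \<eta>) f (component \<eta> p x) = s f"
      using nat[of f x] cov[OF p f] x t[OF f] by simp
  next
    fix y assume y: "y \<in> sec (target \<eta>) p \<and> (\<forall>f\<in>cov p. res (target \<eta>) f y = s f)"
    have "res X f (?inv p y) = t f" if f: "f \<in> cov p" for f
    proof (rule inj[of "dom C f"])
      show "component \<eta> (dom C f) (res X f (?inv p y)) = component \<eta> (dom C f) (t f)"
        using nat[of f "?inv p y"] cov[OF p f] inv[OF p] y f t[OF f] by simp
    qed (use f cov[OF p f] t inv[OF p] y dom_obj presheafD(4)[OF psh] in auto)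
    then have "?inv p y = x" using uniq inv[OF p] y by blast
    then show "y = component \<eta> p x" using inv(2)[OF p] y by auto
  qed
qed

lemma sheaf_separated:
  assumes X: "is_sheaf C cov X" and p: "p \<in> obj C" and "x \<in> sec X p" "y \<in> sec X p"
    and cov: "\<And>f. f \<in> cov p \<Longrightarrow> f \<in> arr C \<and> cod C f = p"
    and eq: "\<And>f. f \<in> cov p \<Longrightarrow> res X f x = res X f y"
  shows "x = y"
proof -
  have "compatible C (cov p) X (\<lambda>f. res X f x)"
    using compatible_restrictions[of X x p "cov p"] X assms by (auto simp: is_sheaf_def)
  then have "\<exists>!z. z \<in> sec X p \<and> (\<forall>f \<in> cov p. res X f z = res X f x)"
    using X p unfolding is_sheaf_def by blast
  then show ?thesis using assms by metis
qed

text \<open>Sections of the source are equal if their images are, since this can be tested on the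
  covering arrows, where \<open>\<beta>\<close> is injective.  For surjectivity, the preimages over the covering
  arrows have to be glued.  Their compatibility is a statement about objects outside of \<open>E\<close>, but
  there it follows from the injectivity just obtained.\<close>
lemma iso_of_sheaves_if_bij_on_covering_objects:
  assumes \<beta>: "is_nat_trans C \<beta>" and X: "is_sheaf C cov (source \<beta>)" and Y: "is_sheaf C cov (target \<beta>)"
    and cov: "\<And>p f. p \<in> obj C \<Longrightarrow> f \<in> cov p \<Longrightarrow> f \<in> arr C \<and> cod C f = p \<and> dom C f \<in> E"
    and bij: "\<And>e. e \<in> obj C \<Longrightarrow> e \<in> E \<Longrightarrow> bij_betw (component \<beta> e) (sec (source \<beta>) e) (sec (target \<beta>) e)"
  shows "iso (Psh C) \<beta>"
proof (rule bij_iso_Psh[OF \<beta>])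
  let ?X = "source \<beta>" and ?Y = "target \<beta>"
  have psh: "is_presheaf C ?X" "is_presheaf C ?Y" using nat_transD[OF \<beta>] by auto
  note nat = nat_transD(6)[OF \<beta>]
  have inj: "x = y" if p: "p \<in> obj C" and xy: "x \<in> sec ?X p" "y \<in> sec ?X p"
      and eq: "component \<beta> p x = component \<beta> p y" for p x y
  proof (rule sheaf_separated[OF X p xy])
    show "f \<in> cov p \<Longrightarrow> f \<in> arr C \<and> cod C f = p" for f using cov[OF p] by blast
    fix f assume f: "f \<in> cov p"
    have "component \<beta> (dom C f) (res ?X f x) = component \<beta> (dom C f) (res ?X f y)"
      using nat[of f x] nat[of f y] cov[OF p f] xy eq by auto
    moreover have "res ?X f x \<in> sec ?X (dom C f)" "res ?X f y \<in> sec ?X (dom C f)"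
      using presheafD(4)[OF psh(1)] cov[OF p f] xy by auto
    ultimately show "res ?X f x = res ?X f y"
      using bij[of "dom C f"] cov[OF p f] dom_obj by (auto simp: bij_betw_def inj_on_def)
  qed
  fix p assume p: "p \<in> obj C"
  have surj: "\<exists>x \<in> sec ?X p. component \<beta> p x = y" if y: "y \<in> sec ?Y p" for y
  proof -
    have "\<exists>z. z \<in> sec ?X (dom C f) \<and> component \<beta> (dom C f) z = res ?Y f y" if f: "f \<in> cov p" for f
    proof -
      have "res ?Y f y \<in> sec ?Y (dom C f)"
        using presheafD(4)[OF psh(2)] cov[OF p f] y by auto
      then show ?thesis
        using bij_betw_the_inv_into_facts[OF bij[of "dom C f"]] cov[OF p f] dom_obj by metis
    qed
    then have "\<forall>f \<in> cov p. \<exists>z. z \<in> sec ?X (dom C f) \<and> component \<beta> (dom C f) z = res ?Y f y" ..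
    from bchoice[OF this] obtain s where "\<forall>f \<in> cov p. s f \<in> sec ?X (dom C f) \<and>
        component \<beta> (dom C f) (s f) = res ?Y f y" ..
    then have s: "\<And>f. f \<in> cov p \<Longrightarrow> s f \<in> sec ?X (dom C f)"
        "\<And>f. f \<in> cov p \<Longrightarrow> component \<beta> (dom C f) (s f) = res ?Y f y"
      by auto
    have "compatible C (cov p) ?X s"
      unfolding compatible_def
    proof (intro conjI ballI impI)
      fix f f' g g'
      assume *: "f \<in> cov p" "f' \<in> cov p" "g \<in> arr C" "g' \<in> arr C"
        and eq: "dom C g = dom C g' \<and> cod C g = dom C f \<and> cod C g' = dom C f' \<and> compo C f g = compo C f' g'"
      have "component \<beta> (dom C g) (res ?X g (s f)) = res ?Y (compo C f g) y"
        using nat[OF *(3), of "s f"] s[OF *(1)] eq * cov[OF p *(1)] y presheafD(6)[OF psh(2), of g f y] by auto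
      moreover have "component \<beta> (dom C g') (res ?X g' (s f')) = res ?Y (compo C f' g') y"
        using nat[OF *(4), of "s f'"] s[OF *(2)] eq * cov[OF p *(2)] y presheafD(6)[OF psh(2), of g' f' y] by auto
      ultimately show "res ?X g (s f) = res ?X g' (s f')"
        using inj[of "dom C g" "res ?X g (s f)" "res ?X g' (s f')"] eq * s(1)[OF *(1)] s(1)[OF *(2)]
          dom_obj presheafD(4)[OF psh(1)] by metis
    qed (use s in auto)
    then obtain x where x: "x \<in> sec ?X p" "\<And>f. f \<in> cov p \<Longrightarrow> res ?X f x = s f"
      using X p unfolding is_sheaf_def by blast
    have "component \<beta> p x = y"
    proof (rule sheaf_separated[OF Y p _ y])
      show "component \<beta> p x \<in> sec ?Y p" using nat_transD(5)[OF \<beta> p] x by blast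
      show "f \<in> cov p \<Longrightarrow> f \<in> arr C \<and> cod C f = p" for f using cov[OF p] by blast
      show "res ?Y f (component \<beta> p x) = res ?Y f y" if f: "f \<in> cov p" for f
        using nat[of f x] cov[OF p f] x s f by auto
    qed
    then show ?thesis using x by blast
  qed
  show "bij_betw (component \<beta> p) (sec ?X p) (sec ?Y p)"
    unfolding bij_betw_def using inj[OF p] surj nat_transD(5)[OF \<beta> p]
    by (auto intro!: inj_onI) (metis image_iff)
qed

end

section \<open>Right Kan extension from the elementary objects\<close>

lemma ex1_unique: "\<exists>!x. P x \<and> f x = a \<Longrightarrow> P x \<Longrightarrow> f x = a \<Longrightarrow> P y \<Longrightarrow> f y = a \<Longrightarrow> x = y"
  by blast

lemma pull_inclusion_simps [simp]:
  "a \<in> obj A \<Longrightarrow> sec (pull_presheaf A inclusion X) a = sec X a"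
  "f \<in> arr A \<Longrightarrow> res (pull_presheaf A inclusion X) f = res X f"
  "source (pull_nat_trans A inclusion \<eta>) = pull_presheaf A inclusion (source \<eta>)"
  "target (pull_nat_trans A inclusion \<eta>) = pull_presheaf A inclusion (target \<eta>)"
  "a \<in> obj A \<Longrightarrow> component (pull_nat_trans A inclusion \<eta>) a = component \<eta> a"
  by (auto simp: pull_presheaf_def pull_nat_trans_def inclusion_def)

text \<open>The sections of a right Kan extension are families indexed by arrows; \<open>H\<close> turns such families
  into elements of the universe \<open>'u\<close>.\<close>

locale category_with_elementary_objects = category C
  for C :: "('a, 'm) category_data" +
  fixes E :: "'a set" and H :: "('m \<Rightarrow> 'u) \<Rightarrow> 'u"
  assumes inj_H: "inj H"
begin

abbreviation "El \<equiv> full_sub C E"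

lemma El_simps [simp]:
  "a \<in> obj El \<longleftrightarrow> a \<in> obj C \<and> a \<in> E"
  "f \<in> arr El \<longleftrightarrow> f \<in> arr C \<and> dom C f \<in> E \<and> cod C f \<in> E"
  "dom El = dom C" "cod El = cod C" "idt El = idt C" "compo El = compo C"
  by (auto simp: full_sub_def)

interpretation El: category El
  by (rule full_sub_category)
interpretation Psh: category "Psh C"
  by (rule Psh_category)
interpretation PshEl: category "Psh El"
  by (rule El.Psh_category)

lemma inclusion_functor: "is_functor El C inclusion"
  using category_axioms El.category_axioms
  by (auto simp: is_functor_def inclusion_def hom_def)

lemma pull_is_presheaf: "is_presheaf C X \<Longrightarrow> is_presheaf El (pull_presheaf El inclusion X)"
  by (auto simp: is_presheaf_def pull_presheaf_def inclusion_def dom_obj cod_obj idt_arr compo_arr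
        dom_idt cod_idt PiE_iff)

lemma pull_is_nat_trans: "is_nat_trans C \<eta> \<Longrightarrow> is_nat_trans El (pull_nat_trans El inclusion \<eta>)"
  by (auto simp: is_nat_trans_def pull_is_presheaf)
     (auto simp: pull_nat_trans_def pull_presheaf_def inclusion_def dom_obj cod_obj PiE_iff)

lemma pull_compo:
  assumes "is_nat_trans C \<eta>" "is_nat_trans C \<theta>" "target \<eta> = source \<theta>"
  shows "pull_nat_trans El inclusion (compo (Psh C) \<theta> \<eta>) =
    compo (Psh El) (pull_nat_trans El inclusion \<theta>) (pull_nat_trans El inclusion \<eta>)"
  using assms
  by (intro nat_trans_eqI[where C = El] El.nat_trans_compo pull_is_nat_trans nat_trans_compo) auto

lemma pull_idt:
  assumes "is_presheaf C X"
  shows "pull_nat_trans El inclusion (idt (Psh C) X) = idt (Psh El) (pull_presheaf El inclusion X)"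
  using assms
  by (intro nat_trans_eqI[where C = El] El.nat_trans_idt pull_is_nat_trans nat_trans_idt pull_is_presheaf) auto

definition over :: "'a \<Rightarrow> 'm set" where
  "over p = {f \<in> arr C. cod C f = p \<and> dom C f \<in> E}"

text \<open>The limit of \<open>Y\<close> over the arrows from elementary objects to \<open>p\<close>, that is, the pointwise
  formula for the right Kan extension along the inclusion.\<close>

definition matching_families :: "('a, 'm, 'u) presheaf \<Rightarrow> 'a \<Rightarrow> ('m \<Rightarrow> 'u) set" where
  "matching_families Y p = {y \<in> (\<Pi>\<^sub>E f \<in> over p. sec Y (dom C f)).
     \<forall>f \<in> over p. \<forall>k \<in> over (dom C f). y (compo C f k) = res Y k (y f)}"

lemma overD: "f \<in> over p \<Longrightarrow> f \<in> arr C" "f \<in> over p \<Longrightarrow> cod C f = p" "f \<in> over p \<Longrightarrow> dom C f \<in> E"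
  and over_dom_obj: "f \<in> over p \<Longrightarrow> dom C f \<in> obj C"
  by (auto simp: over_def dom_obj)

lemma over_compo: "f \<in> arr C \<Longrightarrow> cod C f = p \<Longrightarrow> k \<in> over (dom C f) \<Longrightarrow> compo C f k \<in> over p"
  by (auto simp: over_def compo_arr)

lemma idt_over: "e \<in> obj C \<Longrightarrow> e \<in> E \<Longrightarrow> idt C e \<in> over e"
  by (auto simp: over_def idt_arr dom_idt cod_idt)

lemma over_arr_El: "k \<in> over e \<Longrightarrow> e \<in> E \<Longrightarrow> k \<in> arr El"
  by (auto simp: over_def)

lemma matching_familiesD:
  assumes "y \<in> matching_families Y p"
  shows "y \<in> extensional (over p)" "f \<in> over p \<Longrightarrow> y f \<in> sec Y (dom C f)"
    "f \<in> over p \<Longrightarrow> k \<in> over (dom C f) \<Longrightarrow> y (compo C f k) = res Y k (y f)"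
  using assms by (auto simp: matching_families_def PiE_def)

definition restrict_family :: "'m \<Rightarrow> ('m \<Rightarrow> 'u) \<Rightarrow> 'm \<Rightarrow> 'u" where
  "restrict_family f y = (\<lambda>k \<in> over (dom C f). y (compo C f k))"

lemma restrict_family_matching:
  assumes f: "f \<in> arr C" and y: "y \<in> matching_families Y (cod C f)"
  shows "restrict_family f y \<in> matching_families Y (dom C f)"
proof -
  have "y (compo C f (compo C k l)) = res Y l (y (compo C f k))"
    if "k \<in> over (dom C f)" "l \<in> over (dom C k)" for k l
    using that f y over_compo[of f] matching_familiesD(3)[OF y, of "compo C f k" l]
    by (auto simp: compo_assoc_arr overD compo_arr)
  moreover have "y (compo C f k) \<in> sec Y (dom C k)" if "k \<in> over (dom C f)" for k
    using matching_familiesD(2)[OF y over_compo[OF f refl that]] f that by (simp add: compo_arr overD)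
  ultimately show ?thesis
    using over_compo[of _ "dom C f"]
    by (auto simp: matching_families_def restrict_family_def compo_arr overD)
qed

definition ran :: "('a, 'm, 'u) presheaf \<Rightarrow> ('a, 'm, 'u) presheaf" where
  "ran Y = \<lparr>sec = \<lambda>p\<in>obj C. H ` matching_families Y p,
     res = \<lambda>f\<in>arr C. \<lambda>x\<in>H ` matching_families Y (cod C f). H (restrict_family f (inv H x))\<rparr>"

lemma inv_H [simp]: "inv H (H y) = y"
  by (simp add: inj_H)

lemma sec_ran: "p \<in> obj C \<Longrightarrow> sec (ran Y) p = H ` matching_families Y p"
  by (simp add: ran_def)

lemma res_ran: "f \<in> arr C \<Longrightarrow> y \<in> matching_families Y (cod C f) \<Longrightarrow>
    res (ran Y) f (H y) = H (restrict_family f y)"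
  by (simp add: ran_def)

lemma restrict_family_idt:
  assumes "p \<in> obj C" "y \<in> matching_families Y p"
  shows "restrict_family (idt C p) y = y"
proof
  fix k
  show "restrict_family (idt C p) y k = y k"
    using assms extensional_arb[OF matching_familiesD(1)[OF assms(2)], of k] compo_idt_left[of k]
    by (cases "k \<in> over p") (simp_all add: restrict_family_def dom_idt overD)
qed

lemma restrict_family_compo:
  assumes "f \<in> arr C" "g \<in> arr C" "cod C f = dom C g"
  shows "restrict_family (compo C g f) y = restrict_family f (restrict_family g y)"
proof
  fix k
  have "compo C (compo C g f) k = compo C g (compo C f k)" if "k \<in> over (dom C f)"
    using assms that by (intro compo_assoc_arr[symmetric]) (auto simp: overD)
  then show "restrict_family (compo C g f) y k = restrict_family f (restrict_family g y) k"
    using assms over_compo[of f "dom C g" k] by (simp add: restrict_family_def compo_arr)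
qed

lemma ran_is_presheaf: "is_presheaf C (ran Y)"
  unfolding is_presheaf_def
proof (intro conjI ballI impI)
  show "sec (ran Y) \<in> extensional (obj C)" "res (ran Y) \<in> extensional (arr C)"
    by (auto simp: ran_def)
next
  fix f assume f: "f \<in> arr C"
  show "res (ran Y) f \<in> sec (ran Y) (cod C f) \<rightarrow>\<^sub>E sec (ran Y) (dom C f)"
    using f restrict_family_matching[OF f, of _ Y] by (auto simp: ran_def dom_obj cod_obj)
next
  fix a x assume "a \<in> obj C" "x \<in> sec (ran Y) a"
  then show "res (ran Y) (idt C a) x = x"
    by (auto simp: sec_ran res_ran idt_arr cod_idt restrict_family_idt)
next
  fix f g x assume "f \<in> arr C" "g \<in> arr C" "cod C f = dom C g" "x \<in> sec (ran Y) (cod C g)"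
  then show "res (ran Y) (compo C g f) x = res (ran Y) f (res (ran Y) g x)"
    using restrict_family_matching[of g]
    by (auto simp: sec_ran cod_obj res_ran compo_arr restrict_family_compo)
qed

text \<open>The transpose of \<open>\<alpha>\<close>: a section over \<open>p\<close> is sent to the family of its restrictions to
  elementary objects, with \<open>\<alpha>\<close> applied to them.\<close>

definition mediating :: "('a, 'm, 'u) presheaf \<Rightarrow> ('a, 'm, 'u) nat_trans \<Rightarrow> ('a, 'm, 'u) nat_trans" where
  "mediating X \<alpha> = \<lparr>source = X, target = ran (target \<alpha>),
     component = \<lambda>p\<in>obj C. \<lambda>x\<in>sec X p. H (\<lambda>f\<in>over p. component \<alpha> (dom C f) (res X f x))\<rparr>"

definition counit :: "('a, 'm, 'u) presheaf \<Rightarrow> ('a, 'm, 'u) nat_trans" where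
  "counit Y = \<lparr>source = pull_presheaf El inclusion (ran Y), target = Y,
     component = \<lambda>e\<in>obj El. \<lambda>x\<in>sec (ran Y) e. inv H x (idt C e)\<rparr>"

definition ran_functor :: "('a, 'm, 'a, 'm, 'u) psh_functor" where
  "ran_functor = \<lparr>on_obj = ran,
     on_arr = \<lambda>\<phi>. mediating (ran (source \<phi>)) (compo (Psh El) \<phi> (counit (source \<phi>)))\<rparr>"

context
  fixes Y :: "('a, 'm, 'u) presheaf" assumes Y: "is_presheaf El Y"
begin

lemma counit_nat_trans: "is_nat_trans El (counit Y)"
  unfolding is_nat_trans_def
proof (intro conjI ballI)
  show "is_presheaf El (source (counit Y))" "is_presheaf El (target (counit Y))"
    using Y by (auto simp: counit_def pull_is_presheaf ran_is_presheaf)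
  show "component (counit Y) \<in> extensional (obj El)" by (simp add: counit_def)
next
  fix e assume e: "e \<in> obj El"
  then show "component (counit Y) e \<in> sec (source (counit Y)) e \<rightarrow>\<^sub>E sec (target (counit Y)) e"
    using matching_familiesD(2)[of _ Y e "idt C e"]
    by (auto simp: counit_def sec_ran idt_over dom_idt)
next
  fix f x assume f: "f \<in> arr El" and x: "x \<in> sec (source (counit Y)) (cod El f)"
  have fo: "f \<in> over (cod C f)" using f by (auto simp: over_def)
  obtain y where y: "x = H y" "y \<in> matching_families Y (cod C f)"
    using x f by (auto simp: counit_def sec_ran cod_obj)
  have "y f = res Y f (y (idt C (cod C f)))"
    using matching_familiesD(3)[OF y(2), of "idt C (cod C f)" f] f fo
    by (auto simp: idt_over cod_obj dom_idt compo_idt_left)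
  then show "component (counit Y) (dom El f) (res (source (counit Y)) f x) =
      res (target (counit Y)) f (component (counit Y) (cod El f) x)"
    using f y restrict_family_matching[OF _ y(2)]
    by (auto simp: counit_def dom_obj cod_obj sec_ran res_ran restrict_family_def idt_over compo_idt_right)
qed

lemma counit_component:
  "e \<in> obj C \<Longrightarrow> e \<in> E \<Longrightarrow> y \<in> matching_families Y e \<Longrightarrow> component (counit Y) e (H y) = y (idt C e)"
  by (auto simp: counit_def sec_ran)

text \<open>The arrows from elementary objects to an elementary object \<open>e\<close> have a terminal one, the
  identity of \<open>e\<close>, so that a matching family over \<open>e\<close> is given by its value there.\<close>

lemma counit_iso: "iso (Psh El) (counit Y)"
proof (rule El.bij_iso_Psh[OF counit_nat_trans])
  fix e assume e: "e \<in> obj El"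
  have det: "y k = res Y k (y (idt C e))" if "y \<in> matching_families Y e" "k \<in> over e" for y k
    using matching_familiesD(3)[OF that(1), of "idt C e" k] that e compo_idt_left[of k]
    by (auto simp: idt_over dom_idt overD)
  have inj: "y = z" if "y \<in> matching_families Y e" "z \<in> matching_families Y e"
      "y (idt C e) = z (idt C e)" for y z
    using that det[OF that(1)] det[OF that(2)] matching_familiesD(1)[OF that(1)] matching_familiesD(1)[OF that(2)]
    by (intro extensionalityI[of y "over e" z]) auto
  have surj: "\<exists>y \<in> matching_families Y e. y (idt C e) = u" if u: "u \<in> sec Y e" for u
  proof -
    let ?y = "\<lambda>k\<in>over e. res Y k u"
    have "res Y k u \<in> sec Y (dom C k)" if "k \<in> over e" for k
      using presheafD(4)[OF Y over_arr_El[OF that]] e u that by (auto simp: overD)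
    moreover have "res Y (compo C k l) u = res Y l (res Y k u)" if "k \<in> over e" "l \<in> over (dom C k)" for k l
      using presheafD(6)[OF Y, of l k u] that e u over_arr_El by (auto simp: overD)
    ultimately have "?y \<in> matching_families Y e"
      by (auto simp: matching_families_def over_compo overD)
    moreover have "?y (idt C e) = u" using presheafD(5)[OF Y _ u] e by (simp add: idt_over)
    ultimately show ?thesis by blast
  qed
  show "bij_betw (component (counit Y) e) (sec (source (counit Y)) e) (sec (target (counit Y)) e)"
    unfolding bij_betw_def
  proof
    show "inj_on (component (counit Y) e) (sec (source (counit Y)) e)"
      using inj e by (auto simp: inj_on_def counit_def sec_ran)
    show "component (counit Y) e ` sec (source (counit Y)) e = sec (target (counit Y)) e"
      using surj e matching_familiesD(2)[of _ Y e "idt C e"]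
      by (force simp: counit_def sec_ran image_image idt_over dom_idt image_iff)
  qed
qed

lemma mediating_nat_trans:
  assumes X: "is_presheaf C X" and \<alpha>: "\<alpha> \<in> hom (Psh El) (pull_presheaf El inclusion X) Y"
  shows "is_nat_trans C (mediating X \<alpha>)"
    and "p \<in> obj C \<Longrightarrow> x \<in> sec X p \<Longrightarrow>
      (\<lambda>f\<in>over p. component \<alpha> (dom C f) (res X f x)) \<in> matching_families Y p"
proof -
  have \<alpha>': "is_nat_trans El \<alpha>" "source \<alpha> = pull_presheaf El inclusion X" "target \<alpha> = Y"
    using \<alpha> by (auto simp: hom_def)
  let ?y = "\<lambda>p x. \<lambda>f\<in>over p. component \<alpha> (dom C f) (res X f x)"
  show fam: "?y p x \<in> matching_families Y p" if p: "p \<in> obj C" and x: "x \<in> sec X p" for p x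
  proof -
    have r: "res X f x \<in> sec X (dom C f)" if "f \<in> over p" for f
      using presheafD(4)[OF X, of f x] x that by (auto simp: overD)
    have "component \<alpha> (dom C f) (res X f x) \<in> sec Y (dom C f)" if "f \<in> over p" for f
      using nat_transD(5)[OF \<alpha>'(1), of "dom C f" "res X f x"] r[OF that] that \<alpha>'
      by (auto simp: overD over_dom_obj)
    moreover have "component \<alpha> (dom C k) (res X (compo C f k) x) = res Y k (component \<alpha> (dom C f) (res X f x))"
      if "f \<in> over p" "k \<in> over (dom C f)" for f k
      using nat_transD(6)[OF \<alpha>'(1), of k "res X f x"] presheafD(6)[OF X, of k f x] r that \<alpha>' x
      by (auto simp: overD over_dom_obj)
    ultimately show ?thesis
      by (auto simp: matching_families_def over_compo overD compo_arr)
  qed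
  show "is_nat_trans C (mediating X \<alpha>)"
    unfolding is_nat_trans_def
  proof (intro conjI ballI)
    fix f x assume f: "f \<in> arr C" and x: "x \<in> sec (source (mediating X \<alpha>)) (cod C f)"
    have "res X f x \<in> sec X (dom C f)" using presheafD(4)[OF X f] x by (simp add: mediating_def)
    moreover have "restrict_family f (?y (cod C f) x) = ?y (dom C f) (res X f x)"
      using f x presheafD(6)[OF X, of _ f x]
      by (auto simp: restrict_family_def over_compo mediating_def overD compo_arr)
    ultimately show "component (mediating X \<alpha>) (dom C f) (res (source (mediating X \<alpha>)) f x) =
        res (target (mediating X \<alpha>)) f (component (mediating X \<alpha>) (cod C f) x)"
      using f x fam[of "cod C f" x] by (auto simp: mediating_def dom_obj cod_obj res_ran \<alpha>')
  qed (use fam in \<open>auto simp: mediating_def X ran_is_presheaf \<alpha>' sec_ran\<close>)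
qed

lemma mediating_factorizes:
  assumes X: "is_presheaf C X" and \<alpha>: "\<alpha> \<in> hom (Psh El) (pull_presheaf El inclusion X) Y"
  shows "compo (Psh El) (counit Y) (pull_nat_trans El inclusion (mediating X \<alpha>)) = \<alpha>"
proof (rule nat_trans_eqI[where C = El])
  have \<alpha>': "is_nat_trans El \<alpha>" "source \<alpha> = pull_presheaf El inclusion X" "target \<alpha> = Y"
    using \<alpha> by (auto simp: hom_def)
  show "is_nat_trans El (compo (Psh El) (counit Y) (pull_nat_trans El inclusion (mediating X \<alpha>)))"
    using mediating_nat_trans[OF assms]
    by (intro El.nat_trans_compo counit_nat_trans pull_is_nat_trans) (auto simp: counit_def mediating_def \<alpha>')
  fix e x assume e: "e \<in> obj El"
    and "x \<in> sec (source (compo (Psh El) (counit Y) (pull_nat_trans El inclusion (mediating X \<alpha>)))) e"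
  then have x: "x \<in> sec X e" by (simp add: mediating_def)
  show "component (compo (Psh El) (counit Y) (pull_nat_trans El inclusion (mediating X \<alpha>))) e x =
      component \<alpha> e x"
    using e x mediating_nat_trans(2)[OF assms, of e x] presheafD(5)[OF X]
    by (auto simp: mediating_def counit_component idt_over dom_idt)
qed (use \<alpha> in \<open>auto simp: hom_def mediating_def counit_def\<close>)

lemma mediating_unique:
  assumes X: "is_presheaf C X" and \<beta>: "\<beta> \<in> hom (Psh C) X (ran Y)"
    and \<alpha>: "compo (Psh El) (counit Y) (pull_nat_trans El inclusion \<beta>) = \<alpha>"
  shows "\<beta> = mediating X \<alpha>"
proof (rule nat_trans_eqI[where C = C])
  have \<beta>': "is_nat_trans C \<beta>" "source \<beta> = X" "target \<beta> = ran Y" using \<beta> by (auto simp: hom_def)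
  have nt: "is_nat_trans El \<alpha>"
    unfolding \<alpha>[symmetric] using \<beta>'
    by (intro El.nat_trans_compo counit_nat_trans pull_is_nat_trans) (auto simp: counit_def)
  have st: "source \<alpha> = pull_presheaf El inclusion X" "target \<alpha> = Y"
    unfolding \<alpha>[symmetric] by (auto simp: \<beta>' counit_def)
  show "is_nat_trans C \<beta>" by fact
  show "is_nat_trans C (mediating X \<alpha>)"
    using nt st by (intro mediating_nat_trans X) (simp add: hom_def)
  show "source \<beta> = source (mediating X \<alpha>)" "target \<beta> = target (mediating X \<alpha>)"
    using \<beta>' st by (auto simp: mediating_def)
  fix p x assume p: "p \<in> obj C" and "x \<in> sec (source \<beta>) p"
  then have x: "x \<in> sec X p" by (simp add: \<beta>')
  obtain y where y: "component \<beta> p x = H y" "y \<in> matching_families Y p"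
    using nat_transD(5)[OF \<beta>'(1) p] x p by (auto simp: \<beta>' sec_ran)
  have "y f = component \<alpha> (dom C f) (res X f x)" if f: "f \<in> over p" for f
  proof -
    have r: "res X f x \<in> sec X (dom C f)" using presheafD(4)[OF X, of f x] x f by (auto simp: overD)
    have "component \<beta> (dom C f) (res X f x) = H (restrict_family f y)"
      using nat_transD(6)[OF \<beta>'(1), of f x] f x y by (auto simp: \<beta>' overD res_ran)
    moreover have "restrict_family f y \<in> matching_families Y (dom C f)"
      using restrict_family_matching[of f y Y] y f by (auto simp: overD)
    ultimately have "component \<alpha> (dom C f) (res X f x) = restrict_family f y (idt C (dom C f))"
      unfolding \<alpha>[symmetric] using r f by (auto simp: \<beta>' overD over_dom_obj counit_component)
    also have "\<dots> = y f"
      using f by (simp add: restrict_family_def idt_over overD over_dom_obj compo_idt_right)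
    finally show ?thesis ..
  qed
  then have "y = (\<lambda>f\<in>over p. component \<alpha> (dom C f) (res X f x))"
    using matching_familiesD(1)[OF y(2)] by (intro extensionalityI[of y "over p"]) auto
  then show "component \<beta> p x = component (mediating X \<alpha>) p x"
    using p x y by (simp add: mediating_def)
qed

text \<open>A compatible family of sections over a covering family prescribes the value of a matching
  family at every arrow that factors through the covering family, and compatibility says that the
  value does not depend on the factorization.  If all arrows from elementary objects factor, the
  matching family is thereby determined.\<close>

lemma ran_is_sheaf:
  assumes cov: "\<And>p f. p \<in> obj C \<Longrightarrow> f \<in> cov p \<Longrightarrow> f \<in> over p"
    and factor: "\<And>p f. p \<in> obj C \<Longrightarrow> f \<in> over p \<Longrightarrow> \<exists>h \<in> cov p. \<exists>k \<in> over (dom C h). compo C h k = f"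
  shows "is_sheaf C cov (ran Y)"
  unfolding is_sheaf_def
proof (intro conjI ballI allI impI)
  show "is_presheaf C (ran Y)" by (rule ran_is_presheaf)
  fix p s assume p: "p \<in> obj C" and s: "compatible C (cov p) (ran Y) s"
  note covD = overD[OF cov[OF p]]
  define t where "t f = inv H (s f)" for f
  have t: "s f = H (t f)" "t f \<in> matching_families Y (dom C f)" if "f \<in> cov p" for f
  proof -
    have "s f \<in> sec (ran Y) (dom C f)" using s that by (simp add: compatible_def)
    then show "s f = H (t f)" "t f \<in> matching_families Y (dom C f)"
      using over_dom_obj[OF cov[OF p that]] by (auto simp: t_def sec_ran)
  qed
  have t_eq: "t h k = t h' k'"
    if h: "h \<in> cov p" "h' \<in> cov p" and k: "k \<in> over (dom C h)" "k' \<in> over (dom C h')"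
      and eq: "compo C h k = compo C h' k'" for h h' k k'
  proof -
    have d: "dom C k = dom C k'"
      using compo_arr(2)[of k h] compo_arr(2)[of k' h'] h k eq covD by (auto simp: overD)
    have "res (ran Y) k (s h) = res (ran Y) k' (s h')"
      using s h k eq d overD unfolding compatible_def by metis
    then have "restrict_family k (t h) = restrict_family k' (t h')"
      using t h k by (auto simp: overD res_ran dest: injD[OF inj_H])
    then have "restrict_family k (t h) (idt C (dom C k)) = restrict_family k' (t h') (idt C (dom C k'))"
      using d by simp
    then show ?thesis
      using k by (simp add: restrict_family_def idt_over overD over_dom_obj compo_idt_right)
  qed
  obtain hh kk where hk: "\<And>f. f \<in> over p \<Longrightarrow> hh f \<in> cov p" "\<And>f. f \<in> over p \<Longrightarrow> kk f \<in> over (dom C (hh f))"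
      "\<And>f. f \<in> over p \<Longrightarrow> compo C (hh f) (kk f) = f"
    using factor[OF p] by metis
  define y where "y = (\<lambda>f\<in>over p. t (hh f) (kk f))"
  have y_compo: "y (compo C h k) = t h k" if "h \<in> cov p" "k \<in> over (dom C h)" for h k
    using that over_compo[of h p k] covD hk[of "compo C h k"] by (auto simp: y_def intro!: t_eq)
  have y: "y \<in> matching_families Y p"
    unfolding matching_families_def
  proof (intro CollectI conjI ballI)
    have "t (hh f) (kk f) \<in> sec Y (dom C f)" if "f \<in> over p" for f
      using matching_familiesD(2)[OF t(2)[OF hk(1)[OF that]] hk(2)[OF that]] hk[OF that]
        compo_arr(2)[of "kk f" "hh f"] covD overD by metis
    then show "y \<in> (\<Pi>\<^sub>E f \<in> over p. sec Y (dom C f))" by (auto simp: y_def)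
    fix f k assume f: "f \<in> over p" and k: "k \<in> over (dom C f)"
    have d: "dom C (kk f) = dom C f"
      using hk[OF f] compo_arr(2)[of "kk f" "hh f"] covD overD by metis
    have kk: "compo C (kk f) k \<in> over (dom C (hh f))"
      using hk[OF f] k d over_compo[of "kk f"] by (auto simp: overD)
    have "compo C f k = compo C (compo C (hh f) (kk f)) k" using hk[OF f] by simp
    also have "\<dots> = compo C (hh f) (compo C (kk f) k)"
      using hk[OF f] k d covD by (intro compo_assoc_arr[symmetric]) (auto simp: overD)
    finally have "y (compo C f k) = t (hh f) (compo C (kk f) k)"
      using y_compo hk[OF f] kk by simp
    also have "\<dots> = res Y k (t (hh f) (kk f))"
      using matching_familiesD(3)[OF t(2)[OF hk(1)[OF f]] hk(2)[OF f]] k d by simp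
    finally show "y (compo C f k) = res Y k (y f)" using f by (simp add: y_def)
  qed
  show "\<exists>!x. x \<in> sec (ran Y) p \<and> (\<forall>f\<in>cov p. res (ran Y) f x = s f)"
  proof (rule ex1I[of _ "H y"], intro conjI ballI)
    show "H y \<in> sec (ran Y) p" using y p by (simp add: sec_ran)
    fix h assume h: "h \<in> cov p"
    have "restrict_family h y = t h"
      using y_compo[OF h] matching_familiesD(1)[OF t(2)[OF h]]
      by (intro extensionalityI[of _ "over (dom C h)"]) (auto simp: restrict_family_def)
    then show "res (ran Y) h (H y) = s h"
      using t[OF h] y covD[OF h] by (simp add: res_ran)
  next
    fix x assume x: "x \<in> sec (ran Y) p \<and> (\<forall>f\<in>cov p. res (ran Y) f x = s f)"
    then obtain z where z: "x = H z" "z \<in> matching_families Y p" using p by (auto simp: sec_ran)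
    have r: "restrict_family h z = t h" if "h \<in> cov p" for h
    proof -
      have "res (ran Y) h (H z) = H (restrict_family h z)"
        using z covD[OF that] by (intro res_ran) auto
      then show ?thesis using x z t[OF that] that by (auto dest: injD[OF inj_H])
    qed
    have "z f = y f" if f: "f \<in> over p" for f
      using fun_cong[OF r[OF hk(1)[OF f]], of "kk f"] hk[OF f] f by (simp add: restrict_family_def y_def)
    then have "z = y"
      using matching_familiesD(1)[OF z(2)] matching_familiesD(1)[OF y]
      by (intro extensionalityI[of _ "over p"]) auto
    then show "x = H y" using z by simp
  qed
qed

end

lemma ran_functor_right_Kan: "is_right_Kan_extension El C inclusion ran_functor counit"
proof -
  have [simp]: "source (counit Y) = pull_presheaf El inclusion (ran Y)" "target (counit Y) = Y"
      for Y :: "('a, 'm, 'u) presheaf"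
    by (simp_all add: counit_def)
  have fm: "compo (Psh El) \<phi> (counit (source \<phi>)) \<in>
      hom (Psh El) (pull_presheaf El inclusion (ran (source \<phi>))) (target \<phi>)"
    if "is_nat_trans El \<phi>" for \<phi>
    using that nat_transD(1)[OF that] by (auto simp: hom_def intro!: El.nat_trans_compo counit_nat_trans)
  have med: "mediating (ran (source \<phi>)) (compo (Psh El) \<phi> (counit (source \<phi>)))
      \<in> hom (Psh C) (ran (source \<phi>)) (ran (target \<phi>))" if "is_nat_trans El \<phi>" for \<phi>
    using mediating_nat_trans(1)[OF nat_transD(2)[OF that] ran_is_presheaf fm[OF that]]
    by (simp add: hom_def mediating_def)
  have nat: "compo (Psh El) (counit (target \<phi>)) (pull_nat_trans El inclusion
        (mediating (ran (source \<phi>)) (compo (Psh El) \<phi> (counit (source \<phi>))))) =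
      compo (Psh El) \<phi> (counit (source \<phi>))" if "is_nat_trans El \<phi>" for \<phi>
    using mediating_factorizes[OF nat_transD(2)[OF that] ran_is_presheaf fm[OF that]] .
  have ran_fun: "is_functor (Psh El) (Psh C) ran_functor"
    unfolding is_functor_def
  proof (intro conjI ballI impI)
    fix Y :: "('a, 'm, 'u) presheaf" assume "Y \<in> obj (Psh El)"
    then have Y: "is_presheaf El Y" by simp
    have "idt (Psh C) (ran Y) = mediating (ran Y) (compo (Psh El) (idt (Psh El) Y) (counit Y))"
      using Y by (intro mediating_unique[OF Y ran_is_presheaf])
        (auto simp: hom_def nat_trans_idt ran_is_presheaf pull_idt PshEl.compo_idt_left[of "counit Y", simplified]
          PshEl.compo_idt_right[of "counit Y", simplified] counit_nat_trans)
    then show "on_arr ran_functor (idt (Psh El) Y) = idt (Psh C) (on_obj ran_functor Y)"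
      by (simp add: ran_functor_def)
  next
    fix f g :: "('a, 'm, 'u) nat_trans" assume "f \<in> arr (Psh El)" "g \<in> arr (Psh El)" "cod (Psh El) f = dom (Psh El) g"
    then have fg: "is_nat_trans El f" "is_nat_trans El g" "target f = source g" by auto
    let ?m = "\<lambda>\<phi>. mediating (ran (source \<phi>)) (compo (Psh El) \<phi> (counit (source \<phi>)))"
    have m: "is_nat_trans C (?m f)" "source (?m f) = ran (source f)" "target (?m f) = ran (target f)"
      "is_nat_trans C (?m g)" "source (?m g) = ran (source g)" "target (?m g) = ran (target g)"
      using med[OF fg(1)] med[OF fg(2)] by (auto simp: hom_def)
    have "compo (Psh C) (?m g) (?m f) = mediating (ran (source f))
       (compo (Psh El) (compo (Psh El) g f) (counit (source f)))"
    proof (rule mediating_unique[OF nat_transD(2)[OF fg(2)] ran_is_presheaf])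
      show "compo (Psh C) (?m g) (?m f) \<in> hom (Psh C) (ran (source f)) (ran (target g))"
        using m fg by (auto simp: hom_def intro!: nat_trans_compo)
      have c: "is_nat_trans El (counit (source g))" "is_nat_trans El (counit (target g))"
          "is_nat_trans El (counit (source f))"
        using fg by (auto intro!: counit_nat_trans dest: nat_transD)
      have "compo (Psh El) (counit (target g)) (pull_nat_trans El inclusion (compo (Psh C) (?m g) (?m f)))
        = compo (Psh El) (counit (target g)) (compo (Psh El) (pull_nat_trans El inclusion (?m g))
            (pull_nat_trans El inclusion (?m f)))"
        using m fg by (subst pull_compo) auto
      also have "\<dots> = compo (Psh El) (compo (Psh El) (counit (target g)) (pull_nat_trans El inclusion (?m g)))
            (pull_nat_trans El inclusion (?m f))"
        using m fg c by (intro PshEl.compo_assoc_arr) (auto intro!: pull_is_nat_trans)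
      also have "\<dots> = compo (Psh El) (compo (Psh El) g (counit (source g))) (pull_nat_trans El inclusion (?m f))"
        using nat[OF fg(2)] by simp
      also have "\<dots> = compo (Psh El) g (compo (Psh El) (counit (source g)) (pull_nat_trans El inclusion (?m f)))"
        using m fg c by (intro PshEl.compo_assoc_arr[symmetric]) (auto intro!: pull_is_nat_trans)
      also have "\<dots> = compo (Psh El) g (compo (Psh El) f (counit (source f)))"
        using nat[OF fg(1)] fg(3) by simp
      also have "\<dots> = compo (Psh El) (compo (Psh El) g f) (counit (source f))"
        using fg c by (intro PshEl.compo_assoc_arr) auto
      finally show "compo (Psh El) (counit (target g)) (pull_nat_trans El inclusion (compo (Psh C) (?m g) (?m f)))
        = compo (Psh El) (compo (Psh El) g f) (counit (source f))" .
    qed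
    then show "on_arr ran_functor (compo (Psh El) g f) =
       compo (Psh C) (on_arr ran_functor g) (on_arr ran_functor f)"
      by (simp add: ran_functor_def)
  qed (use med in \<open>auto simp: ran_functor_def ran_is_presheaf Psh.category_axioms PshEl.category_axioms\<close>)
  have univ: "\<exists>!\<beta>. \<beta> \<in> hom (Psh C) X (ran Y) \<and> compo (Psh El) (counit Y) (pull_nat_trans El inclusion \<beta>) = \<alpha>"
    if "is_presheaf El Y" "is_presheaf C X" "\<alpha> \<in> hom (Psh El) (pull_presheaf El inclusion X) Y"
      for X Y :: "('a, 'm, 'u) presheaf" and \<alpha>
  proof (rule ex1I[of _ "mediating X \<alpha>"])
    show "mediating X \<alpha> \<in> hom (Psh C) X (ran Y) \<and>
      compo (Psh El) (counit Y) (pull_nat_trans El inclusion (mediating X \<alpha>)) = \<alpha>"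
      using mediating_nat_trans(1)[OF that] mediating_factorizes[OF that] that(3)
      by (auto simp: hom_def mediating_def)
  qed (use mediating_unique[OF that(1,2)] in auto)
  show ?thesis
    unfolding is_right_Kan_extension_def
  proof (intro conjI ballI)
    fix Y X :: "('a, 'm, 'u) presheaf" and \<alpha>
    assume YX: "Y \<in> obj (Psh El)" "X \<in> obj (Psh C)" and \<alpha>: "\<alpha> \<in> hom (Psh El) (pull_presheaf El inclusion X) Y"
    show "\<exists>!\<beta>. \<beta> \<in> hom (Psh C) X (on_obj ran_functor Y) \<and>
        compo (Psh El) (counit Y) (pull_nat_trans El inclusion \<beta>) = \<alpha>"
      using univ[OF _ _ \<alpha>] YX by (simp add: ran_functor_def)
  qed (use inclusion_functor ran_fun nat in \<open>auto simp: ran_functor_def hom_def counit_nat_trans\<close>)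
qed

text \<open>Both \<open>\<epsilon> Y\<close> and \<open>counit Y\<close> are terminal among the arrows from a restricted presheaf to \<open>Y\<close>.
  This transfers what is known about the pointwise formula to an arbitrary Kan extension.\<close>

lemma Kan_extension_value_iso:
  assumes R: "is_right_Kan_extension El C inclusion R \<epsilon>" and Y: "is_presheaf El Y"
  obtains \<theta> where "iso (Psh C) \<theta>" "source \<theta> = ran Y" "target \<theta> = on_obj R Y"
    "compo (Psh El) (\<epsilon> Y) (pull_nat_trans El inclusion \<theta>) = counit Y"
proof -
  have RY: "is_presheaf C (on_obj R Y)"
    using R Y by (auto simp: is_right_Kan_extension_def is_functor_def)
  have \<epsilon>: "\<epsilon> Y \<in> hom (Psh El) (pull_presheaf El inclusion (on_obj R Y)) Y"
    using R Y by (auto simp: is_right_Kan_extension_def)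
  have ex1: "\<exists>!\<beta>. \<beta> \<in> hom (Psh C) X (on_obj R Y) \<and>
       compo (Psh El) (\<epsilon> Y) (pull_nat_trans El inclusion \<beta>) = \<alpha>"
    if "is_presheaf C X" "\<alpha> \<in> hom (Psh El) (pull_presheaf El inclusion X) Y" for X \<alpha>
    using R Y that by (auto simp: is_right_Kan_extension_def)
  have c: "counit Y \<in> hom (Psh El) (pull_presheaf El inclusion (ran Y)) Y"
    using counit_nat_trans[OF Y] by (simp add: hom_def counit_def)
  obtain \<theta> where \<theta>: "\<theta> \<in> hom (Psh C) (ran Y) (on_obj R Y)"
      "compo (Psh El) (\<epsilon> Y) (pull_nat_trans El inclusion \<theta>) = counit Y"
    using ex1[OF ran_is_presheaf c] by blast
  define \<rho> where "\<rho> = mediating (on_obj R Y) (\<epsilon> Y)"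
  have \<rho>: "\<rho> \<in> hom (Psh C) (on_obj R Y) (ran Y)"
      "compo (Psh El) (counit Y) (pull_nat_trans El inclusion \<rho>) = \<epsilon> Y"
    using mediating_nat_trans(1)[OF Y RY \<epsilon>] mediating_factorizes[OF Y RY \<epsilon>] \<epsilon>
    by (auto simp: \<rho>_def hom_def mediating_def)
  note D = \<theta>(1) \<rho>(1) c \<epsilon>
  have nt: "is_nat_trans C \<theta>" "is_nat_trans C \<rho>" "is_nat_trans El (counit Y)" "is_nat_trans El (\<epsilon> Y)"
    "source \<theta> = ran Y" "target \<theta> = on_obj R Y" "source \<rho> = on_obj R Y" "target \<rho> = ran Y"
    "source (counit Y) = pull_presheaf El inclusion (ran Y)" "target (counit Y) = Y"
    "source (\<epsilon> Y) = pull_presheaf El inclusion (on_obj R Y)" "target (\<epsilon> Y) = Y"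
    using D by (auto simp: hom_def)
  have "compo (Psh El) (\<epsilon> Y) (pull_nat_trans El inclusion (compo (Psh C) \<theta> \<rho>)) =
      compo (Psh El) (compo (Psh El) (\<epsilon> Y) (pull_nat_trans El inclusion \<theta>)) (pull_nat_trans El inclusion \<rho>)"
    using nt PshEl.compo_assoc_arr[of "pull_nat_trans El inclusion \<rho>" "pull_nat_trans El inclusion \<theta>" "\<epsilon> Y"]
    by (simp add: pull_compo pull_is_nat_trans)
  also have "\<dots> = compo (Psh El) (\<epsilon> Y) (pull_nat_trans El inclusion (idt (Psh C) (on_obj R Y)))"
    using \<theta>(2) \<rho>(2) nt RY PshEl.compo_idt_right[of "\<epsilon> Y"] by (simp add: pull_idt)
  also have "\<dots> = \<epsilon> Y"
    using nt RY PshEl.compo_idt_right[of "\<epsilon> Y"] by (simp add: pull_idt)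
  finally have e: "compo (Psh El) (\<epsilon> Y) (pull_nat_trans El inclusion (compo (Psh C) \<theta> \<rho>)) = \<epsilon> Y" .
  have "compo (Psh C) \<theta> \<rho> = idt (Psh C) (on_obj R Y)"
  proof (rule ex1_unique[OF ex1[OF RY \<epsilon>] _ e])
    show "compo (Psh El) (\<epsilon> Y) (pull_nat_trans El inclusion (idt (Psh C) (on_obj R Y))) = \<epsilon> Y"
      using nt RY PshEl.compo_idt_right[of "\<epsilon> Y"] by (simp add: pull_idt)
  qed (use nt RY in \<open>auto simp: hom_def nat_trans_compo nat_trans_idt\<close>)
  moreover have "compo (Psh El) (counit Y) (pull_nat_trans El inclusion (compo (Psh C) \<rho> \<theta>)) =
      compo (Psh El) (compo (Psh El) (counit Y) (pull_nat_trans El inclusion \<rho>)) (pull_nat_trans El inclusion \<theta>)"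
    using nt PshEl.compo_assoc_arr[of "pull_nat_trans El inclusion \<theta>" "pull_nat_trans El inclusion \<rho>" "counit Y"]
    by (simp add: pull_compo pull_is_nat_trans)
  then have "compo (Psh El) (counit Y) (pull_nat_trans El inclusion (compo (Psh C) \<rho> \<theta>)) = counit Y"
    using \<theta>(2) \<rho>(2) by simp
  moreover have "compo (Psh El) (counit Y) (pull_nat_trans El inclusion (idt (Psh C) (ran Y))) = counit Y"
    using nt PshEl.compo_idt_right[of "counit Y"] by (simp add: pull_idt ran_is_presheaf)
  ultimately have "compo (Psh C) \<rho> \<theta> = idt (Psh C) (ran Y)" "compo (Psh C) \<theta> \<rho> = idt (Psh C) (on_obj R Y)"
    using mediating_unique[OF Y ran_is_presheaf, where \<beta> = "compo (Psh C) \<rho> \<theta>" and \<alpha> = "counit Y"]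
      mediating_unique[OF Y ran_is_presheaf, where \<beta> = "idt (Psh C) (ran Y)" and \<alpha> = "counit Y"] nt
    by (auto simp: hom_def nat_trans_compo nat_trans_idt ran_is_presheaf)
  then have "iso (Psh C) \<theta>"
    using nt \<rho>(1) by (auto simp: iso_def)
  then show thesis using \<theta>(2) nt by (intro that[of \<theta>]) auto
qed

text \<open>The counit of the adjunction is invertible because the inclusion is fully faithful.  By the
  triangle identity, the unit at a sheaf is then invertible on elementary objects.  Its target is a
  sheaf, so that it is invertible.\<close>
lemma elementary_objects_equivalence:
  fixes R :: "('a, 'm, 'a, 'm, 'u) psh_functor"
  assumes cov: "\<And>p f. p \<in> obj C \<Longrightarrow> f \<in> cov p \<Longrightarrow> f \<in> over p"
    and factor: "\<And>p f. p \<in> obj C \<Longrightarrow> f \<in> over p \<Longrightarrow> \<exists>h \<in> cov p. \<exists>k \<in> over (dom C h). compo C h k = f"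
    and R: "is_right_Kan_extension El C inclusion R \<epsilon>"
  shows "is_equivalence (Psh El) (Sh C cov) R"
proof -
  let ?G = "\<lparr>on_obj = pull_presheaf El inclusion, on_arr = pull_nat_trans El inclusion\<rparr>"
  interpret Sh: category "Sh C cov" by (rule Sh_category)
  have Sh_simps: "X \<in> obj (Sh C cov) \<longleftrightarrow> is_sheaf C cov X"
    "\<phi> \<in> arr (Sh C cov) \<longleftrightarrow> is_nat_trans C \<phi> \<and> is_sheaf C cov (source \<phi>) \<and> is_sheaf C cov (target \<phi>)"
    "dom (Sh C cov) = source" "cod (Sh C cov) = target" "idt (Sh C cov) = idt (Psh C)"
    "compo (Sh C cov) = compo (Psh C)" for X \<phi>
    by (auto simp: Sh_def full_sub_def is_sheaf_def)
  have R_functor: "is_functor (Psh El) (Psh C) R"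
    and \<epsilon>: "\<And>Y. is_presheaf El Y \<Longrightarrow> \<epsilon> Y \<in> hom (Psh El) (pull_presheaf El inclusion (on_obj R Y)) Y"
    and univ: "\<And>X Y \<alpha>. is_presheaf El Y \<Longrightarrow> is_presheaf C X \<Longrightarrow>
       \<alpha> \<in> hom (Psh El) (pull_presheaf El inclusion X) Y \<Longrightarrow>
       \<exists>!\<beta>. \<beta> \<in> hom (Psh C) X (on_obj R Y) \<and> compo (Psh El) (\<epsilon> Y) (pull_nat_trans El inclusion \<beta>) = \<alpha>"
    and \<epsilon>_nat: "\<And>\<phi>. is_nat_trans El \<phi> \<Longrightarrow>
       compo (Psh El) (\<epsilon> (target \<phi>)) (pull_nat_trans El inclusion (on_arr R \<phi>)) =
       compo (Psh El) \<phi> (\<epsilon> (source \<phi>))"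
    using R by (auto simp: is_right_Kan_extension_def)
  have R_arr: "is_nat_trans C (on_arr R \<phi>)" "source (on_arr R \<phi>) = on_obj R (source \<phi>)"
    "target (on_arr R \<phi>) = on_obj R (target \<phi>)" if "is_nat_trans El \<phi>" for \<phi>
    using R_functor that by (auto simp: is_functor_def hom_def)
  have \<epsilon>': "is_nat_trans El (\<epsilon> Y)" "source (\<epsilon> Y) = pull_presheaf El inclusion (on_obj R Y)" "target (\<epsilon> Y) = Y"
    if "is_presheaf El Y" for Y
    using \<epsilon>[OF that] by (auto simp: hom_def)
  have cov': "f \<in> arr C \<and> cod C f = p \<and> dom C f \<in> E" if "p \<in> obj C" "f \<in> cov p" for p f
    using cov[OF that] by (auto simp: over_def)
  have RY_sheaf: "is_sheaf C cov (on_obj R Y)" if Y: "is_presheaf El Y" for Y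
  proof -
    have sh: "is_sheaf C cov (ran Y)"
      using Y cov factor by (rule ran_is_sheaf)
    obtain \<theta> where \<theta>: "iso (Psh C) \<theta>" "source \<theta> = ran Y" "target \<theta> = on_obj R Y"
      by (rule Kan_extension_value_iso[OF R Y])
    show ?thesis
      using sheaf_iso[OF sh \<theta>(1,2)] cov' \<theta>(3) by auto
  qed
  have \<epsilon>_iso: "iso (Psh El) (\<epsilon> Y)" if Y: "is_presheaf El Y" for Y
  proof (rule El.bij_iso_Psh)
    fix e assume e: "e \<in> obj El"
    obtain \<theta> where \<theta>: "iso (Psh C) \<theta>" "source \<theta> = ran Y" "target \<theta> = on_obj R Y"
        "compo (Psh El) (\<epsilon> Y) (pull_nat_trans El inclusion \<theta>) = counit Y"
      using Kan_extension_value_iso[OF R Y] .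
    have b: "bij_betw (component \<theta> e) (sec (ran Y) e) (sec (on_obj R Y) e)"
      using iso_Psh_bij[OF \<theta>(1), of e] e \<theta> by simp
    have "bij_betw (component (counit Y) e) (sec (ran Y) e) (sec Y e)"
      using El.iso_Psh_bij[OF counit_iso[OF Y] e] e by (simp add: counit_def)
    moreover have "component (counit Y) e x = (component (\<epsilon> Y) e \<circ> component \<theta> e) x" if "x \<in> sec (ran Y) e" for x
      using that e \<theta>(2) by (simp add: \<theta>(4)[symmetric])
    ultimately have "bij_betw (component (\<epsilon> Y) e \<circ> component \<theta> e) (sec (ran Y) e) (sec Y e)"
      using bij_betw_cong[of "sec (ran Y) e" "component (counit Y) e"] by blast
    then show "bij_betw (component (\<epsilon> Y) e) (sec (source (\<epsilon> Y)) e) (sec (target (\<epsilon> Y)) e)"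
      using bij_betw_comp_iff[OF b, of "component (\<epsilon> Y) e" "sec Y e"] \<epsilon>'[OF Y] e by simp
  qed (rule \<epsilon>'[OF Y])
  have R_Sh: "is_functor (Psh El) (Sh C cov) R"
    using R_functor RY_sheaf R_arr PshEl.category_axioms Sh.category_axioms
    by (auto simp: is_functor_def Sh_simps hom_def nat_transD(1,2)[where C = El])
  have G: "is_functor (Sh C cov) (Psh El) ?G"
    using PshEl.category_axioms Sh.category_axioms
    by (auto simp: is_functor_def Sh_simps hom_def is_sheaf_def pull_is_presheaf pull_is_nat_trans pull_idt pull_compo)
  have inclusion_functors: "is_functor (Psh El) (Psh El) inclusion" "is_functor (Sh C cov) (Sh C cov) inclusion"
    using PshEl.category_axioms Sh.category_axioms by (auto simp: is_functor_def inclusion_def hom_def)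
  have functor_compI: "is_functor B D (functor_comp K F)" if "is_functor B A F" "is_functor A D K"
    for A :: "('x1, 'x2) category_data" and B :: "('y1, 'y2) category_data" and D :: "('z1, 'z2) category_data" and F K
    using that by (auto simp: is_functor_def functor_comp_def hom_def category.dom_obj category.cod_obj)
  have 1: "naturally_isomorphic (Psh El) (Psh El) (functor_comp ?G R) inclusion"
    unfolding naturally_isomorphic_def
    using \<epsilon> \<epsilon>_iso \<epsilon>_nat by (intro exI[of _ \<epsilon>]) (auto simp: functor_comp_def inclusion_def)
  have "\<forall>X. \<exists>\<beta>. is_sheaf C cov X \<longrightarrow> \<beta> \<in> hom (Psh C) X (on_obj R (pull_presheaf El inclusion X)) \<and>
      compo (Psh El) (\<epsilon> (pull_presheaf El inclusion X)) (pull_nat_trans El inclusion \<beta>) =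
        idt (Psh El) (pull_presheaf El inclusion X)"
  proof
    fix X
    show "\<exists>\<beta>. is_sheaf C cov X \<longrightarrow> \<beta> \<in> hom (Psh C) X (on_obj R (pull_presheaf El inclusion X)) \<and>
      compo (Psh El) (\<epsilon> (pull_presheaf El inclusion X)) (pull_nat_trans El inclusion \<beta>) =
        idt (Psh El) (pull_presheaf El inclusion X)"
    proof (cases "is_sheaf C cov X")
      case True
      then have X: "is_presheaf C X" "is_presheaf El (pull_presheaf El inclusion X)"
        by (auto simp: is_sheaf_def pull_is_presheaf)
      then show ?thesis
        using univ[OF X(2,1), of "idt (Psh El) (pull_presheaf El inclusion X)"]
        by (auto simp: hom_def El.nat_trans_idt)
    qed simp
  qed
  from choice[OF this] obtain \<eta> where
    eta: "\<forall>X. is_sheaf C cov X \<longrightarrow> \<eta> X \<in> hom (Psh C) X (on_obj R (pull_presheaf El inclusion X)) \<and>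
      compo (Psh El) (\<epsilon> (pull_presheaf El inclusion X)) (pull_nat_trans El inclusion (\<eta> X)) =
        idt (Psh El) (pull_presheaf El inclusion X)" ..
  have \<eta>: "is_nat_trans C (\<eta> X)" "source (\<eta> X) = X" "target (\<eta> X) = on_obj R (pull_presheaf El inclusion X)"
    "compo (Psh El) (\<epsilon> (pull_presheaf El inclusion X)) (pull_nat_trans El inclusion (\<eta> X)) =
        idt (Psh El) (pull_presheaf El inclusion X)" if "is_sheaf C cov X" for X
    using eta that by (auto simp: hom_def)
  have \<eta>_iso: "iso (Psh C) (\<eta> X)" if X: "is_sheaf C cov X" for X
  proof (rule iso_of_sheaves_if_bij_on_covering_objects[where cov = cov and E = E])
    let ?Y = "pull_presheaf El inclusion X"
    have Y: "is_presheaf El ?Y" using X by (auto simp: is_sheaf_def pull_is_presheaf)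
    show "is_nat_trans C (\<eta> X)" "is_sheaf C cov (source (\<eta> X))" "is_sheaf C cov (target (\<eta> X))"
      using \<eta>[OF X] X RY_sheaf[OF Y] by simp_all
    fix e assume e: "e \<in> obj C" "e \<in> E"
    have b: "bij_betw (component (\<epsilon> ?Y) e) (sec (on_obj R ?Y) e) (sec X e)"
      using El.iso_Psh_bij[OF \<epsilon>_iso[OF Y], of e] \<epsilon>'[OF Y] e by simp
    have "(component (\<epsilon> ?Y) e \<circ> component (\<eta> X) e) x = x" if x: "x \<in> sec X e" for x
    proof -
      have "component (compo (Psh El) (\<epsilon> ?Y) (pull_nat_trans El inclusion (\<eta> X))) e x = x"
        unfolding \<eta>(4)[OF X] using x e by simp
      then show ?thesis using x e \<eta>(2)[OF X] by simp
    qed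
    then have "bij_betw (component (\<epsilon> ?Y) e \<circ> component (\<eta> X) e) (sec X e) (sec X e)"
      using bij_betw_cong[of "sec X e" id "component (\<epsilon> ?Y) e \<circ> component (\<eta> X) e" "sec X e"]
        bij_betw_id[of "sec X e"] by simp
    then show "bij_betw (component (\<eta> X) e) (sec (source (\<eta> X)) e) (sec (target (\<eta> X)) e)"
      using bij_betw_comp_iff2[OF b, of "component (\<eta> X) e" "sec X e"] \<eta>[OF X] nat_transD(5)[OF \<eta>(1)[OF X], of e] e
      by auto
  qed (use cov' in auto)
  have \<eta>_nat: "compo (Psh C) (\<eta> (target \<phi>)) \<phi> =
      compo (Psh C) (on_arr R (pull_nat_trans El inclusion \<phi>)) (\<eta> (source \<phi>))"
    if \<phi>: "is_nat_trans C \<phi>" "is_sheaf C cov (source \<phi>)" "is_sheaf C cov (target \<phi>)" for \<phi>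
  proof -
    let ?i = "pull_nat_trans El inclusion" and ?X = "source \<phi>" and ?X' = "target \<phi>"
    let ?Y = "pull_presheaf El inclusion ?X" and ?Y' = "pull_presheaf El inclusion ?X'"
    have Y: "is_presheaf El ?Y" "is_presheaf El ?Y'" "is_presheaf C ?X"
      using \<phi> by (auto simp: is_sheaf_def pull_is_presheaf)
    have i\<phi>: "is_nat_trans El (?i \<phi>)" using \<phi> by (simp add: pull_is_nat_trans)
    note facts = \<eta>(1-3)[OF \<phi>(2)] \<eta>(1-3)[OF \<phi>(3)] \<epsilon>'[OF Y(1)] \<epsilon>'[OF Y(2)] R_arr[OF i\<phi>] i\<phi> \<phi>(1)
    have "compo (Psh El) (\<epsilon> ?Y') (?i (compo (Psh C) (\<eta> ?X') \<phi>)) =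
        compo (Psh El) (compo (Psh El) (\<epsilon> ?Y') (?i (\<eta> ?X'))) (?i \<phi>)"
      using facts PshEl.compo_assoc_arr[of "?i \<phi>" "?i (\<eta> ?X')" "\<epsilon> ?Y'"]
      by (simp add: pull_compo pull_is_nat_trans)
    also have "\<dots> = ?i \<phi>"
      using \<eta>(4)[OF \<phi>(3)] PshEl.compo_idt_left[of "?i \<phi>"] facts by simp
    finally have 1: "compo (Psh El) (\<epsilon> ?Y') (?i (compo (Psh C) (\<eta> ?X') \<phi>)) = ?i \<phi>" .
    have "compo (Psh El) (\<epsilon> ?Y') (?i (compo (Psh C) (on_arr R (?i \<phi>)) (\<eta> ?X))) =
        compo (Psh El) (compo (Psh El) (\<epsilon> ?Y') (?i (on_arr R (?i \<phi>)))) (?i (\<eta> ?X))"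
      using facts PshEl.compo_assoc_arr[of "?i (\<eta> ?X)" "?i (on_arr R (?i \<phi>))" "\<epsilon> ?Y'"]
      by (simp add: pull_compo pull_is_nat_trans)
    also have "\<dots> = compo (Psh El) (compo (Psh El) (?i \<phi>) (\<epsilon> ?Y)) (?i (\<eta> ?X))"
      using \<epsilon>_nat[OF i\<phi>] by simp
    also have "\<dots> = compo (Psh El) (?i \<phi>) (compo (Psh El) (\<epsilon> ?Y) (?i (\<eta> ?X)))"
      using facts PshEl.compo_assoc_arr[of "?i (\<eta> ?X)" "\<epsilon> ?Y" "?i \<phi>"]
      by (simp add: pull_is_nat_trans)
    also have "\<dots> = ?i \<phi>"
      using \<eta>(4)[OF \<phi>(2)] PshEl.compo_idt_right[of "?i \<phi>"] facts by simp
    finally have 2: "compo (Psh El) (\<epsilon> ?Y') (?i (compo (Psh C) (on_arr R (?i \<phi>)) (\<eta> ?X))) = ?i \<phi>" .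
    have "compo (Psh C) (\<eta> ?X') \<phi> \<in> hom (Psh C) ?X (on_obj R ?Y')"
      "compo (Psh C) (on_arr R (?i \<phi>)) (\<eta> ?X) \<in> hom (Psh C) ?X (on_obj R ?Y')"
      using facts by (auto simp: hom_def nat_trans_compo)
    then show ?thesis
      using ex1_unique[OF univ[OF Y(2,3), of "?i \<phi>"] _ 1 _ 2] i\<phi> by (simp add: hom_def)
  qed
  have 2: "naturally_isomorphic (Sh C cov) (Sh C cov) inclusion (functor_comp R ?G)"
    unfolding naturally_isomorphic_def
  proof (intro exI[of _ \<eta>] conjI ballI)
    fix X :: "('a, 'm, 'u) presheaf" assume "X \<in> obj (Sh C cov)"
    then have X: "is_sheaf C cov X" by (simp add: Sh_simps)
    then have Y: "is_presheaf El (pull_presheaf El inclusion X)" by (auto simp: is_sheaf_def pull_is_presheaf)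
    show "\<eta> X \<in> hom (Sh C cov) (on_obj inclusion X) (on_obj (functor_comp R ?G) X)"
      using \<eta>[OF X] X RY_sheaf[OF Y] by (simp add: hom_def Sh_simps inclusion_def functor_comp_def)
    obtain \<rho> where "is_nat_trans C \<rho>" "source \<rho> = target (\<eta> X)" "target \<rho> = source (\<eta> X)"
      "compo (Psh C) \<rho> (\<eta> X) = idt (Psh C) (source (\<eta> X))" "compo (Psh C) (\<eta> X) \<rho> = idt (Psh C) (target (\<eta> X))"
      using Psh.inverse_exists[OF \<eta>_iso[OF X]] by auto
    then show "iso (Sh C cov) (\<eta> X)"
      using \<eta>[OF X] X RY_sheaf[OF Y] unfolding iso_def by (auto simp: hom_def Sh_simps)
  qed (use \<eta>_nat in \<open>auto simp: Sh_simps inclusion_def functor_comp_def\<close>)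
  show ?thesis
    unfolding is_equivalence_def
    using R_Sh G naturally_isomorphic_sym[OF functor_compI[OF R_Sh G] inclusion_functors(1) 1]
      naturally_isomorphic_sym[OF inclusion_functors(2) functor_compI[OF G R_Sh] 2]
    by blast
qed

end

section \<open>Splitting lists into blocks\<close>

lemma blocks_Nil [simp]: "blocks [] = []"
  by (simp add: blocks_def)

lemma blocks_Cons [simp]: "blocks (n # ns) = [0..<n] # map (map ((+) n)) (blocks ns)"
proof -
  have "[0..<length (n # ns)] = 0 # map Suc [0..<length ns]"
    by (simp add: upt_conv_Cons map_Suc_upt del: upt_Suc)
  moreover have "[n + a..<n + b] = map ((+) n) [a..<b]" for a b
    by (intro nth_equalityI) auto
  ultimately show ?thesis
    by (simp add: blocks_def del: upt_Suc)
qed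

text \<open>Here \<open>xs\<close> and \<open>ys\<close> leave room for the inputs of a lower vertex on both sides of those of the
  upper vertices.\<close>

lemma nth_blocks:
  "map (map (\<lambda>j. (xs @ concat xss @ ys) ! (length xs + j))) (blocks (map length xss)) = xss"
proof (induction xss arbitrary: xs)
  case (Cons zs xss)
  have "map (\<lambda>j. (xs @ (zs @ concat xss) @ ys) ! (length xs + j)) [0..<length zs] = zs"
    by (auto intro!: nth_equalityI simp: nth_append)
  then show ?case
    using Cons.IH[of "xs @ zs"] by (simp add: comp_def add.assoc)
qed simp

lemma map_eq_concat:
  "map f xs = concat yss \<Longrightarrow> \<exists>xss. xs = concat xss \<and> map (map f) xss = yss"
proof (induction yss arbitrary: xs)
  case (Cons ys yss)
  then obtain us vs where "xs = us @ vs" "map f us = ys" "map f vs = concat yss"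
    by (auto simp: map_eq_append_conv)
  then show ?case using Cons.IH[of vs] by (metis concat.simps(2) list.simps(9))
qed simp

lemma concat_concat_map: "concat (concat xsss) = concat (map concat xsss)"
  by (induction xsss) auto

lemma map2_concat:
  "map length xss = map length yss \<Longrightarrow>
    map2 f (concat xss) (concat yss) = concat (map2 (map2 f) xss yss)"
proof (induction xss arbitrary: yss)
  case (Cons xs xss)
  then show ?case by (cases yss) auto
qed simp

section \<open>Grafting in planar operads\<close>

context planar_operad
begin

lemma composable_length: "composable P p qs \<Longrightarrow> length qs = arity P p"
  unfolding composable_def arity_def by (metis length_map)

lemma composable_ident: "q \<in> Ops P \<Longrightarrow> c = outp P q \<Longrightarrow> composable P (ident P c) [q]"
  by (simp add: composable_def ident_Ops inp_ident outp_Col)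

lemma cmp_ident: "q \<in> Ops P \<Longrightarrow> c = outp P q \<Longrightarrow> cmp P (ident P c) [q] = q"
  by (simp add: cmp_ident_left)

lemma idents: "set cs \<subseteq> Col P \<Longrightarrow> set (map (ident P) cs) \<subseteq> Ops P"
  and outp_idents: "set cs \<subseteq> Col P \<Longrightarrow> map (outp P) (map (ident P) cs) = cs"
  by (induction cs) (auto simp: ident_Ops outp_ident inp_ident)

lemma arity_idents: "set cs \<subseteq> Col P \<Longrightarrow> sum_list (map (arity P) (map (ident P) cs)) = length cs"
  and concat_inp_idents: "set cs \<subseteq> Col P \<Longrightarrow> concat (map (inp P) (map (ident P) cs)) = cs"
  by (induction cs) (auto simp: arity_def inp_ident)

lemma composable_idents: "p \<in> Ops P \<Longrightarrow> composable P p (map (ident P) (inp P p))"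
  using inp_Col[of p] idents[of "inp P p"] outp_idents[of "inp P p"] by (simp add: composable_def)

lemma composable_idents_list:
  "set qs \<subseteq> Ops P \<Longrightarrow> list_all2 (composable P) qs (map (\<lambda>q. map (ident P) (inp P q)) qs)"
  by (induction qs) (auto simp: composable_idents)

lemma cmp_idents_list:
  "set qs \<subseteq> Ops P \<Longrightarrow> map2 (cmp P) qs (map (\<lambda>q. map (ident P) (inp P q)) qs) = qs"
  by (induction qs) (auto simp: cmp_ident_right)

lemma idents_composable_list:
  "set qs \<subseteq> Ops P \<Longrightarrow> list_all2 (composable P) (map (ident P) (map (outp P) qs)) (map (\<lambda>q. [q]) qs)"
  by (induction qs) (auto simp: composable_ident)

lemma idents_cmp_list:
  "set qs \<subseteq> Ops P \<Longrightarrow> map2 (cmp P) (map (ident P) (map (outp P) qs)) (map (\<lambda>q. [q]) qs) = qs"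
  by (induction qs) (auto simp: cmp_ident)

lemma cmp_list:
  "list_all2 (composable P) qs rss \<Longrightarrow> set (map2 (cmp P) qs rss) \<subseteq> Ops P"
  "list_all2 (composable P) qs rss \<Longrightarrow> map (outp P) (map2 (cmp P) qs rss) = map (outp P) qs"
  "list_all2 (composable P) qs rss \<Longrightarrow>
    map (inp P) (map2 (cmp P) qs rss) = map (\<lambda>rs. concat (map (inp P) rs)) rss"
  by (induction rule: list_all2_induct) (auto simp: cmp_Ops outp_cmp inp_cmp)

lemma composable_cmp:
  assumes "composable P p qs" "list_all2 (composable P) qs rss"
  shows "composable P p (map2 (cmp P) qs rss)" "composable P (cmp P p qs) (concat rss)"
proof -
  show "composable P p (map2 (cmp P) qs rss)"
    using assms cmp_list[OF assms(2)] by (simp add: composable_def)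
  have "set (concat rss) \<subseteq> Ops P \<and> map (outp P) (concat rss) = concat (map (inp P) qs)"
    using assms(2) by (induction rule: list_all2_induct) (auto simp: composable_def)
  then show "composable P (cmp P p qs) (concat rss)"
    using assms cmp_Ops[OF assms(1)] inp_cmp[OF assms(1)] by (simp add: composable_def)
qed

lemma cmp_assoc_list:
  assumes "list_all2 (composable P) ps qss" "list_all2 (list_all2 (composable P)) qss rsss"
  shows "map2 (cmp P) (map2 (cmp P) ps qss) (map concat rsss) =
      map2 (cmp P) ps (map2 (map2 (cmp P)) qss rsss)"
  using assms
proof (induction arbitrary: rsss rule: list_all2_induct)
  case (Cons p ps qs qss)
  then show ?case by (cases rsss) (auto simp: cmp_assoc)
qed simp

lemma pcomposable_split:
  "pcomposable P l i x \<longleftrightarrow> l \<in> Ops P \<and> x \<in> Ops P \<and>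
    (\<exists>cs ds. inp P l = cs @ outp P x # ds \<and> i = length cs)"
proof
  assume "pcomposable P l i x"
  then have "l \<in> Ops P" "x \<in> Ops P" "i < length (inp P l)" "outp P x = inp P l ! i"
    by (auto simp: pcomposable_def arity_def)
  then show "l \<in> Ops P \<and> x \<in> Ops P \<and> (\<exists>cs ds. inp P l = cs @ outp P x # ds \<and> i = length cs)"
    using id_take_nth_drop[of i "inp P l"]
    by (intro conjI exI[of _ "take i (inp P l)"] exI[of _ "drop (Suc i) (inp P l)"]) auto
qed (auto simp: pcomposable_def arity_def)

lemma pcmp_split:
  assumes "inp P l = cs @ c # ds"
  shows "pcmp P l (length cs) x = cmp P l (map (ident P) cs @ x # map (ident P) ds)"
  using assms by (simp add: pcmp_def list_update_append)

lemma pcomposable_insert: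
  assumes "l \<in> Ops P" "x \<in> Ops P" "inp P l = cs @ outp P x # ds"
  shows "composable P l (map (ident P) cs @ x # map (ident P) ds)"
  using assms inp_Col[OF assms(1)] idents[of cs] idents[of ds] outp_idents[of cs] outp_idents[of ds]
  by (auto simp: composable_def)

lemma pcmp_Ops:
  assumes "l \<in> Ops P" "x \<in> Ops P" "inp P l = cs @ outp P x # ds"
  shows "pcmp P l (length cs) x \<in> Ops P" "outp P (pcmp P l (length cs) x) = outp P l"
    "inp P (pcmp P l (length cs) x) = cs @ inp P x @ ds"
  using pcomposable_insert[OF assms] cmp_Ops outp_cmp inp_cmp inp_Col[OF assms(1)] assms(3)
    concat_inp_idents[of cs] concat_inp_idents[of ds]
  by (auto simp: pcmp_split[OF assms(3)])

lemma cmp_pcmp: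
  assumes l: "l \<in> Ops P" "inp P l = map (outp P) as @ outp P x # map (outp P) bs"
    and x: "composable P x xs" and ab: "set as \<subseteq> Ops P" "set bs \<subseteq> Ops P"
  shows "cmp P (pcmp P l (length as) x) (as @ xs @ bs) = cmp P l (as @ cmp P x xs # bs)"
proof -
  have "cmp P (cmp P l (map (ident P) (map (outp P) as) @ x # map (ident P) (map (outp P) bs)))
      (concat (map (\<lambda>q. [q]) as @ xs # map (\<lambda>q. [q]) bs)) =
    cmp P l (map2 (cmp P) (map (ident P) (map (outp P) as) @ x # map (ident P) (map (outp P) bs))
      (map (\<lambda>q. [q]) as @ xs # map (\<lambda>q. [q]) bs))"
    using assms idents_composable_list[of as] idents_composable_list[of bs] pcomposable_insert[OF l(1) _ l(2)]
    by (intro cmp_assoc list_all2_appendI) (auto simp: composable_def)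
  then show ?thesis
    using idents_cmp_list[OF ab(1)] idents_cmp_list[OF ab(2)] pcmp_split[OF l(2), of x] by simp
qed

lemma length_concat_inp: "length (concat (map (inp P) qs)) = sum_list (map (arity P) qs)"
  by (induction qs) (auto simp: arity_def)

lemma pcmp_cmp:
  assumes l: "composable P l (as @ x # bs)" and x: "pcomposable P x i y"
  shows "pcmp P (cmp P l (as @ x # bs)) (sum_list (map (arity P) as) + i) y =
    cmp P l (as @ pcmp P x i y # bs)"
proof -
  obtain cs ds where cd: "inp P x = cs @ outp P y # ds" "i = length cs" and xy: "x \<in> Ops P" "y \<in> Ops P"
    using x by (auto simp: pcomposable_split)
  let ?ids = "\<lambda>q. map (ident P) (inp P q)"
  let ?cs = "concat (map (inp P) as) @ cs" and ?ds = "ds @ concat (map (inp P) bs)"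
  have ab: "set as \<subseteq> Ops P" "set bs \<subseteq> Ops P" using l by (auto simp: composable_def)
  have "inp P (cmp P l (as @ x # bs)) = ?cs @ outp P y # ?ds" using inp_cmp[OF l] cd by simp
  then have "pcmp P (cmp P l (as @ x # bs)) (length ?cs) y =
    cmp P (cmp P l (as @ x # bs)) (map (ident P) ?cs @ y # map (ident P) ?ds)"
    by (rule pcmp_split)
  also have "map (ident P) ?cs @ y # map (ident P) ?ds =
      concat (map ?ids as @ (map (ident P) cs @ y # map (ident P) ds) # map ?ids bs)"
    by (simp add: map_concat comp_def)
  also have "cmp P (cmp P l (as @ x # bs)) \<dots> = cmp P l (map2 (cmp P) (as @ x # bs)
      (map ?ids as @ (map (ident P) cs @ y # map (ident P) ds) # map ?ids bs))"
    using l composable_idents_list[OF ab(1)] composable_idents_list[OF ab(2)] pcomposable_insert[OF xy cd(1)]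
    by (intro cmp_assoc list_all2_appendI) auto
  also have "\<dots> = cmp P l (as @ pcmp P x i y # bs)"
    using cmp_idents_list[OF ab(1)] cmp_idents_list[OF ab(2)] cd by (simp add: pcmp_split)
  finally show ?thesis using cd by (simp add: length_concat_inp)
qed

lemma pcmp_ident: "y \<in> Ops P \<Longrightarrow> c = outp P y \<Longrightarrow> pcmp P (ident P c) 0 y = y"
  by (simp add: pcmp_def inp_ident outp_Col cmp_ident)

lemma pcmp_cmp_ident:
  assumes "composable P l (as @ ident P c # bs)" "y \<in> Ops P" "c = outp P y"
  shows "pcmp P (cmp P l (as @ ident P c # bs)) (sum_list (map (arity P) as)) y = cmp P l (as @ y # bs)"
proof -
  have "pcomposable P (ident P c) 0 y"
    using assms by (auto simp: pcomposable_def arity_def ident_Ops inp_ident outp_Col)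
  then show ?thesis using pcmp_cmp[OF assms(1)] pcmp_ident[OF assms(2,3)] by fastforce
qed

lemma pcmp_ident_right:
  assumes "l \<in> Ops P" "inp P l = cs @ c # ds"
  shows "pcmp P l (length cs) (ident P c) = l"
  using cmp_ident_right[OF assms(1)] assms(2) by (simp add: pcmp_split)

lemma pcmp_pcmp:
  assumes "pcomposable P l i x" "pcomposable P x j y"
  shows "pcmp P (pcmp P l i x) (i + j) y = pcmp P l i (pcmp P x j y)"
proof -
  obtain cs ds where cd: "inp P l = cs @ outp P x # ds" "i = length cs" and lx: "l \<in> Ops P" "x \<in> Ops P"
    using assms(1) by (auto simp: pcomposable_split)
  have "sum_list (map (arity P) (map (ident P) cs)) = i"
    using inp_Col[OF lx(1)] cd arity_idents[of cs] by simp
  then show ?thesis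
    using pcmp_cmp[OF pcomposable_insert[OF lx cd(1)] assms(2)] cd
    by (simp add: pcmp_split)
qed

text \<open>Associativity of the composition of arrows, as seen at the lower vertex: both sides are
  \<open>lh \<circ>\<^sub>i lg (C, lf (A (sA), -, B (sB)), D)\<close>, with a free input of colour \<open>c\<close>.\<close>

lemma lower_vertex_assoc:
  assumes f: "composable P lf (A @ ident P c # B)"
    and g: "composable P lg (C @ ident P (outp P lf) # D)"
    and h: "pcomposable P lh i lg"
    and sA: "list_all2 (composable P) A sA" and sB: "list_all2 (composable P) B sB"
    and c: "c \<in> Col P"
  shows "pcmp P lh i (cmp P (pcmp P lg (length C) (cmp P lf (A @ ident P c # B)))
         ((C @ concat sA) @ ident P c # (concat sB @ D))) =
      pcmp P (pcmp P lh i (cmp P lg (C @ ident P (outp P lf) # D)))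
        (i + sum_list (map (arity P) C)) (cmp P lf (map2 (cmp P) A sA @ ident P c # map2 (cmp P) B sB))"
proof -
  let ?d = "outp P lf"
  let ?M = "cmp P lf (A @ ident P c # B)"
  have lf: "lf \<in> Ops P" using f by (simp add: composable_def)
  have lg: "lg \<in> Ops P" and CD: "set C \<subseteq> Ops P" "set D \<subseteq> Ops P" using g by (auto simp: composable_def)
  have inp_lg: "inp P lg = map (outp P) C @ ?d # map (outp P) D"
    using g lf by (auto simp: composable_def outp_ident outp_Col)
  have M: "?M \<in> Ops P" "outp P ?M = ?d" using f cmp_Ops outp_cmp by auto
  have l: "list_all2 (composable P) (A @ ident P c # B) (sA @ [ident P c] # sB)"
    using sA sB c by (intro list_all2_appendI) (auto simp: composable_ident ident_Ops outp_ident)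
  have comp: "composable P ?M (concat (sA @ [ident P c] # sB))" using composable_cmp[OF f l] by simp
  let ?N = "cmp P lf (map2 (cmp P) A sA @ ident P c # map2 (cmp P) B sB)"
  have N: "cmp P ?M (concat sA @ ident P c # concat sB) = ?N"
    using cmp_assoc[OF f l] c sA by (simp add: cmp_ident ident_Ops outp_ident list_all2_lengthD)
  have N': "?N \<in> Ops P" "outp P ?N = ?d"
    unfolding N[symmetric] using comp M cmp_Ops outp_cmp by auto
  have "cmp P (pcmp P lg (length C) ?M) (C @ (concat sA @ ident P c # concat sB) @ D) =
      cmp P lg (C @ cmp P ?M (concat sA @ ident P c # concat sB) # D)"
    using lg CD inp_lg M comp by (intro cmp_pcmp) auto
  also have "\<dots> = pcmp P (cmp P lg (C @ ident P ?d # D)) (sum_list (map (arity P) C)) ?N"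
    unfolding N using g N' by (intro pcmp_cmp_ident[symmetric]) auto
  finally have "pcmp P lh i (cmp P (pcmp P lg (length C) ?M) ((C @ concat sA) @ ident P c # (concat sB @ D))) =
      pcmp P lh i (pcmp P (cmp P lg (C @ ident P ?d # D)) (sum_list (map (arity P) C)) ?N)"
    by simp
  also have "\<dots> = pcmp P (pcmp P lh i (cmp P lg (C @ ident P ?d # D))) (i + sum_list (map (arity P) C)) ?N"
  proof (rule pcmp_pcmp[symmetric])
    show "pcomposable P lh i (cmp P lg (C @ ident P ?d # D))"
      using h g cmp_Ops outp_cmp by (auto simp: pcomposable_def)
    show "pcomposable P (cmp P lg (C @ ident P ?d # D)) (sum_list (map (arity P) C)) ?N"
      unfolding pcomposable_split using g cmp_Ops inp_cmp N' lf
      by (intro conjI exI[of _ "concat (map (inp P) C)"] exI[of _ "concat (map (inp P) D)"])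
         (auto simp: length_concat_inp inp_ident outp_Col)
  qed
  finally show ?thesis .
qed

section \<open>The twisted arrow category of a planar operad\<close>

lemma planar_Tw_simps [simp]:
  "obj (planar_Tw P) = Ops P" "dom (planar_Tw P) = src" "cod (planar_Tw P) = planar_target P"
  "compo (planar_Tw P) = planar_compo P"
  "idt (planar_Tw P) p = \<lparr>src = p, lower = ident P (outp P p), pos = 0, uppers = map (ident P) (inp P p)\<rparr>"
  by (auto simp: planar_Tw_def)

lemma planar_arrowE:
  assumes "f \<in> arr (planar_Tw P)"
  obtains cs ds where "src f \<in> Ops P" "lower f \<in> Ops P" "composable P (src f) (uppers f)"
    "inp P (lower f) = cs @ outp P (src f) # ds" "pos f = length cs"
  using assms by (auto simp: planar_Tw_def pcomposable_split)

lemma planar_arrowI: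
  assumes "lower f \<in> Ops P" "composable P (src f) (uppers f)"
    "inp P (lower f) = cs @ outp P (src f) # ds" "pos f = length cs"
  shows "f \<in> arr (planar_Tw P)"
  using assms by (auto simp: planar_Tw_def pcomposable_split composable_def)

lemma planar_target_facts:
  assumes "lower f \<in> Ops P" "composable P (src f) (uppers f)"
    "inp P (lower f) = cs @ outp P (src f) # ds" "pos f = length cs"
  shows "planar_target P f \<in> Ops P" "outp P (planar_target P f) = outp P (lower f)"
    "inp P (planar_target P f) = cs @ concat (map (inp P) (uppers f)) @ ds"
  using pcmp_Ops[of "lower f" "cmp P (src f) (uppers f)" cs ds] assms cmp_Ops outp_cmp inp_cmp
  by (auto simp: planar_target_def)

lemma split_along:
  assumes "map (outp P) rs = cs @ concat (map (inp P) qs) @ ds" "set rs \<subseteq> Ops P" "set qs \<subseteq> Ops P"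
  obtains A rss B where "rs = A @ concat rss @ B" "map (outp P) A = cs" "map (outp P) B = ds"
    "list_all2 (composable P) qs rss" "set A \<subseteq> Ops P" "set B \<subseteq> Ops P"
proof -
  obtain A R B where rs: "rs = A @ R @ B" "map (outp P) A = cs" "map (outp P) B = ds"
      "map (outp P) R = concat (map (inp P) qs)"
  proof -
    obtain A S where "rs = A @ S" "map (outp P) A = cs" "map (outp P) S = concat (map (inp P) qs) @ ds"
      using assms(1) by (metis map_eq_append_conv)
    moreover from this(3) obtain R B where "S = R @ B" "map (outp P) R = concat (map (inp P) qs)" "map (outp P) B = ds"
      by (metis map_eq_append_conv)
    ultimately show thesis by (intro that) auto
  qed
  obtain rss where rss: "R = concat rss" "map (map (outp P)) rss = map (inp P) qs"
    using map_eq_concat[OF rs(4)] by blast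
  have "list_all2 (composable P) qs rss"
    using rss(2) assms(2,3) unfolding rs(1) rss(1)
  proof (induction qs arbitrary: rss)
    case (Cons q qs)
    then show ?case by (cases rss) (auto simp: composable_def)
  qed simp
  then show thesis using rs rss assms(2) by (intro that) auto
qed

lemma planar_compo_eq:
  assumes "uppers g = A @ concat rss @ B" "length A = pos f" "list_all2 (composable P) (uppers f) rss"
  shows "planar_compo P g f = \<lparr>src = src f,
    lower = pcmp P (lower g) (pos g) (cmp P (lower f) (A @ ident P (outp P (src f)) # B)),
    pos = pos g + sum_list (map (arity P) A), uppers = map2 (cmp P) (uppers f) rss\<rparr>"
proof -
  have len: "map (arity P) (uppers f) = map length rss"
    using assms(3) by (induction rule: list_all2_induct) (auto simp: composable_length)
  have "map2 (\<lambda>q b. cmp P q (map (\<lambda>j. uppers g ! (pos f + j)) b)) (uppers f) (blocks (map length rss)) =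
      map2 (cmp P) (uppers f) (map (map (\<lambda>j. uppers g ! (pos f + j))) (blocks (map length rss)))"
    by (simp add: zip_map2 comp_def case_prod_beta)
  also have "\<dots> = map2 (cmp P) (uppers f) rss"
    using nth_blocks[of A rss B] assms(1,2) by simp
  finally show ?thesis
    using assms(1,2) by (simp add: planar_compo_def Let_def len length_concat)
qed

text \<open>The upper vertices of \<open>g\<close> sit on the leaves of \<open>f\<close>.  In planar order these are the inputs of
  the lower vertex of \<open>f\<close> before the source (with \<open>A\<close> on them), those of the upper vertices of \<open>f\<close>
  (with \<open>rss\<close>), and the remaining ones of the lower vertex (with \<open>B\<close>).  Cutting \<open>uppers g\<close> in this
  way replaces the arithmetic of positions by list operations.\<close>

lemma planar_composableE:
  assumes f: "f \<in> arr (planar_Tw P)" and g: "g \<in> arr (planar_Tw P)" and fg: "planar_target P f = src g"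
  obtains cs ds A rss B where "src f \<in> Ops P" "lower f \<in> Ops P" "composable P (src f) (uppers f)"
    "inp P (lower f) = cs @ outp P (src f) # ds" "pos f = length cs"
    "uppers g = A @ concat rss @ B" "map (outp P) A = cs" "map (outp P) B = ds"
    "list_all2 (composable P) (uppers f) rss" "set A \<subseteq> Ops P" "set B \<subseteq> Ops P"
    "outp P (lower f) = outp P (src g)"
    "composable P (lower f) (A @ ident P (outp P (src f)) # B)"
    "planar_compo P g f = \<lparr>src = src f,
      lower = pcmp P (lower g) (pos g) (cmp P (lower f) (A @ ident P (outp P (src f)) # B)),
      pos = pos g + sum_list (map (arity P) A), uppers = map2 (cmp P) (uppers f) rss\<rparr>"
proof -
  obtain cs ds where 1: "src f \<in> Ops P" "lower f \<in> Ops P" "composable P (src f) (uppers f)"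
    "inp P (lower f) = cs @ outp P (src f) # ds" "pos f = length cs"
    using planar_arrowE[OF f] by metis
  have g': "composable P (src g) (uppers g)" using planar_arrowE[OF g] by metis
  note t = planar_target_facts[OF 1(2-5), unfolded fg]
  obtain A rss B where 2: "uppers g = A @ concat rss @ B" "map (outp P) A = cs" "map (outp P) B = ds"
    "list_all2 (composable P) (uppers f) rss" "set A \<subseteq> Ops P" "set B \<subseteq> Ops P"
    using split_along[of "uppers g" cs "uppers f" ds] g' t(3) 1(3) by (auto simp: composable_def)
  have "length A = pos f" using 1(5) 2(2) by (metis length_map)
  then have "planar_compo P g f = \<lparr>src = src f,
      lower = pcmp P (lower g) (pos g) (cmp P (lower f) (A @ ident P (outp P (src f)) # B)),
      pos = pos g + sum_list (map (arity P) A), uppers = map2 (cmp P) (uppers f) rss\<rparr>"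
    by (intro planar_compo_eq 2)
  moreover have "composable P (lower f) (A @ ident P (outp P (src f)) # B)"
    using 1 2 by (auto simp: composable_def ident_Ops outp_Col outp_ident)
  ultimately show thesis using 1 2 t(2) by (intro that) auto
qed

lemma planar_compo_arr:
  assumes f: "f \<in> arr (planar_Tw P)" and g: "g \<in> arr (planar_Tw P)" and fg: "planar_target P f = src g"
  shows "planar_compo P g f \<in> arr (planar_Tw P)"
    "planar_target P (planar_compo P g f) = planar_target P g"
proof -
  obtain cs ds A rss B where 1: "src f \<in> Ops P" "lower f \<in> Ops P" "composable P (src f) (uppers f)"
    "inp P (lower f) = cs @ outp P (src f) # ds" "pos f = length cs"
    "uppers g = A @ concat rss @ B" "map (outp P) A = cs" "map (outp P) B = ds"
    "list_all2 (composable P) (uppers f) rss" "set A \<subseteq> Ops P" "set B \<subseteq> Ops P"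
    "outp P (lower f) = outp P (src g)"
    and comp: "composable P (lower f) (A @ ident P (outp P (src f)) # B)"
    and eq: "planar_compo P g f = \<lparr>src = src f,
      lower = pcmp P (lower g) (pos g) (cmp P (lower f) (A @ ident P (outp P (src f)) # B)),
      pos = pos g + sum_list (map (arity P) A), uppers = map2 (cmp P) (uppers f) rss\<rparr>"
    by (rule planar_composableE[OF assms])
  obtain cs' ds' where 2: "lower g \<in> Ops P" "composable P (src g) (uppers g)"
    "inp P (lower g) = cs' @ outp P (src g) # ds'" "pos g = length cs'"
    using planar_arrowE[OF g] by metis
  let ?c = "outp P (src f)"
  let ?M = "cmp P (lower f) (A @ ident P ?c # B)"
  have M: "?M \<in> Ops P" "outp P ?M = outp P (src g)"
      "inp P ?M = concat (map (inp P) A) @ ?c # concat (map (inp P) B)"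
    using comp cmp_Ops outp_cmp inp_cmp 1 by (auto simp: inp_ident outp_Col)
  note low = pcmp_Ops[OF 2(1) M(1) 2(3)[folded M(2)], folded 2(4)]
  have q: "composable P (src f) (map2 (cmp P) (uppers f) rss)"
    using composable_cmp[OF 1(3,9)] by simp
  show "planar_compo P g f \<in> arr (planar_Tw P)"
    using low M q unfolding eq
    by (intro planar_arrowI[where cs = "cs' @ concat (map (inp P) A)" and ds = "concat (map (inp P) B) @ ds'"])
       (auto simp: 2(4) length_concat_inp)
  let ?Z = "cmp P (src f) (map2 (cmp P) (uppers f) rss)"
  have Z: "?Z \<in> Ops P" "outp P ?Z = ?c" using q cmp_Ops outp_cmp by auto
  have pM: "pcomposable P (lower g) (pos g) ?M" using 2 M by (auto simp: pcomposable_split)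
  have pZ: "pcomposable P ?M (sum_list (map (arity P) A)) ?Z"
    unfolding pcomposable_split using M Z
    by (intro conjI exI[of _ "concat (map (inp P) A)"] exI[of _ "concat (map (inp P) B)"])
       (auto simp: length_concat_inp)
  have "planar_target P (planar_compo P g f) = pcmp P (lower g) (pos g) (cmp P (lower f) (A @ ?Z # B))"
    unfolding eq planar_target_def using pcmp_pcmp[OF pM pZ] pcmp_cmp_ident[OF comp Z(1)] Z by simp
  also have "?Z = cmp P (cmp P (src f) (uppers f)) (concat rss)"
    using cmp_assoc[OF 1(3,9)] by simp
  also have "cmp P (lower f) (A @ \<dots> # B) = cmp P (pcmp P (lower f) (length A) (cmp P (src f) (uppers f)))
      (A @ concat rss @ B)"
    using 1 composable_cmp(2)[OF 1(3,9)] outp_cmp[OF 1(3)] by (intro cmp_pcmp[symmetric]) auto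
  also have "\<dots> = cmp P (src g) (uppers g)"
    using 1 fg by (metis length_map planar_target_def)
  finally show "planar_target P (planar_compo P g f) = planar_target P g"
    by (simp add: planar_target_def)
qed

lemma planar_idt:
  assumes "p \<in> Ops P"
  shows "idt (planar_Tw P) p \<in> arr (planar_Tw P)" "planar_target P (idt (planar_Tw P) p) = p"
  using assms composable_idents[OF assms] outp_Col[OF assms]
  by (auto simp: planar_target_def cmp_ident_right pcmp_ident
      intro!: planar_arrowI[where cs = "[]" and ds = "[]"] ident_Ops inp_ident)

lemma planar_compo_idt_left:
  assumes f: "f \<in> arr (planar_Tw P)"
  shows "planar_compo P (idt (planar_Tw P) (planar_target P f)) f = f"
proof -
  obtain cs ds where 1: "src f \<in> Ops P" "lower f \<in> Ops P" "composable P (src f) (uppers f)"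
    "inp P (lower f) = cs @ outp P (src f) # ds" "pos f = length cs"
    using planar_arrowE[OF f] by metis
  note t = planar_target_facts[OF 1(2-5)]
  have q: "set (uppers f) \<subseteq> Ops P" using 1 by (simp add: composable_def)
  have col: "set cs \<subseteq> Col P" using inp_Col[OF 1(2)] 1(4) by simp
  have "planar_compo P (idt (planar_Tw P) (planar_target P f)) f = \<lparr>src = src f,
    lower = pcmp P (lower (idt (planar_Tw P) (planar_target P f))) (pos (idt (planar_Tw P) (planar_target P f)))
      (cmp P (lower f) (map (ident P) cs @ ident P (outp P (src f)) # map (ident P) ds)),
    pos = pos (idt (planar_Tw P) (planar_target P f)) + sum_list (map (arity P) (map (ident P) cs)),
    uppers = map2 (cmp P) (uppers f) (map (\<lambda>q. map (ident P) (inp P q)) (uppers f))\<rparr>"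
    using 1 t composable_idents_list[OF q]
    by (intro planar_compo_eq) (auto simp: map_concat comp_def)
  also have "cmp P (lower f) (map (ident P) cs @ ident P (outp P (src f)) # map (ident P) ds) = lower f"
    using cmp_ident_right[OF 1(2)] 1(4) by simp
  also have "sum_list (map (arity P) (map (ident P) cs)) = length cs"
    by (rule arity_idents[OF col])
  finally show ?thesis
    using 1 t cmp_idents_list[OF q] pcmp_ident[OF 1(2)] by simp
qed

lemma planar_compo_idt_right:
  assumes f: "f \<in> arr (planar_Tw P)"
  shows "planar_compo P f (idt (planar_Tw P) (src f)) = f"
proof -
  obtain cs ds where 1: "src f \<in> Ops P" "lower f \<in> Ops P" "composable P (src f) (uppers f)"
    "inp P (lower f) = cs @ outp P (src f) # ds" "pos f = length cs"
    using planar_arrowE[OF f] by metis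
  have q: "set (uppers f) \<subseteq> Ops P" "inp P (src f) = map (outp P) (uppers f)" using 1 by (auto simp: composable_def)
  have "planar_compo P f (idt (planar_Tw P) (src f)) = \<lparr>src = src (idt (planar_Tw P) (src f)),
    lower = pcmp P (lower f) (pos f) (cmp P (lower (idt (planar_Tw P) (src f)))
      ([] @ ident P (outp P (src (idt (planar_Tw P) (src f)))) # [])),
    pos = pos f + sum_list (map (arity P) []),
    uppers = map2 (cmp P) (uppers (idt (planar_Tw P) (src f))) (map (\<lambda>q. [q]) (uppers f))\<rparr>"
    using idents_composable_list[OF q(1)] q(2) by (intro planar_compo_eq) auto
  also have "\<dots> = f"
    using 1 q idents_cmp_list[OF q(1)] outp_Col[OF 1(1)]
    by (simp add: cmp_ident ident_Ops outp_ident pcmp_ident_right)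
  finally show ?thesis .
qed

lemma planar_compo_assoc:
  assumes f: "f \<in> arr (planar_Tw P)" and g: "g \<in> arr (planar_Tw P)" and h: "h \<in> arr (planar_Tw P)"
    and fg: "planar_target P f = src g" and gh: "planar_target P g = src h"
  shows "planar_compo P h (planar_compo P g f) = planar_compo P (planar_compo P h g) f"
proof -
  obtain cs ds A rss B where 1: "src f \<in> Ops P" "lower f \<in> Ops P" "composable P (src f) (uppers f)"
    "inp P (lower f) = cs @ outp P (src f) # ds" "pos f = length cs"
    "uppers g = A @ concat rss @ B" "map (outp P) A = cs" "map (outp P) B = ds"
    "list_all2 (composable P) (uppers f) rss" "set A \<subseteq> Ops P" "set B \<subseteq> Ops P"
    "outp P (lower f) = outp P (src g)"
    and comp: "composable P (lower f) (A @ ident P (outp P (src f)) # B)"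
    and eq: "planar_compo P g f = \<lparr>src = src f,
      lower = pcmp P (lower g) (pos g) (cmp P (lower f) (A @ ident P (outp P (src f)) # B)),
      pos = pos g + sum_list (map (arity P) A), uppers = map2 (cmp P) (uppers f) rss\<rparr>"
    by (rule planar_composableE[OF f g fg])
  obtain cs' ds' C sss D where 2: "src g \<in> Ops P" "lower g \<in> Ops P" "composable P (src g) (uppers g)"
    "inp P (lower g) = cs' @ outp P (src g) # ds'" "pos g = length cs'"
    "uppers h = C @ concat sss @ D" "map (outp P) C = cs'" "map (outp P) D = ds'"
    "list_all2 (composable P) (uppers g) sss" "set C \<subseteq> Ops P" "set D \<subseteq> Ops P"
    "outp P (lower g) = outp P (src h)"
    and comp': "composable P (lower g) (C @ ident P (outp P (src g)) # D)"
    and eq': "planar_compo P h g = \<lparr>src = src g,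
      lower = pcmp P (lower h) (pos h) (cmp P (lower g) (C @ ident P (outp P (src g)) # D)),
      pos = pos h + sum_list (map (arity P) C), uppers = map2 (cmp P) (uppers g) sss\<rparr>"
    by (rule planar_composableE[OF g h gh])
  obtain cs'' ds'' where 3: "lower h \<in> Ops P" "inp P (lower h) = cs'' @ outp P (src h) # ds''" "pos h = length cs''"
    using planar_arrowE[OF h] by metis
  \<comment> \<open>The upper vertices of \<open>h\<close> that lie over those of \<open>g\<close> are cut in the same way as the latter,
    into those over \<open>A\<close>, over \<open>rss\<close> and over \<open>B\<close>.\<close>
  obtain sA sR sB where sss: "sss = sA @ sR @ sB" "list_all2 (composable P) A sA"
      "list_all2 (composable P) (concat rss) sR" "list_all2 (composable P) B sB"
    using 2(9) unfolding 1(6) by (auto simp: list_all2_append1)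
  obtain ssR where ssR: "sR = concat ssR" "list_all2 (list_all2 (composable P)) rss ssR"
  proof -
    have "\<exists>ssR. sR = concat ssR \<and> list_all2 (list_all2 (composable P)) rss ssR"
      using sss(3)
    proof (induction rss arbitrary: sR)
      case (Cons rs rss)
      then obtain u v where "sR = u @ v" "list_all2 (composable P) rs u" "list_all2 (composable P) (concat rss) v"
        by (auto simp: list_all2_append1)
      then show ?case using Cons.IH[of v] by (metis concat.simps(2) list.rel_intros(2))
    qed simp
    then show thesis using that by blast
  qed
  have lens: "map length rss = map length ssR"
    using ssR(2) by (induction rule: list_all2_induct) (auto dest: list_all2_lengthD)
  let ?c = "outp P (src f)" and ?d = "outp P (src g)"
  let ?A = "map2 (cmp P) A sA" and ?B = "map2 (cmp P) B sB" and ?R = "map2 (map2 (cmp P)) rss ssR"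
  let ?M = "cmp P (lower f) (A @ ident P ?c # B)"
  have upp: "map2 (cmp P) (uppers g) sss = ?A @ concat ?R @ ?B"
    using sss lens unfolding 1(6) ssR(1) by (simp add: map2_concat list_all2_lengthD)
  have R: "list_all2 (composable P) (uppers f) ?R"
    using 1(9) ssR(2)
  proof (induction arbitrary: ssR rule: list_all2_induct)
    case (Cons q qs rs rss)
    then show ?case by (cases ssR) (auto simp: composable_cmp)
  qed simp
  have AB: "map (outp P) ?A = cs" "map (outp P) ?B = ds" "set ?A \<subseteq> Ops P" "set ?B \<subseteq> Ops P"
    using cmp_list[OF sss(2)] cmp_list[OF sss(4)] 1(7,8) by simp_all
  have lA: "length ?A = pos f" using AB(1) 1(5) by (metis length_map)
  have rhs: "planar_compo P (planar_compo P h g) f = \<lparr>src = src f,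
      lower = pcmp P (pcmp P (lower h) (pos h) (cmp P (lower g) (C @ ident P ?d # D)))
        (pos h + sum_list (map (arity P) C)) (cmp P (lower f) (?A @ ident P ?c # ?B)),
      pos = pos h + sum_list (map (arity P) C) + sum_list (map (arity P) ?A),
      uppers = map2 (cmp P) (uppers f) ?R\<rparr>"
    using planar_compo_eq[of "planar_compo P h g" ?A ?R ?B f] upp lA R unfolding eq' by simp
  have C: "length C = pos g" using 2(5,7) by (metis length_map)
  have CsA: "length (C @ concat sA) = pos (planar_compo P g f)"
  proof -
    have "length (concat sA) = sum_list (map (arity P) A)"
      using sss(2) by (induction rule: list_all2_induct) (auto simp: composable_length)
    then show ?thesis using C by (simp add: eq)
  qed
  have S: "list_all2 (composable P) (map2 (cmp P) (uppers f) rss) (map concat ssR)"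
    using 1(9) ssR(2)
  proof (induction arbitrary: ssR rule: list_all2_induct)
    case (Cons q qs rs rss)
    then show ?case by (cases ssR) (auto simp: composable_cmp)
  qed simp
  have uh: "uppers h = (C @ concat sA) @ concat (map concat ssR) @ (concat sB @ D)"
    by (simp add: 2(6) sss(1) ssR(1) concat_concat_map)
  have lhs: "planar_compo P h (planar_compo P g f) = \<lparr>src = src f,
      lower = pcmp P (lower h) (pos h) (cmp P (pcmp P (lower g) (pos g) ?M)
         ((C @ concat sA) @ ident P ?c # (concat sB @ D))),
      pos = pos h + sum_list (map (arity P) (C @ concat sA)),
      uppers = map2 (cmp P) (map2 (cmp P) (uppers f) rss) (map concat ssR)\<rparr>"
    using planar_compo_eq[OF uh CsA] S unfolding eq by simp
  let ?N = "cmp P (lower f) (?A @ ident P ?c # ?B)"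
  have low: "pcmp P (lower h) (pos h) (cmp P (pcmp P (lower g) (pos g) ?M)
         ((C @ concat sA) @ ident P ?c # (concat sB @ D))) =
      pcmp P (pcmp P (lower h) (pos h) (cmp P (lower g) (C @ ident P ?d # D)))
        (pos h + sum_list (map (arity P) C)) ?N"
    unfolding C[symmetric] 1(12)[symmetric]
    using comp comp'[folded 1(12)] sss 3 1(1) 2
    by (intro lower_vertex_assoc) (auto simp: outp_Col pcomposable_split)
  have "sum_list (map (arity P) (concat sA)) = sum_list (map (arity P) ?A)"
    using sss(2)
    by (induction rule: list_all2_induct) (auto simp: arity_def inp_cmp length_concat comp_def)
  then show ?thesis
    unfolding lhs rhs low using cmp_assoc_list[OF 1(9) ssR(2)] by simp
qed

lemma planar_Tw_category: "category (planar_Tw P)"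
proof
  fix f assume f: "f \<in> arr (planar_Tw P)"
  show "dom (planar_Tw P) f \<in> obj (planar_Tw P)" "cod (planar_Tw P) f \<in> obj (planar_Tw P)"
    using planar_arrowE[OF f] planar_target_facts(1) planar_Tw_simps(1-3) by metis+
next
  fix f g a b c assume "f \<in> hom (planar_Tw P) a b" "g \<in> hom (planar_Tw P) b c"
  then show "compo (planar_Tw P) g f \<in> hom (planar_Tw P) a c"
    using planar_compo_arr[of f g] by (auto simp: hom_def planar_compo_def Let_def)
next
  fix f a b assume "f \<in> hom (planar_Tw P) a b"
  then show "compo (planar_Tw P) (idt (planar_Tw P) b) f = f" "compo (planar_Tw P) f (idt (planar_Tw P) a) = f"
    using planar_compo_idt_left[of f] planar_compo_idt_right[of f] by (auto simp: hom_def)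
next
  fix f g h a b c d
  assume "f \<in> hom (planar_Tw P) a b" "g \<in> hom (planar_Tw P) b c" "h \<in> hom (planar_Tw P) c d"
  then show "compo (planar_Tw P) h (compo (planar_Tw P) g f) = compo (planar_Tw P) (compo (planar_Tw P) h g) f"
    using planar_compo_assoc[of f g h] by (auto simp: hom_def)
next
  fix a assume "a \<in> obj (planar_Tw P)"
  then show "idt (planar_Tw P) a \<in> hom (planar_Tw P) a a"
    using planar_idt[of a] by (simp add: hom_def)
qed

end

section \<open>Invertible unary operations\<close>

context planar_operad
begin

abbreviation unary_iso :: "'o \<Rightarrow> bool" where
  "unary_iso u \<equiv> iso (unary_category P) u"

lemma arity_ident: "c \<in> Col P \<Longrightarrow> arity P (ident P c) = 1"
  by (simp add: arity_def inp_ident)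

lemma unary_isoE:
  assumes "unary_iso u"
  obtains c u' where "u \<in> Ops P" "u' \<in> Ops P" "c \<in> Col P" "inp P u = [c]" "inp P u' = [outp P u]" "outp P u' = c"
    "cmp P u' [u] = ident P c" "cmp P u [u'] = ident P (outp P u)" "unary_iso u'"
proof -
  obtain u' where u: "u \<in> Ops P" "arity P u = 1" and u': "u' \<in> Ops P" "arity P u' = 1"
    "hd (inp P u') = outp P u" "outp P u' = hd (inp P u)"
    "cmp P u' [u] = ident P (hd (inp P u))" "cmp P u [u'] = ident P (outp P u)"
    using assms by (auto simp: iso_def hom_def unary_category_def)
  have "unary_iso u'" using u u' by (auto simp: iso_def hom_def unary_category_def)
  moreover have "inp P u = [hd (inp P u)]" "inp P u' = [hd (inp P u')]"
    using u u' by (auto simp: arity_def length_Suc_conv)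
  ultimately show thesis
    using u u' inp_Col[OF u(1)] outp_Col[OF u'(1)] by (intro that[of u' "hd (inp P u)"]) auto
qed

lemma unary_isoI:
  assumes "u \<in> Ops P" "u' \<in> Ops P" "inp P u = [c]" "inp P u' = [d]" "outp P u = d" "outp P u' = c"
    "cmp P u' [u] = ident P c" "cmp P u [u'] = ident P d"
  shows "unary_iso u"
  using assms by (auto simp: iso_def hom_def unary_category_def arity_def)

lemma unary_iso_ident: "q \<in> identities P \<Longrightarrow> unary_iso q"
proof -
  assume "q \<in> identities P"
  then obtain c where "c \<in> Col P" "q = ident P c" by (auto simp: identities_def)
  then show ?thesis
    by (intro unary_isoI[of q q c c]) (auto simp: cmp_ident ident_Ops inp_ident outp_ident)
qed

lemma unary_iso_cmp:
  assumes "unary_iso u" "unary_iso v" "composable P u [v]"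
  shows "unary_iso (cmp P u [v])"
proof -
  obtain c u' where u: "u \<in> Ops P" "u' \<in> Ops P" "c \<in> Col P" "inp P u = [c]" "inp P u' = [outp P u]" "outp P u' = c"
    "cmp P u' [u] = ident P c" "cmp P u [u'] = ident P (outp P u)"
    using unary_isoE[OF assms(1)] by metis
  obtain d v' where v: "v \<in> Ops P" "v' \<in> Ops P" "d \<in> Col P" "inp P v = [d]" "inp P v' = [outp P v]" "outp P v' = d"
    "cmp P v' [v] = ident P d" "cmp P v [v'] = ident P (outp P v)"
    using unary_isoE[OF assms(2)] by metis
  have vo: "outp P v = c" using assms(3) u by (simp add: composable_def)
  have comp: "composable P u [v]" "composable P v' [u']" "composable P v [v']" "composable P u' [u]"
    using u v vo by (auto simp: composable_def)
  have 1: "cmp P (cmp P x [y]) [z] = cmp P x [cmp P y [z]]" if "composable P x [y]" "composable P y [z]" for x y z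
    using cmp_assoc[of x "[y]" "[[z]]"] that by simp
  have c2: "composable P v [cmp P v' [u']]" "composable P u' [cmp P u [v]]"
    using comp cmp_Ops outp_cmp u v vo by (auto simp: composable_def)
  have "cmp P (cmp P u [v]) [cmp P v' [u']] = cmp P u [cmp P (cmp P v [v']) [u']]"
    using 1[of u v "cmp P v' [u']"] 1[of v v' u'] comp c2 by simp
  then have a: "cmp P (cmp P u [v]) [cmp P v' [u']] = ident P (outp P u)"
    using u v vo by (simp add: cmp_ident)
  have "cmp P (cmp P v' [u']) [cmp P u [v]] = cmp P v' [cmp P (cmp P u' [u]) [v]]"
    using 1[of v' u' "cmp P u [v]"] 1[of u' u v] comp c2 by simp
  then have b: "cmp P (cmp P v' [u']) [cmp P u [v]] = ident P d"
    using u v vo by (simp add: cmp_ident)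
  show ?thesis
    using a b comp cmp_Ops outp_cmp inp_cmp u v by (intro unary_isoI[of _ "cmp P v' [u']" d "outp P u"]) auto
qed

text \<open>An operation of arity 0 cannot be completed to an identity by grafting operations onto it, so
  all operations in \<open>Q\<close> and \<open>R\<close> have inputs.  Hence a graft of several of them onto one operation has
  several inputs, and all grafts in question are of the form \<open>q(r)\<close> and \<open>r(q')\<close>.  As the right
  inverse \<open>r\<close> of \<open>q\<close> has a right inverse \<open>q'\<close> itself, \<open>q' = q\<close>.\<close>

lemma mutually_right_invertible:
  assumes Q: "\<And>q. q \<in> Q \<Longrightarrow> \<exists>rs. set rs \<subseteq> R \<and> composable P q rs \<and> cmp P q rs \<in> identities P"
    and R: "\<And>r. r \<in> R \<Longrightarrow> \<exists>qs. set qs \<subseteq> Q \<and> composable P r qs \<and> cmp P r qs \<in> identities P"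
    and q: "q \<in> Q"
  shows "unary_iso q"
proof -
  have ar: "sum_list (map (arity P) rs) = 1" if "composable P q rs" "cmp P q rs \<in> identities P" for q rs
  proof -
    have "arity P (cmp P q rs) = 1" using that(2) by (auto simp: identities_def arity_ident)
    then show ?thesis using inp_cmp[OF that(1)] length_concat_inp[of rs] by (simp add: arity_def)
  qed
  have pos: "arity P q \<noteq> 0" if "composable P q rs" "cmp P q rs \<in> identities P" for q rs
    using ar[OF that] composable_length[OF that(1)] by (cases rs) auto
  have one: "\<exists>r. rs = [r]"
    if "composable P q rs" "cmp P q rs \<in> identities P" "\<forall>r \<in> set rs. arity P r \<noteq> 0" for q rs
  proof -
    have "length rs \<le> sum_list (map (arity P) rs)"
      using that(3) by (induction rs) (auto simp: Suc_le_eq add_strict_increasing2 intro: le_trans)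
    then have "length rs \<le> 1" "rs \<noteq> []" using ar[OF that(1,2)] by auto
    then show ?thesis by (cases rs) auto
  qed
  have Q1: "\<exists>r \<in> R. composable P q [r] \<and> cmp P q [r] \<in> identities P" if qQ: "q \<in> Q" for q
  proof -
    obtain rs where rs: "set rs \<subseteq> R" "composable P q rs" "cmp P q rs \<in> identities P" using Q[OF qQ] by blast
    have "\<forall>r \<in> set rs. arity P r \<noteq> 0" using pos R rs(1) by blast
    then show ?thesis using one[OF rs(2,3)] rs by auto
  qed
  have R1: "\<exists>q \<in> Q. composable P r [q] \<and> cmp P r [q] \<in> identities P" if rR: "r \<in> R" for r
  proof -
    obtain qs where qs: "set qs \<subseteq> Q" "composable P r qs" "cmp P r qs \<in> identities P" using R[OF rR] by blast
    have "\<forall>q \<in> set qs. arity P q \<noteq> 0" using pos Q qs(1) by blast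
    then show ?thesis using one[OF qs(2,3)] qs by auto
  qed
  obtain r where r: "r \<in> R" "composable P q [r]" "cmp P q [r] \<in> identities P" using Q1[OF q] by blast
  obtain q' where q': "q' \<in> Q" "composable P r [q']" "cmp P r [q'] \<in> identities P" using R1[OF r(1)] by blast
  have ident: "cmp P x [y] = ident P (outp P x)" if "composable P x [y]" "cmp P x [y] \<in> identities P" for x y
    using that outp_cmp[OF that(1)] by (auto simp: identities_def outp_ident)
  have Ops: "q \<in> Ops P" "r \<in> Ops P" "q' \<in> Ops P" "inp P q = [outp P r]" "inp P r = [outp P q']"
    using r q' by (auto simp: composable_def)
  have qr: "cmp P q [r] = ident P (outp P q)" and rq': "cmp P r [q'] = ident P (outp P r)"
    using ident r q' by auto
  have "inp P (cmp P q [r]) = inp P r" using inp_cmp[OF r(2)] by simp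
  then have out: "outp P q' = outp P q" using qr Ops by (simp add: inp_ident outp_Col)
  have "q' = cmp P (cmp P q [r]) [q']" using qr Ops out by (simp add: cmp_ident)
  also have "\<dots> = cmp P q [cmp P r [q']]" using cmp_assoc[of q "[r]" "[[q']]"] r q' by simp
  also have "\<dots> = q" using rq' Ops cmp_ident_right[of q] by simp
  finally show ?thesis
    using Ops qr rq' out by (intro unary_isoI[of q r "outp P r" "outp P q"]) auto
qed

lemma identity_cmp: "q \<in> identities P \<Longrightarrow> composable P q rs \<Longrightarrow> \<exists>r. rs = [r] \<and> cmp P q rs = r"
  by (auto simp: identities_def composable_def inp_ident cmp_ident)

end

section \<open>Subcategories of the planar twisted arrow category\<close>

context planar_operad
begin

lemma planar_LowerD:
  assumes "f \<in> planar_Lower P"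
  shows "f \<in> arr (planar_Tw P)" "set (uppers f) \<subseteq> identities P"
  using assms by (auto simp: planar_Lower_def)

lemma planar_Lower_idt: "p \<in> Ops P \<Longrightarrow> idt (planar_Tw P) p \<in> planar_Lower P"
  using planar_idt(1)[of p] inp_Col[of p] by (auto simp: planar_Lower_def identities_def)

lemma planar_compo_upperE:
  assumes "f \<in> arr (planar_Tw P)" "g \<in> arr (planar_Tw P)" "planar_target P f = src g"
    and "q \<in> set (uppers (planar_compo P g f))"
  obtains q1 rs where "q1 \<in> set (uppers f)" "set rs \<subseteq> set (uppers g)" "composable P q1 rs" "q = cmp P q1 rs"
proof (rule planar_composableE[OF assms(1-3)])
  fix cs ds A rss B
  assume a: "uppers g = A @ concat rss @ B" "list_all2 (composable P) (uppers f) rss"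
    "planar_compo P g f = \<lparr>src = src f,
      lower = pcmp P (lower g) (pos g) (cmp P (lower f) (A @ ident P (outp P (src f)) # B)),
      pos = pos g + sum_list (map (arity P) A), uppers = map2 (cmp P) (uppers f) rss\<rparr>"
  have "q \<in> set (map2 (cmp P) (uppers f) rss)" using assms(4) by (simp add: a(3))
  then obtain i where i': "i < length (map2 (cmp P) (uppers f) rss)" "map2 (cmp P) (uppers f) rss ! i = q"
    unfolding in_set_conv_nth by blast
  have i: "i < length (uppers f)" "q = cmp P (uppers f ! i) (rss ! i)" "length rss = length (uppers f)"
    using i' list_all2_lengthD[OF a(2)] by auto
  have "rss ! i \<in> set rss" using i by simp
  then have "set (rss ! i) \<subseteq> set (uppers g)" unfolding a(1) by auto
  moreover have "composable P (uppers f ! i) (rss ! i)" using a(2) i(1) by (simp add: list_all2_conv_all_nth)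
  moreover have "uppers f ! i \<in> set (uppers f)" using i(1) by simp
  ultimately show thesis using i(2) by (intro that)
qed

lemma planar_compo_upperI:
  assumes "f \<in> arr (planar_Tw P)" "g \<in> arr (planar_Tw P)" "planar_target P f = src g"
    and "q1 \<in> set (uppers f)"
  obtains rs where "set rs \<subseteq> set (uppers g)" "composable P q1 rs" "cmp P q1 rs \<in> set (uppers (planar_compo P g f))"
proof (rule planar_composableE[OF assms(1-3)])
  fix cs ds A rss B
  assume a: "uppers g = A @ concat rss @ B" "list_all2 (composable P) (uppers f) rss"
    "planar_compo P g f = \<lparr>src = src f,
      lower = pcmp P (lower g) (pos g) (cmp P (lower f) (A @ ident P (outp P (src f)) # B)),
      pos = pos g + sum_list (map (arity P) A), uppers = map2 (cmp P) (uppers f) rss\<rparr>"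
  obtain i where i: "i < length (uppers f)" "q1 = uppers f ! i" using assms(4) by (auto simp: in_set_conv_nth)
  have l: "length rss = length (uppers f)" using list_all2_lengthD[OF a(2)] by simp
  have "map2 (cmp P) (uppers f) rss ! i = cmp P q1 (rss ! i)" using i l by simp
  then have "cmp P q1 (rss ! i) \<in> set (uppers (planar_compo P g f))"
    using i l nth_mem[of i "map2 (cmp P) (uppers f) rss"] by (simp add: a(3))
  moreover have "rss ! i \<in> set rss" using i l by simp
  then have "set (rss ! i) \<subseteq> set (uppers g)" using a(1) by auto
  moreover have "composable P q1 (rss ! i)" using a(2) i by (simp add: list_all2_conv_all_nth)
  ultimately show thesis using that by blast
qed

lemma planar_Lower_compo:
  assumes "f \<in> planar_Lower P" "g \<in> planar_Lower P" "planar_target P f = src g"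
  shows "planar_compo P g f \<in> planar_Lower P"
proof -
  note f = planar_LowerD[OF assms(1)] and g = planar_LowerD[OF assms(2)]
  have "q \<in> identities P" if q: "q \<in> set (uppers (planar_compo P g f))" for q
  proof -
    obtain q1 rs where "q1 \<in> set (uppers f)" "set rs \<subseteq> set (uppers g)" "composable P q1 rs" "q = cmp P q1 rs"
      using planar_compo_upperE[OF f(1) g(1) assms(3) q] .
    moreover from this obtain r where "rs = [r]" "cmp P q1 rs = r" using identity_cmp[of q1 rs] f(2) by auto
    ultimately show ?thesis using g(2) by auto
  qed
  then show ?thesis
    using planar_compo_arr(1)[OF f(1) g(1) assms(3)] by (auto simp: planar_Lower_def)
qed

lemma planar_Perm_idt: "f \<in> planar_Perm P \<Longrightarrow> f = idt (planar_Tw P) (src f)"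
proof -
  assume "f \<in> planar_Perm P"
  then have f: "f \<in> arr (planar_Tw P)" "lower f \<in> identities P" "set (uppers f) \<subseteq> identities P"
    by (auto simp: planar_Perm_def)
  obtain cs ds where 1: "src f \<in> Ops P" "composable P (src f) (uppers f)"
    "inp P (lower f) = cs @ outp P (src f) # ds" "pos f = length cs"
    using planar_arrowE[OF f(1)] by metis
  have "cs = []" "lower f = ident P (outp P (src f))"
    using f(2) 1(3) by (auto simp: identities_def inp_ident Cons_eq_append_conv)
  moreover have "uppers f = map (ident P) (inp P (src f))"
  proof -
    have "map (ident P) (map (outp P) (uppers f)) = uppers f"
      using f(3) by (auto intro!: map_idI simp: identities_def outp_ident)
    then show ?thesis using 1(2) by (metis composable_def)
  qed
  ultimately show ?thesis using 1 by (intro planar_arrow.equality) auto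
qed

lemma planar_composites_Lower_Perm: "composites (planar_Tw P) (planar_Lower P) (planar_Perm P) = planar_Lower P"
proof (intro equalityI subsetI)
  fix h assume "h \<in> composites (planar_Tw P) (planar_Lower P) (planar_Perm P)"
  then obtain f g where fg: "h = planar_compo P g f" "f \<in> planar_Perm P" "g \<in> planar_Lower P" "planar_target P f = src g"
    by (auto simp: composites_def)
  have "f = idt (planar_Tw P) (src f)" by (rule planar_Perm_idt[OF fg(2)])
  moreover have "src f \<in> Ops P" using fg(2) planar_arrowE[of f] by (auto simp: planar_Perm_def)
  ultimately have "src g = src f" using planar_idt(2) fg(4) by metis
  then have "h = g"
    using fg(1) \<open>f = idt (planar_Tw P) (src f)\<close> planar_compo_idt_right[of g] planar_LowerD(1)[OF fg(3)] by metis
  then show "h \<in> planar_Lower P" using fg by simp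
next
  fix h assume h: "h \<in> planar_Lower P"
  note h' = planar_LowerD[OF h]
  have s: "src h \<in> Ops P" using planar_arrowE[OF h'(1)] by metis
  have "idt (planar_Tw P) (src h) \<in> planar_Perm P"
    using planar_idt(1)[OF s] inp_Col[OF s] outp_Col[OF s] by (auto simp: planar_Perm_def identities_def)
  moreover have "h = compo (planar_Tw P) h (idt (planar_Tw P) (src h))"
    using planar_compo_idt_right[OF h'(1)] by simp
  moreover have "cod (planar_Tw P) (idt (planar_Tw P) (src h)) = dom (planar_Tw P) h"
    using planar_idt(2)[OF s] by simp
  ultimately show "h \<in> composites (planar_Tw P) (planar_Lower P) (planar_Perm P)"
    using h unfolding composites_def by blast
qed

lemma planar_input_maps_facts:
  assumes "h \<in> planar_input_maps P p"
  shows "h \<in> planar_Lower P" "planar_target P h = p" "p \<in> Ops P \<Longrightarrow> src h \<in> identities P"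
proof -
  obtain j where j: "j < arity P p" "h \<in> planar_Lower P" "src h = ident P (inp P p ! j)" "planar_target P h = p"
    using assms by (auto simp: planar_input_maps_def)
  then show "h \<in> planar_Lower P" "planar_target P h = p" by auto
  assume "p \<in> Ops P"
  then have "inp P p ! j \<in> Col P" using inp_Col j(1) nth_mem unfolding arity_def by blast
  then show "src h \<in> identities P" using j by (simp add: identities_def)
qed

lemma planar_petal_Lower:
  assumes "f \<in> arr (planar_Tw P)" "arity P (src f) = 0"
  shows "f \<in> planar_Lower P"
proof -
  have "composable P (src f) (uppers f)" by (rule planar_arrowE[OF assms(1)])
  then have "uppers f = []" using composable_length[of "src f" "uppers f"] assms(2) by simp
  then show ?thesis using assms(1) by (simp add: planar_Lower_def)
qed

lemma planar_Lower_from_identity: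
  assumes f: "f \<in> planar_Lower P" and s: "src f \<in> identities P"
  shows "f \<in> planar_input_maps P (planar_target P f)"
proof -
  note f' = planar_LowerD[OF f]
  obtain cs ds where 1: "src f \<in> Ops P" "lower f \<in> Ops P" "composable P (src f) (uppers f)"
    "inp P (lower f) = cs @ outp P (src f) # ds" "pos f = length cs"
    using planar_arrowE[OF f'(1)] by metis
  obtain u where u: "uppers f = [u]" using identity_cmp[OF s 1(3)] by blast
  have "u \<in> identities P" using u f' by simp
  then have e: "src f = ident P (outp P u)" "inp P u = [outp P u]"
    using s 1(3) u by (auto simp: identities_def composable_def inp_ident outp_ident)
  have "inp P (planar_target P f) = cs @ inp P u @ ds"
    using planar_target_facts(3)[OF 1(2-5)] u by simp
  then have "length cs < arity P (planar_target P f)" "inp P (planar_target P f) ! length cs = outp P u"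
    using e(2) by (simp_all add: arity_def)
  then show ?thesis
    using f 1(5) e(1) unfolding planar_input_maps_def
    by (intro CollectI exI[of _ "length cs"]) simp
qed

text \<open>In the composites of \<open>f\<close> with its inverse, in both orders, the grafts at the upper vertices are
  identities.\<close>

lemma planar_iso_uppers:
  assumes "iso (planar_Tw P) f" "q \<in> set (uppers f)"
  shows "unary_iso q"
proof -
  interpret category "planar_Tw P" by (rule planar_Tw_category)
  obtain g where g0: "g \<in> arr (planar_Tw P)" "dom (planar_Tw P) g = cod (planar_Tw P) f"
    "cod (planar_Tw P) g = dom (planar_Tw P) f"
    "compo (planar_Tw P) g f = idt (planar_Tw P) (dom (planar_Tw P) f)"
    "compo (planar_Tw P) f g = idt (planar_Tw P) (cod (planar_Tw P) f)"
    by (rule inverse_exists[OF assms(1)])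
  then have g: "f \<in> arr (planar_Tw P)" "g \<in> arr (planar_Tw P)" "src g = planar_target P f" "planar_target P g = src f"
    "planar_compo P g f = idt (planar_Tw P) (src f)" "planar_compo P f g = idt (planar_Tw P) (planar_target P f)"
    using iso_arr[OF assms(1)] by (simp_all del: planar_Tw_simps(5))
  have idt: "set (uppers (idt (planar_Tw P) p)) \<subseteq> identities P" if "p \<in> Ops P" for p
    using planar_Lower_idt[OF that] planar_LowerD by blast
  have o: "src f \<in> Ops P" "planar_target P f \<in> Ops P" using dom_obj[OF g(1)] cod_obj[OF g(1)] by auto
  show ?thesis
  proof (rule mutually_right_invertible[OF _ _ assms(2)])
    fix q assume "q \<in> set (uppers f)"
    then show "\<exists>rs. set rs \<subseteq> set (uppers g) \<and> composable P q rs \<and> cmp P q rs \<in> identities P"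
      using planar_compo_upperI[OF g(1,2) g(3)[symmetric]] idt[OF o(1)] g(5) by (metis subsetD)
  next
    fix r assume "r \<in> set (uppers g)"
    then show "\<exists>qs. set qs \<subseteq> set (uppers f) \<and> composable P r qs \<and> cmp P r qs \<in> identities P"
      using planar_compo_upperI[OF g(2,1,4)] idt[OF o(2)] g(6) by (metis subsetD)
  qed
qed

lemma planar_Inert_uppers:
  assumes "f \<in> Inert (planar_Tw P) (planar_Lower P)"
  shows "f \<in> arr (planar_Tw P) \<and> (\<forall>q \<in> set (uppers f). unary_iso q)"
  using assms
proof induction
  case (lower f)
  then show ?case using planar_LowerD[of f] unary_iso_ident by blast
next
  case (isom f)
  then show ?case using planar_iso_uppers category.iso_arr[OF planar_Tw_category] by blast
next
  case (compo f g)
  have fg: "f \<in> arr (planar_Tw P)" "g \<in> arr (planar_Tw P)" "planar_target P f = src g"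
    using compo by auto
  have "unary_iso q" if q: "q \<in> set (uppers (planar_compo P g f))" for q
  proof -
    obtain q1 rs where r: "q1 \<in> set (uppers f)" "set rs \<subseteq> set (uppers g)" "composable P q1 rs" "q = cmp P q1 rs"
      using planar_compo_upperE[OF fg q] .
    have u: "unary_iso q1" using compo r by blast
    then have "length rs = 1" using unary_isoE[OF u] r(3) composable_length by (metis arity_def length_Cons list.size(3) One_nat_def)
    then obtain x where "rs = [x]" by (auto simp: length_Suc_conv)
    then show ?thesis using unary_iso_cmp[OF u, of x] r compo by auto
  qed
  then show ?case using planar_compo_arr(1)[OF fg] by simp
qed

text \<open>For \<open>u\<close> from \<open>c\<close> to \<open>d\<close> with inverse \<open>u'\<close>, the isomorphism \<open>id\<^sub>d \<rightarrow> id\<^sub>c\<close> given by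
  \<open>u' \<circ> id\<^sub>d \<circ> u = id\<^sub>c\<close>.\<close>

definition planar_conjugation :: "'o \<Rightarrow> 'o \<Rightarrow> 'o planar_arrow" where
  "planar_conjugation u u' = \<lparr>src = ident P (outp P u), lower = u', pos = 0, uppers = [u]\<rparr>"

lemma planar_conjugation_arr:
  assumes "u \<in> Ops P" "u' \<in> Ops P" "inp P u = [c]" "inp P u' = [outp P u]" "outp P u' = c" "cmp P u' [u] = ident P c"
  shows "planar_conjugation u u' \<in> arr (planar_Tw P)" "planar_target P (planar_conjugation u u') = ident P c"
proof -
  show "planar_conjugation u u' \<in> arr (planar_Tw P)"
    using assms by (intro planar_arrowI[where cs = "[]" and ds = "[]"])
      (auto simp: planar_conjugation_def composable_ident outp_ident outp_Col)
  show "planar_target P (planar_conjugation u u') = ident P c"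
    using assms by (simp add: planar_target_def planar_conjugation_def cmp_ident pcmp_def)
qed

lemma planar_conjugation_inverse:
  assumes "u \<in> Ops P" "u' \<in> Ops P" "inp P u = [c]" "inp P u' = [outp P u]" "outp P u' = c"
    "cmp P u' [u] = ident P c" "cmp P u [u'] = ident P (outp P u)"
  shows "planar_compo P (planar_conjugation u' u) (planar_conjugation u u') = idt (planar_Tw P) (ident P (outp P u))"
proof -
  have c: "c \<in> Col P" "outp P u \<in> Col P" using assms outp_Col by auto
  have "planar_compo P (planar_conjugation u' u) (planar_conjugation u u') =
    \<lparr>src = src (planar_conjugation u u'),
    lower = pcmp P (lower (planar_conjugation u' u)) (pos (planar_conjugation u' u))
      (cmp P (lower (planar_conjugation u u')) ([] @ ident P (outp P (src (planar_conjugation u u'))) # [])),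
    pos = pos (planar_conjugation u' u) + sum_list (map (arity P) []),
    uppers = map2 (cmp P) (uppers (planar_conjugation u u')) [[u']]\<rparr>"
    using assms by (intro planar_compo_eq) (auto simp: planar_conjugation_def composable_def)
  also have "\<dots> = idt (planar_Tw P) (ident P (outp P u))"
    using assms c cmp_ident_right[OF assms(2)] by (simp add: planar_conjugation_def outp_ident inp_ident pcmp_def)
  finally show ?thesis .
qed

lemma planar_conjugation_iso:
  assumes "u \<in> Ops P" "u' \<in> Ops P" "inp P u = [c]" "inp P u' = [outp P u]" "outp P u' = c"
    "cmp P u' [u] = ident P c" "cmp P u [u'] = ident P (outp P u)"
  shows "iso (planar_Tw P) (planar_conjugation u u')"
proof -
  note a = planar_conjugation_arr[OF assms(1-6)]
  have b: "planar_conjugation u' u \<in> arr (planar_Tw P)" "planar_target P (planar_conjugation u' u) = ident P (outp P u)"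
    using planar_conjugation_arr[of u' u "outp P u"] assms by auto
  have "planar_compo P (planar_conjugation u u') (planar_conjugation u' u) = idt (planar_Tw P) (ident P c)"
    using planar_conjugation_inverse[of u' u "outp P u"] assms by simp
  moreover have "src (planar_conjugation u u') = ident P (outp P u)" "src (planar_conjugation u' u) = ident P c"
    using assms by (auto simp: planar_conjugation_def)
  ultimately show ?thesis
    unfolding iso_def using a b planar_conjugation_inverse[OF assms]
    by (auto simp: hom_def simp del: planar_Tw_simps(5) intro!: bexI[of _ "planar_conjugation u' u"])
qed

text \<open>Let \<open>l\<close> be the lower vertex of \<open>f\<close> and \<open>u\<close> its only upper vertex, with inverse \<open>u'\<close>.  Moving
  \<open>u\<close> below the source yields the input map with lower vertex \<open>l \<circ>\<^sub>i u\<close>.  Conjugation by \<open>u\<close>,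
  applied first, puts \<open>u\<close> back on top and \<open>u'\<close> at the bottom, where it cancels the new factor \<open>u\<close>
  in \<open>l \<circ>\<^sub>i u\<close>.\<close>

lemma planar_Inert_factor:
  assumes f: "f \<in> Inert (planar_Tw P) (planar_Lower P)" and s: "src f \<in> identities P"
  shows "\<exists>h \<in> planar_input_maps P (planar_target P f). \<exists>k \<in> Inert (planar_Tw P) (planar_Lower P).
    planar_target P k = src h \<and> planar_compo P h k = f"
proof -
  have f': "f \<in> arr (planar_Tw P)" and iso: "\<And>q. q \<in> set (uppers f) \<Longrightarrow> unary_iso q"
    using planar_Inert_uppers[OF f] by auto
  obtain cs ds where 1: "src f \<in> Ops P" "lower f \<in> Ops P" "composable P (src f) (uppers f)"
    "inp P (lower f) = cs @ outp P (src f) # ds" "pos f = length cs"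
    using planar_arrowE[OF f'] by metis
  obtain u where u: "uppers f = [u]" "cmp P (src f) [u] = u" using identity_cmp[OF s 1(3)] by metis
  have src: "src f = ident P (outp P u)"
    using s 1(3) u by (auto simp: identities_def composable_def inp_ident)
  have "unary_iso u" using iso u by simp
  then obtain c u' where uu: "u \<in> Ops P" "u' \<in> Ops P" "c \<in> Col P" "inp P u = [c]" "inp P u' = [outp P u]" "outp P u' = c"
    "cmp P u' [u] = ident P c" "cmp P u [u'] = ident P (outp P u)"
    using unary_isoE by metis
  have ou: "outp P (src f) = outp P u" using src uu by (simp add: outp_ident outp_Col)
  let ?l = "pcmp P (lower f) (length cs) u"
  have l: "?l \<in> Ops P" "inp P ?l = cs @ c # ds"
    using pcmp_Ops[of "lower f" u cs ds] 1 uu ou by auto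
  define h where "h = \<lparr>src = ident P c, lower = ?l, pos = length cs, uppers = [ident P c]\<rparr>"
  define k where "k = planar_conjugation u u'"
  have h: "h \<in> planar_Lower P"
    unfolding planar_Lower_def using l uu(3)
    by (auto simp: h_def identities_def composable_ident ident_Ops outp_ident
        intro!: planar_arrowI[where cs = cs and ds = ds])
  have th: "planar_target P h = planar_target P f"
    using pcmp_ident_right[OF l] u 1(5) uu(3) by (simp add: planar_target_def h_def cmp_ident ident_Ops outp_ident)
  have "inp P (planar_target P f) = cs @ c # ds"
    using planar_target_facts(3)[OF 1(2-5)] u uu by simp
  then have "h \<in> planar_input_maps P (planar_target P f)"
    unfolding planar_input_maps_def using h th by (auto simp: h_def arity_def intro!: exI[of _ "length cs"])
  moreover have "k \<in> Inert (planar_Tw P) (planar_Lower P)"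
    unfolding k_def using uu by (intro Inert.isom planar_conjugation_iso) auto
  moreover have "planar_target P k = src h"
    using planar_conjugation_arr(2)[of u u' c] uu by (simp add: k_def h_def)
  moreover have "planar_compo P h k = f"
  proof -
    have "planar_compo P h k = \<lparr>src = src k,
      lower = pcmp P (lower h) (pos h) (cmp P (lower k) ([] @ ident P (outp P (src k)) # [])),
      pos = pos h + sum_list (map (arity P) []), uppers = map2 (cmp P) (uppers k) [[ident P c]]\<rparr>"
      using uu by (intro planar_compo_eq)
        (auto simp: h_def k_def planar_conjugation_def composable_def ident_Ops outp_ident)
    moreover have "cmp P u' [ident P (outp P u)] = u'" "cmp P u [ident P c] = u"
      using cmp_ident_right[of u'] cmp_ident_right[of u] uu by auto
    moreover have "pcmp P ?l (length cs) u' = lower f"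
    proof -
      have "pcmp P ?l (length cs + 0) u' = pcmp P (lower f) (length cs) (pcmp P u 0 u')"
        using 1 uu ou by (intro pcmp_pcmp) (auto simp: pcomposable_split)
      also have "pcmp P u 0 u' = ident P (outp P u)" using uu by (simp add: pcmp_def)
      finally show ?thesis using pcmp_ident_right[OF 1(2,4)] ou by simp
    qed
    ultimately show ?thesis
      using 1 u src uu by (intro planar_arrow.equality) (auto simp: h_def k_def planar_conjugation_def outp_ident outp_Col)
  qed
  ultimately show ?thesis by blast
qed

end

section \<open>Permutations and ranks\<close>

lemma is_perm_length: "is_perm n s \<Longrightarrow> length s = n"
  unfolding is_perm_def by (metis card_lessThan distinct_card)

lemma is_perm_iff_mset: "is_perm n s \<longleftrightarrow> mset s = mset [0..<n]"
proof
  assume "is_perm n s"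
  then show "mset s = mset [0..<n]"
    using set_eq_iff_mset_eq_distinct[of s "[0..<n]"] by (auto simp: is_perm_def atLeast0LessThan)
next
  assume "mset s = mset [0..<n]"
  then show "is_perm n s"
    using mset_eq_imp_distinct_iff[of s "[0..<n]"] mset_eq_setD[of s "[0..<n]"]
    by (auto simp: is_perm_def atLeast0LessThan simp del: mset_upt)
qed

lemma mset_map_nth_perm: "is_perm (length xs) s \<Longrightarrow> mset (map ((!) xs) s) = mset xs"
  unfolding is_perm_iff_mset by (metis map_nth mset_map)

lemma mset_concat_cong: "mset xss = mset yss \<Longrightarrow> mset (concat xss) = mset (concat yss)"
  by (metis mset_concat mset_map sum_mset_sum_list)

lemma mset_concat_map_cong:
  "(\<And>j. j \<in> set J \<Longrightarrow> mset (f j) = mset (g j)) \<Longrightarrow> mset (concat (map f J)) = mset (concat (map g J))"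
  by (induction J) auto

lemma concat_blocks: "concat (blocks ns) = [0..<sum_list ns]"
proof (induction ns)
  case (Cons n ns)
  have "map ((+) n) [0..<m] = [n..<n + m]" for m by (intro nth_equalityI) auto
  moreover have "concat (map (map ((+) n)) (blocks ns)) = map ((+) n) (concat (blocks ns))"
    by (simp add: map_concat)
  ultimately show ?case using Cons by (simp add: upt_add_eq_append[symmetric])
qed simp

lemma map_length_blocks [simp]: "map length (blocks ns) = ns"
  by (induction ns) (auto simp: comp_def)

lemma length_blocks [simp]: "length (blocks ns) = length ns"
  by (simp add: blocks_def)

lemma nth_concat_blocks: "map (map ((!) (concat xss))) (blocks (map length xss)) = xss"
  using nth_blocks[of "[]" xss "[]"] by simp

lemma nth_concat_nth_blocks:
  assumes "j < length xss"
  shows "map ((!) (concat xss)) (blocks (map length xss) ! j) = xss ! j"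
proof -
  have "map (map ((!) (concat xss))) (blocks (map length xss)) ! j = xss ! j"
    by (simp only: nth_concat_blocks)
  then show ?thesis using assms by simp
qed

lemma mset_blocks_permuted_inside:
  "list_all2 (\<lambda>b s. is_perm (length b) s) bs ss \<Longrightarrow>
    mset (concat (map2 (\<lambda>b s. map ((!) b) s) bs ss)) = mset (concat bs)"
  by (induction rule: list_all2_induct) (simp_all add: mset_map_nth_perm del: mset_map)

lemma sorted_distinct_card_less:
  fixes xs :: "nat list"
  assumes "sorted_wrt (<) xs" "i < length xs"
  shows "card {y \<in> set xs. y < xs ! i} = i"
proof -
  have d: "distinct xs" using assms(1) strict_sorted_iff by blast
  have "{y \<in> set xs. y < xs ! i} = set (take i xs)"
  proof (intro equalityI subsetI)
    fix y assume "y \<in> {y \<in> set xs. y < xs ! i}"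
    then obtain j where j: "j < length xs" "y = xs ! j" "xs ! j < xs ! i" by (auto simp: in_set_conv_nth)
    have "j < i"
    proof (rule ccontr)
      assume "\<not> j < i"
      then have "xs ! i \<le> xs ! j"
        using sorted_wrt_nth_less[OF assms(1), of i j] j(1) by (cases "i = j") auto
      then show False using j(3) by simp
    qed
    then show "y \<in> set (take i xs)" using j assms(2) by (auto simp: in_set_conv_nth)
  next
    fix y assume "y \<in> set (take i xs)"
    then obtain j where "j < i" "y = xs ! j" using assms(2) by (auto simp: in_set_conv_nth)
    then show "y \<in> {y \<in> set xs. y < xs ! i}"
      using sorted_wrt_nth_less[OF assms(1), of j i] assms(2) by auto
  qed
  then show ?thesis using d assms(2) by (simp add: distinct_card)
qed

lemma strict_sorted_sort: "distinct (K :: nat list) \<Longrightarrow> sorted_wrt (<) (sort K)"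
  by (simp add: strict_sorted_iff)

lemma ranks_perm:
  assumes "distinct K"
  shows "is_perm (length K) (ranks K)" "map ((!) (sort K)) (ranks K) = K"
proof -
  note s = strict_sorted_sort[OF assms]
  have r: "\<exists>i < length K. sort K ! i = x \<and> card {y \<in> set K. y < x} = i" if "x \<in> set K" for x
  proof -
    obtain i where "i < length K" "sort K ! i = x"
      using \<open>x \<in> set K\<close> by (metis in_set_conv_nth length_sort set_sort)
    then show ?thesis using sorted_distinct_card_less[OF s, of i] by auto
  qed
  then show *: "map ((!) (sort K)) (ranks K) = K"
    unfolding ranks_def map_map by (intro map_idI) auto
  have "inj_on (\<lambda>x. card {y \<in> set K. y < x}) (set K)"
    using r by (intro inj_onI) metis
  then have d: "distinct (ranks K)" using assms by (simp add: ranks_def distinct_map)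
  moreover have "set (ranks K) \<subseteq> {..<length K}" using r by (fastforce simp: ranks_def)
  moreover have "length (ranks K) = length K" by (simp add: ranks_def)
  ultimately show "is_perm (length K) (ranks K)"
    unfolding is_perm_def by (metis card_lessThan card_subset_eq distinct_card finite_lessThan)
qed

lemma ranks_zero_Suc: "ranks (0 # map Suc K) = 0 # map Suc (ranks K)"
proof -
  have "{y \<in> set (0 # map Suc K). y < Suc x} = insert 0 (Suc ` {y \<in> set K. y < x})" for x by auto
  then have "card {y \<in> set (0 # map Suc K). y < Suc x} = Suc (card {y \<in> set K. y < x})" for x
    by (simp add: card_image)
  then show ?thesis by (simp add: ranks_def comp_def)
qed

lemma sort_zero_Suc: "sort (0 # map Suc K) = 0 # map Suc (sort K)"
  by (rule properties_for_sort) (simp_all add: sorted_map sorted_wrt_map)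

text \<open>With the label \<open>0\<close> on the first input and all other labels shifted to positive ones, sorting
  all inputs keeps the first one in its place, so that one kind of sorting suffices.\<close>

lemma sort_inputs_tail_eq: "sort_inputs_tail P p K = sort_inputs P p (0 # map Suc K)"
  by (simp add: sort_inputs_tail_def sort_inputs_def ranks_zero_Suc)

lemma distinct_map_inverse:
  assumes "distinct K" "length K = length xs"
  obtains F where "map F K = xs"
proof
  show "map (\<lambda>k. the (map_of (zip K xs) k)) K = xs"
    using assms by (intro nth_equalityI) (auto simp: map_of_zip_nth)
qed

lemma concat_map_eqD:
  assumes "concat (map f J) @ u = concat (map g J) @ v" "\<And>j. j \<in> set J \<Longrightarrow> length (f j) = length (g j)"
  shows "j \<in> set J \<Longrightarrow> f j = g j" "u = v"
proof -
  have "(\<forall>j \<in> set J. f j = g j) \<and> u = v"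
    using assms by (induction J) auto
  then show "j \<in> set J \<Longrightarrow> f j = g j" "u = v" by auto
qed

section \<open>Operations with labelled inputs\<close>

text \<open>\<open>K\<close> and \<open>K'\<close> are labels of the inputs of \<open>p\<close> and \<open>p'\<close>.  The relation says that \<open>p'\<close> is \<open>p\<close>
  with its inputs reordered, each input keeping its label.  Sorting inputs is one case of it.
  Keeping track of labels instead of permutations makes the equivariance axioms into the single
  statement that grafting respects the relation, whatever the order of the inputs.\<close>

definition relabelled ::
  "('c, 'o, 'z) sym_operad_data_scheme \<Rightarrow> 'o \<Rightarrow> 'a list \<Rightarrow> 'o \<Rightarrow> 'a list \<Rightarrow> bool" where
  "relabelled P p K p' K' \<longleftrightarrow> p \<in> Ops P \<and> length K = arity P p \<and> length K' = arity P p \<and>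
    (\<exists>s. is_perm (arity P p) s \<and> p' = act P p s \<and> K = map ((!) K') s)"

text \<open>The data before \<open>f\<close> describe an arrow whose vertices have their inputs in an arbitrary order:
  \<open>J\<close> are labels of the inputs of the source \<open>p\<close>; the upper vertex \<open>q j\<close> with leaves \<open>L j\<close> sits on the
  input labelled \<open>j\<close>; the lower vertex \<open>l\<close> has leaves \<open>ks\<close> besides its first input.  The arrow \<open>f\<close> is
  obtained by sorting.  As before, the first input of \<open>l\<close> has the label \<open>0\<close> and the labels of the
  leaves of \<open>l\<close> are shifted.\<close>

definition presents :: "('c, 'o, 'z) sym_operad_data_scheme \<Rightarrow> 'o \<Rightarrow> nat list \<Rightarrow> (nat \<Rightarrow> 'o) \<Rightarrow> 'o \<Rightarrow>
    (nat \<Rightarrow> nat list) \<Rightarrow> nat list \<Rightarrow> 'o sym_arrow \<Rightarrow> bool" where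
  "presents P p J q l L ks f \<longleftrightarrow> relabelled P p J (ssrc f) [0..<arity P (ssrc f)] \<and>
    (\<forall>j \<in> set J. relabelled P (q j) (L j) (suppers f ! j) (sup_leaves f ! j)) \<and>
    relabelled P l (0 # map Suc ks) (slower f) (0 # map Suc (slow_leaves f))"

context symmetric_operad
begin

lemma relabelledE:
  assumes "relabelled P p K p' K'"
  obtains s where "p \<in> Ops P" "length K = arity P p" "length K' = arity P p" "is_perm (arity P p) s"
    "p' = act P p s" "K = map ((!) K') s"
  using assms by (auto simp: relabelled_def)

lemma relabelledI:
  assumes "p \<in> Ops P" "length K' = arity P p" "is_perm (arity P p) s"
  shows "relabelled P p (map ((!) K') s) (act P p s) K'"
  using assms is_perm_length[OF assms(3)] by (auto simp: relabelled_def)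

lemma relabelled_facts:
  assumes "relabelled P p K p' K'"
  shows "p \<in> Ops P" "p' \<in> Ops P" "outp P p' = outp P p" "arity P p' = arity P p"
    "length K = arity P p" "length K' = arity P p" "mset K = mset K'"
proof -
  obtain s where s: "p \<in> Ops P" "length K = arity P p" "length K' = arity P p" "is_perm (arity P p) s"
    "p' = act P p s" "K = map ((!) K') s"
    using relabelledE[OF assms] by metis
  then show "p \<in> Ops P" "p' \<in> Ops P" "outp P p' = outp P p" "arity P p' = arity P p"
    "length K = arity P p" "length K' = arity P p"
    by (auto simp: act_Ops outp_act arity_act)
  show "mset K = mset K'" using s mset_map_nth_perm[of K' s] by simp
qed

lemma relabelled_set:
  assumes "relabelled P p K p' K'"
  shows "set K = set K'" "distinct K \<longleftrightarrow> distinct K'"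
  using mset_eq_setD[OF relabelled_facts(7)[OF assms]] mset_eq_imp_distinct_iff[OF relabelled_facts(7)[OF assms]]
  by auto

lemma relabelled_refl: "p \<in> Ops P \<Longrightarrow> length K = arity P p \<Longrightarrow> relabelled P p K p K"
  using relabelledI[of p K "[0..<arity P p]"]
  by (metis act_id is_perm_iff_mset map_nth)

lemma relabelled_trans:
  assumes "relabelled P p K p' K'" "relabelled P p' K' p'' K''"
  shows "relabelled P p K p'' K''"
proof -
  obtain s where s: "p \<in> Ops P" "length K = arity P p" "length K' = arity P p" "is_perm (arity P p) s"
    "p' = act P p s" "K = map ((!) K') s"
    using relabelledE[OF assms(1)] by metis
  obtain t where t: "length K'' = arity P p'" "is_perm (arity P p') t" "p'' = act P p' t" "K' = map ((!) K'') t"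
    using relabelledE[OF assms(2)] by metis
  have n: "arity P p' = arity P p" using relabelled_facts[OF assms(1)] by simp
  have st: "is_perm (arity P p) (map ((!) t) s)"
    using mset_map_nth_perm[of t s] s(4) t(2) is_perm_length[OF t(2)] n
    by (simp add: is_perm_iff_mset)
  have "K = map (\<lambda>j. map ((!) K'') t ! j) s" using s(6) t(4) by simp
  also have "\<dots> = map ((!) K'') (map ((!) t) s)"
    using s(4) is_perm_length[OF t(2)] n by (auto simp: is_perm_def)
  finally have "K = map ((!) K'') (map ((!) t) s)" .
  moreover have "p'' = act P p (map ((!) t) s)" using act_act[OF s(1,4)] t n s(5) by simp
  ultimately show ?thesis using relabelledI[OF s(1) _ st, of K''] t(1) n by simp
qed

lemma relabelled_map: "relabelled P p K p' K' \<Longrightarrow> relabelled P p (map \<phi> K) p' (map \<phi> K')"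
proof -
  assume a: "relabelled P p K p' K'"
  obtain s where s: "p \<in> Ops P" "length K = arity P p" "length K' = arity P p" "is_perm (arity P p) s"
    "p' = act P p s" "K = map ((!) K') s"
    using relabelledE[OF a] by metis
  have "map \<phi> K = map ((!) (map \<phi> K')) s"
    using s(3,4) by (auto simp: s(6) is_perm_def)
  then show ?thesis
    unfolding s(5) using relabelledI[OF s(1) _ s(4), of "map \<phi> K'"] s(3) by simp
qed

lemma relabelled_inp:
  assumes "relabelled P p K p' K'"
  shows "map c K = inp P p \<longleftrightarrow> map c K' = inp P p'"
proof -
  obtain s where s: "p \<in> Ops P" "length K = arity P p" "length K' = arity P p" "is_perm (arity P p) s"
    "p' = act P p s" "K = map ((!) K') s"
    using relabelledE[OF assms] by metis
  have l: "length (inp P p) = length s" "length (inp P p') = length s" "arity P p = length s"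
    using relabelled_facts(4)[OF assms] is_perm_length[OF s(4)] by (auto simp: arity_def)
  have i: "inp P p' ! (s ! j) = inp P p ! j" if "j < length s" for j
    using inp_act[OF s(1,4)] that l s(5) by simp
  have e: "\<exists>j < length s. i = s ! j" if "i < length s" for i
    using that s(4) l unfolding is_perm_def by (metis in_set_conv_nth lessThan_iff)
  have sl: "s ! j < length s" if "j < length s" for j
    using that s(4) l unfolding is_perm_def by (metis lessThan_iff nth_mem)
  have K: "K ! j = K' ! (s ! j)" if "j < length s" for j using s(6) that by simp
  show ?thesis
  proof
    assume a: "map c K = inp P p"
    have "c (K' ! i) = inp P p' ! i" if il: "i < length s" for i
    proof -
      obtain j where "j < length s" "i = s ! j" using e[OF il] by blast
      then show ?thesis using i[of j] K[of j] a s(2) l by (metis nth_map)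
    qed
    then show "map c K' = inp P p'" using s(3) l by (intro nth_equalityI) auto
  next
    assume a: "map c K' = inp P p'"
    have "c (K ! j) = inp P p ! j" if "j < length s" for j
      using i[OF that] K[OF that] a sl[OF that] s(3) l by (metis nth_map)
    then show "map c K = inp P p" using s(2) l by (intro nth_equalityI) auto
  qed
qed

lemma relabelled_sort_inputs:
  assumes "p \<in> Ops P" "distinct K" "length K = arity P p"
  shows "relabelled P p K (sort_inputs P p K) (sort K)"
  using relabelledI[of p "sort K" "ranks K"] assms ranks_perm[OF assms(2)]
  by (simp add: sort_inputs_def)

lemma relabelled_act:
  assumes "p \<in> Ops P" "is_perm (arity P p) K"
  shows "relabelled P p K (act P p K) [0..<arity P p]"
proof -
  have "map ((!) [0..<arity P p]) K = K"
    using assms(2) by (intro map_idI) (auto simp: is_perm_def)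
  then show ?thesis using relabelledI[of p "[0..<arity P p]" K] assms by simp
qed

text \<open>Distinct labels can be sorted in only one way.\<close>

lemma relabelled_sorted_unique:
  fixes K :: "nat list"
  assumes "relabelled P p K p1 K1" "relabelled P p K p2 K2" "sorted_wrt (<) K1" "sorted_wrt (<) K2"
  shows "p1 = p2" "K1 = K2"
proof -
  obtain s where s: "p \<in> Ops P" "length K1 = arity P p" "is_perm (arity P p) s"
    "p1 = act P p s" "K = map ((!) K1) s"
    using relabelledE[OF assms(1)] by metis
  obtain t where t: "is_perm (arity P p) t" "p2 = act P p t" "K = map ((!) K2) t"
    using relabelledE[OF assms(2)] by metis
  show K: "K1 = K2"
    using relabelled_set[OF assms(1)] relabelled_set[OF assms(2)] assms(3,4) strict_sorted_equal by metis
  have "distinct K1" using assms(3) strict_sorted_iff by blast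
  have "s = t"
  proof (rule nth_equalityI)
    show "length s = length t" using is_perm_length s t by metis
    fix i assume i: "i < length s"
    then have "s ! i < length K1" "t ! i < length K1"
      using s(2,3) t(1) is_perm_length[OF s(3)] is_perm_length[OF t(1)] unfolding is_perm_def
      by (metis lessThan_iff nth_mem)+
    moreover have "K1 ! (s ! i) = K1 ! (t ! i)"
      using s(5) t(3) K i is_perm_length[OF s(3)] is_perm_length[OF t(1)] by (metis nth_map)
    ultimately show "s ! i = t ! i" using \<open>distinct K1\<close> by (simp add: nth_eq_iff_index_eq)
  qed
  then show "p1 = p2" using s t by simp
qed

lemma relabelled_cmp_right:
  assumes comp: "composable P p (map F K)"
    and FG: "\<And>k. k \<in> set K \<Longrightarrow> relabelled P (F k) (G k) (F' k) (G' k)"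
  shows "relabelled P (cmp P p (map F K)) (concat (map G K)) (cmp P p (map F' K)) (concat (map G' K))"
proof -
  have "\<forall>k \<in> set K. \<exists>s. is_perm (arity P (F k)) s \<and> F' k = act P (F k) s \<and> G k = map ((!) (G' k)) s"
    using FG unfolding relabelled_def by blast
  from bchoice[OF this] obtain S where S: "\<And>k. k \<in> set K \<Longrightarrow> is_perm (arity P (F k)) (S k)"
    "\<And>k. k \<in> set K \<Longrightarrow> F' k = act P (F k) (S k)" "\<And>k. k \<in> set K \<Longrightarrow> G k = map ((!) (G' k)) (S k)"
    by blast
  have len: "length (G' k) = arity P (F k)" "length (G k) = arity P (F k)" if "k \<in> set K" for k
    using relabelled_facts[OF FG[OF that]] by auto
  let ?bl = "blocks (map (arity P) (map F K))"
  let ?t = "concat (map2 (\<lambda>b s. map ((!) b) s) ?bl (map S K))"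
  let ?n = "sum_list (map (arity P) (map F K))"
  have ar: "arity P (cmp P p (map F K)) = ?n"
    using inp_cmp[OF comp] length_concat_inp[of "map F K"] by (simp add: arity_def)
  have "map2 (act P) (map F K) (map S K) = map F' K"
    using S(2) by (induction K) auto
  moreover have "list_all2 (\<lambda>q s. is_perm (arity P q) s) (map F K) (map S K)"
    using S(1) by (induction K) auto
  ultimately have e: "cmp P p (map F' K) = act P (cmp P p (map F K)) ?t"
    using cmp_act_right[OF comp, of "map S K"] by simp
  have "list_all2 (\<lambda>b s. is_perm (length b) s) ?bl (map S K)"
  proof -
    have "length (?bl ! i) = arity P (F (K ! i))" if "i < length K" for i
      using map_length_blocks[of "map (arity P) (map F K)"] that
      by (metis length_blocks length_map nth_map)
    then show ?thesis using S(1) by (auto simp: list_all2_conv_all_nth)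
  qed
  from mset_blocks_permuted_inside[OF this] have t: "is_perm ?n ?t"
    unfolding is_perm_iff_mset concat_blocks .
  have G': "map (arity P) (map F K) = map length (map G' K)" using len(1) by simp
  have "map (map ((!) (concat (map G' K)))) (map2 (\<lambda>b s. map ((!) b) s) ?bl (map S K)) = map G K"
  proof (rule nth_equalityI)
    fix i assume "i < length (map (map ((!) (concat (map G' K)))) (map2 (\<lambda>b s. map ((!) b) s) ?bl (map S K)))"
    then have i: "i < length K" by simp
    then have k: "K ! i \<in> set K" by simp
    have b: "map ((!) (concat (map G' K))) (?bl ! i) = G' (K ! i)"
      using nth_concat_nth_blocks[of i "map G' K"] i unfolding G' by simp
    then have "length (?bl ! i) = arity P (F (K ! i))" using len(1)[OF k] by (metis length_map)
    then have "map ((!) (concat (map G' K))) (map ((!) (?bl ! i)) (S (K ! i))) =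
        map ((!) (map ((!) (concat (map G' K))) (?bl ! i))) (S (K ! i))"
      using S(1)[OF k] by (auto simp: is_perm_def)
    then have "map ((!) (concat (map G' K))) (map ((!) (?bl ! i)) (S (K ! i))) = map ((!) (G' (K ! i))) (S (K ! i))"
      unfolding b .
    then show "map (map ((!) (concat (map G' K)))) (map2 (\<lambda>b s. map ((!) b) s) ?bl (map S K)) ! i = map G K ! i"
      using i S(3)[OF k] by simp
  qed simp
  then have "concat (map G K) = map ((!) (concat (map G' K))) ?t"
    by (simp add: map_concat)
  moreover have "length (concat (map G' K)) = ?n"
    by (simp only: length_concat G')
  ultimately show ?thesis
    using relabelledI[of "cmp P p (map F K)" "concat (map G' K)" ?t] t cmp_Ops[OF comp] ar e by simp
qed

lemma relabelled_cmp_left: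
  assumes rel: "relabelled P p K p' K'" and comp: "composable P p (map F K)"
    and len: "\<And>k. k \<in> set K \<Longrightarrow> length (G k) = arity P (F k)"
  shows "relabelled P (cmp P p (map F K)) (concat (map G K)) (cmp P p' (map F K')) (concat (map G K'))"
proof -
  obtain s where s: "p \<in> Ops P" "length K = arity P p" "length K' = arity P p" "is_perm (arity P p) s"
    "p' = act P p s" "K = map ((!) K') s"
    using relabelledE[OF rel] by metis
  have "map (\<lambda>k. outp P (F k)) K = inp P p" using comp by (simp add: composable_def comp_def)
  then have "map (\<lambda>k. outp P (F k)) K' = inp P p'" using relabelled_inp[OF rel] by simp
  then have comp': "composable P (act P p s) (map F K')"
    using comp relabelled_set(1)[OF rel] relabelled_facts(2)[OF rel] s(5) by (simp add: composable_def comp_def)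
  have sn: "\<And>j. j \<in> set s \<Longrightarrow> j < length K'" using s(3,4) by (auto simp: is_perm_def)
  let ?bl = "blocks (map (arity P) (map F K'))"
  let ?t = "concat (map ((!) ?bl) s)"
  let ?n = "sum_list (map (arity P) (map F K))"
  have ar: "arity P (cmp P p (map F K)) = ?n"
    using inp_cmp[OF comp] length_concat_inp[of "map F K"] by (simp add: arity_def)
  have "map ((!) (map F K')) s = map F K" using sn by (simp add: s(6) comp_def)
  then have e: "cmp P p' (map F K') = act P (cmp P p (map F K)) ?t"
    using cmp_act_left[OF s(1,4) comp'] s(5) by simp
  have "mset ?t = mset (concat ?bl)"
    using s(3,4) by (intro mset_concat_cong mset_map_nth_perm) simp
  moreover have "sum_list (map (arity P) (map F K')) = ?n"
  proof -
    have "mset (map (arity P) (map F K')) = mset (map (arity P) (map F K))"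
      using relabelled_facts(7)[OF rel] by (simp only: mset_map)
    then show ?thesis by (metis sum_mset_sum_list)
  qed
  ultimately have t: "is_perm ?n ?t"
    by (simp add: is_perm_iff_mset concat_blocks)
  have G: "map (arity P) (map F K') = map length (map G K')"
    using len relabelled_set(1)[OF rel] by simp
  have "map ((!) (concat (map G K'))) ?t = concat (map (\<lambda>j. map ((!) (concat (map G K'))) (?bl ! j)) s)"
    by (simp add: map_concat comp_def)
  also have "\<dots> = concat (map (\<lambda>j. G (K' ! j)) s)"
  proof -
    have "map ((!) (concat (map G K'))) (?bl ! j) = G (K' ! j)" if "j \<in> set s" for j
      using nth_concat_nth_blocks[of j "map G K'"] sn[OF that] unfolding G by simp
    then have "map (\<lambda>j. map ((!) (concat (map G K'))) (?bl ! j)) s = map (\<lambda>j. G (K' ! j)) s"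
      by (intro map_cong refl)
    then show ?thesis by (rule arg_cong)
  qed
  also have "\<dots> = concat (map G K)" by (simp add: s(6) comp_def)
  finally have "concat (map G K) = map ((!) (concat (map G K'))) ?t" ..
  moreover have "length (concat (map G K')) = ?n"
  proof -
    have "mset (map G K') = mset (map G K)" using relabelled_facts(7)[OF rel] by simp
    then have "length (concat (map G K')) = length (concat (map G K))"
      by (metis mset_concat_cong size_mset)
    then show ?thesis using len by (simp add: length_concat comp_def cong: map_cong)
  qed
  ultimately show ?thesis
    using relabelledI[of "cmp P p (map F K)" "concat (map G K')" ?t] t cmp_Ops[OF comp] ar e by simp
qed

text \<open>Here \<open>F k\<close> is grafted onto the input labelled \<open>k\<close>, and \<open>G k\<close> are the labels of the inputs of
  \<open>F k\<close>.\<close>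

lemma relabelled_cmp:
  assumes rel: "relabelled P p K p' K'" and comp: "composable P p (map F K)"
    and FG: "\<And>k. k \<in> set K \<Longrightarrow> relabelled P (F k) (G k) (F' k) (G' k)"
  shows "relabelled P (cmp P p (map F K)) (concat (map G K)) (cmp P p' (map F' K')) (concat (map G' K'))"
proof -
  have "composable P p (map F' K)"
  proof -
    have out: "map (outp P) (map F' K) = map (outp P) (map F K)"
      using relabelled_facts(3)[OF FG] by simp
    show ?thesis
      unfolding composable_def out
      using comp[unfolded composable_def] relabelled_facts(2)[OF FG] by auto
  qed
  then show ?thesis
    using relabelled_trans[OF relabelled_cmp_right[OF comp FG] relabelled_cmp_left[OF rel]]
      relabelled_facts(4,6)[OF FG] by simp
qed

lemma relabelled_pcmp:
  assumes l: "relabelled P l (a # ks) l' (a # ks')" and d: "distinct (a # ks)"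
    and x: "relabelled P x K x' K'" and lx: "pcomposable P l 0 x"
  shows "relabelled P (pcmp P l 0 x) (K @ map \<phi> ks) (pcmp P l' 0 x') (K' @ map \<phi> ks')"
    "pcomposable P l' 0 x'"
proof -
  obtain ds where ds: "inp P l = outp P x # ds" and lx': "l \<in> Ops P" "x \<in> Ops P"
    using lx by (auto simp: pcomposable_split)
  have "length (a # ks) = length (inp P l)" using relabelled_facts(5)[OF l] by (simp add: arity_def)
  then obtain c where "map c (a # ks) = inp P l" using distinct_map_inverse[OF d] by metis
  then have c: "map c (a # ks) = inp P l" "map c (a # ks') = inp P l'"
    using relabelled_inp[OF l, of c] by auto
  have col: "set (inp P l) \<subseteq> Col P" "set (inp P l') \<subseteq> Col P"
    using relabelled_facts(1,2)[OF l] inp_Col by auto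
  have d': "distinct (a # ks')" using d relabelled_set(2)[OF l] by blast
  let ?F = "\<lambda>k. if k = a then x else ident P (c k)" and ?F' = "\<lambda>k. if k = a then x' else ident P (c k)"
  let ?G = "\<lambda>k. if k = a then K else [\<phi> k]" and ?G' = "\<lambda>k. if k = a then K' else [\<phi> k]"
  have F: "map ?F (a # ks) = x # map (ident P) ds" "map ?F' (a # ks') = x' # map (ident P) (tl (inp P l'))"
  proof -
    have "map ?F ks = map (ident P) (map c ks)" "map ?F' ks' = map (ident P) (map c ks')"
      using d d' by auto
    moreover have "map c ks = ds" "map c ks' = tl (inp P l')" using c(1) ds c(2)[symmetric] by auto
    ultimately show "map ?F (a # ks) = x # map (ident P) ds"
      "map ?F' (a # ks') = x' # map (ident P) (tl (inp P l'))" by auto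
  qed
  have G: "concat (map ?G (a # ks)) = K @ map \<phi> ks" "concat (map ?G' (a # ks')) = K' @ map \<phi> ks'"
  proof -
    have "map ?G ks = map (\<lambda>k. [\<phi> k]) ks" "map ?G' ks' = map (\<lambda>k. [\<phi> k]) ks'" using d d' by auto
    moreover have "concat (map (\<lambda>k. [\<phi> k]) xs) = map \<phi> xs" for xs by (induction xs) auto
    ultimately have "concat (map ?G ks) = map \<phi> ks" "concat (map ?G' ks') = map \<phi> ks'"
      by metis+
    then show "concat (map ?G (a # ks)) = K @ map \<phi> ks" "concat (map ?G' (a # ks')) = K' @ map \<phi> ks'"
      by (simp_all only: list.map concat.simps if_True refl)
  qed
  have rel: "relabelled P (?F k) (?G k) (?F' k) (?G' k)" if "k \<in> set (a # ks)" for k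
  proof (cases "k = a")
    case False
    have "c k \<in> set (inp P l)" unfolding c(1)[symmetric] using that by auto
    then have "c k \<in> Col P" using col(1) by blast
    then show ?thesis using False by (simp add: relabelled_refl ident_Ops arity_def inp_ident)
  qed (use x in simp)
  have "composable P l (map ?F (a # ks))"
    unfolding F using pcomposable_insert[of l x "[]" ds] lx' ds by simp
  from relabelled_cmp[OF l this rel] have
    "relabelled P (cmp P l (x # map (ident P) ds)) (K @ map \<phi> ks)
      (cmp P l' (x' # map (ident P) (tl (inp P l')))) (K' @ map \<phi> ks')"
    unfolding F G .
  moreover have "inp P l' = outp P x' # tl (inp P l')"
    using c ds relabelled_facts(3)[OF x] by (metis list.sel(1,3) list.simps(9) list.inject)
  ultimately show "relabelled P (pcmp P l 0 x) (K @ map \<phi> ks) (pcmp P l' 0 x') (K' @ map \<phi> ks')"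
    using pcmp_split[of l "[]" "outp P x" ds x] pcmp_split[of l' "[]" "outp P x'" "tl (inp P l')" x'] ds by simp
  show "pcomposable P l' 0 x'"
    using \<open>inp P l' = outp P x' # tl (inp P l')\<close> relabelled_facts(2)[OF l] relabelled_facts(2)[OF x]
    unfolding pcomposable_split by (intro conjI exI[of _ "[]"] exI[of _ "tl (inp P l')"]) auto
qed

end

section \<open>Labelled presentations of symmetric arrows\<close>

context symmetric_operad
begin

lemma sym_Tw_simps [simp]:
  "obj (sym_Tw P) = Ops P" "dom (sym_Tw P) = ssrc" "cod (sym_Tw P) = sym_target P"
  "arr (sym_Tw P) = {f. is_sym_arrow P f}" "compo (sym_Tw P) = sym_compo P"
  "idt (sym_Tw P) p = \<lparr>ssrc = p, slower = ident P (outp P p), suppers = map (ident P) (inp P p),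
     slow_leaves = [], sup_leaves = map (\<lambda>j. [j]) [0..<arity P p]\<rparr>"
  by (auto simp: sym_Tw_def)

lemma sym_arrowD:
  assumes "is_sym_arrow P f"
  shows "ssrc f \<in> Ops P" "slower f \<in> Ops P" "composable P (ssrc f) (suppers f)"
    "pcomposable P (slower f) 0 (ssrc f)" "length (suppers f) = arity P (ssrc f)"
    "length (sup_leaves f) = arity P (ssrc f)"
    "j < arity P (ssrc f) \<Longrightarrow> suppers f ! j \<in> Ops P"
    "j < arity P (ssrc f) \<Longrightarrow> length (sup_leaves f ! j) = arity P (suppers f ! j)"
    "j < arity P (ssrc f) \<Longrightarrow> sorted_wrt (<) (sup_leaves f ! j)"
    "sorted_wrt (<) (slow_leaves f)" "Suc (length (slow_leaves f)) = arity P (slower f)"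
    "is_perm (length (leaf_list f)) (leaf_list f)"
proof -
  have a: "composable P (ssrc f) (suppers f)" "pcomposable P (slower f) 0 (ssrc f)"
    "map length (sup_leaves f) = map (arity P) (suppers f)"
    "length (slow_leaves f) = arity P (slower f) - 1"
    "\<forall>L \<in> set (sup_leaves f). sorted_wrt (<) L"
    using assms by (auto simp: is_sym_arrow_def)
  show "ssrc f \<in> Ops P" "slower f \<in> Ops P" "composable P (ssrc f) (suppers f)"
    "pcomposable P (slower f) 0 (ssrc f)"
    using a by (auto simp: composable_def pcomposable_def)
  show l: "length (suppers f) = arity P (ssrc f)" using composable_length[OF a(1)] .
  show l': "length (sup_leaves f) = arity P (ssrc f)" using l a(3) by (metis length_map)
  show "j < arity P (ssrc f) \<Longrightarrow> suppers f ! j \<in> Ops P"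
    using a(1) l by (auto simp: composable_def)
  show "j < arity P (ssrc f) \<Longrightarrow> length (sup_leaves f ! j) = arity P (suppers f ! j)"
    using a(3) l l' by (metis nth_map)
  show "j < arity P (ssrc f) \<Longrightarrow> sorted_wrt (<) (sup_leaves f ! j)" using a(5) l' by simp
  show "Suc (length (slow_leaves f)) = arity P (slower f)" using a(2,4) by (auto simp: pcomposable_def)
  show "sorted_wrt (<) (slow_leaves f)" "is_perm (length (leaf_list f)) (leaf_list f)"
    using assms by (auto simp: is_sym_arrow_def)
qed

lemma presents_self:
  assumes "is_sym_arrow P f"
  shows "presents P (ssrc f) [0..<arity P (ssrc f)] ((!) (suppers f)) (slower f) ((!) (sup_leaves f)) (slow_leaves f) f"
  using sym_arrowD[OF assms] by (auto simp: presents_def intro!: relabelled_refl)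

context
  fixes p J q l L ks f
  assumes pr: "presents P p J q l L ks f" and f: "is_sym_arrow P f"
begin

lemma presents_src: "relabelled P p J (ssrc f) [0..<arity P (ssrc f)]"
  and presents_upper: "j \<in> set J \<Longrightarrow> relabelled P (q j) (L j) (suppers f ! j) (sup_leaves f ! j)"
  and presents_lower: "relabelled P l (0 # map Suc ks) (slower f) (0 # map Suc (slow_leaves f))"
  using pr by (auto simp: presents_def)

lemma presents_set_J: "set J = {..<arity P (ssrc f)}" "mset J = mset [0..<arity P (ssrc f)]"
proof -
  show "set J = {..<arity P (ssrc f)}"
    using relabelled_set(1)[OF presents_src] by (simp only: set_upt atLeast0LessThan)
qed (rule relabelled_facts(7)[OF presents_src])

lemma presents_labels: "mset (concat (map L J) @ ks) = mset (leaf_list f)"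
proof -
  have "mset (concat (map L J)) = mset (concat (map ((!) (sup_leaves f)) J))"
    by (intro mset_concat_map_cong relabelled_facts(7)[OF presents_upper])
  also have "\<dots> = mset (concat (map ((!) (sup_leaves f)) [0..<length (sup_leaves f)]))"
    using presents_set_J(2) sym_arrowD(6)[OF f] by (intro mset_concat_cong) (simp only: mset_map)
  also have "\<dots> = mset (concat (sup_leaves f))" by (simp only: map_nth)
  finally have 1: "mset (concat (map L J)) = mset (concat (sup_leaves f))" .
  have "mset (map (\<lambda>k. k - 1) (0 # map Suc ks)) = mset (map (\<lambda>k. k - 1) (0 # map Suc (slow_leaves f)))"
    by (rule relabelled_facts(7)[OF relabelled_map[OF presents_lower]])
  then have "mset ks = mset (slow_leaves f)" by (simp add: comp_def del: mset_map)
  with 1 show ?thesis by (simp add: leaf_list_def)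
qed

lemma presents_distinct: "distinct (concat (map L J) @ ks)"
  using mset_eq_imp_distinct_iff[OF presents_labels] sym_arrowD(12)[OF f] by (simp add: is_perm_def)

lemma presents_lower_distinct: "distinct (0 # map Suc ks)"
  using presents_distinct by (auto simp: distinct_map)

lemma presents_src_composable: "composable P p (map q J)"
proof -
  let ?c = "\<lambda>j. outp P (suppers f ! j)"
  have "map ?c [0..<arity P (ssrc f)] = map (outp P) (map ((!) (suppers f)) [0..<length (suppers f)])"
    using sym_arrowD(5)[OF f] by simp
  also have "\<dots> = inp P (ssrc f)"
    unfolding map_nth using sym_arrowD(3)[OF f] by (simp add: composable_def)
  finally have "map ?c J = inp P p" using relabelled_inp[OF presents_src] by simp
  moreover have "map (outp P) (map q J) = map ?c J"
    using relabelled_facts(3)[OF presents_upper] by simp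
  ultimately have "map (outp P) (map q J) = inp P p" by simp
  then show ?thesis
    using relabelled_facts(1)[OF presents_src] relabelled_facts(1)[OF presents_upper]
    by (auto simp: composable_def)
qed

lemma presents_lower_pcomposable: "pcomposable P l 0 p"
proof -
  have d: "distinct (0 # map Suc (slow_leaves f))"
    using presents_lower_distinct relabelled_set(2)[OF presents_lower] by blast
  have "length (0 # map Suc (slow_leaves f)) = length (inp P (slower f))"
    using sym_arrowD(11)[OF f] by (simp add: arity_def)
  then obtain c where c: "map c (0 # map Suc (slow_leaves f)) = inp P (slower f)"
    using distinct_map_inverse[OF d] by metis
  then have c': "map c (0 # map Suc ks) = inp P l" using relabelled_inp[OF presents_lower] by blast
  have "c 0 = outp P (ssrc f)"
    using c sym_arrowD(4)[OF f] by (metis list.simps(9) nth_Cons_0 pcomposable_def)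
  moreover have "outp P (ssrc f) = outp P p" using relabelled_facts(3)[OF presents_src] .
  ultimately show ?thesis
    using c'[symmetric] relabelled_facts(1)[OF presents_src] relabelled_facts(1)[OF presents_lower]
    unfolding pcomposable_def arity_def by simp
qed

lemma presents_target:
  "relabelled P (pcmp P l 0 (cmp P p (map q J))) (concat (map L J) @ ks)
    (sym_target P f) [0..<arity P (sym_target P f)]"
  "sym_target P f \<in> Ops P" "arity P (sym_target P f) = length (leaf_list f)"
proof -
  let ?n = "arity P (ssrc f)"
  have "relabelled P (cmp P p (map q J)) (concat (map L J))
      (cmp P (ssrc f) (map ((!) (suppers f)) [0..<?n])) (concat (map ((!) (sup_leaves f)) [0..<?n]))"
    by (intro relabelled_cmp[OF presents_src presents_src_composable] presents_upper)
  then have up: "relabelled P (cmp P p (map q J)) (concat (map L J)) (cmp P (ssrc f) (suppers f)) (concat (sup_leaves f))"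
    using sym_arrowD(5,6)[OF f] map_nth[of "suppers f"] map_nth[of "sup_leaves f"] by simp
  have "pcomposable P l 0 (cmp P p (map q J))"
    using presents_lower_pcomposable presents_src_composable cmp_Ops outp_cmp by (simp add: pcomposable_def)
  \<comment> \<open>After grafting, the first input is gone and the shift of the labels is undone.\<close>
  from relabelled_pcmp(1)[OF presents_lower presents_lower_distinct up this, of "\<lambda>k. k - 1"]
  have 1: "relabelled P (pcmp P l 0 (cmp P p (map q J))) (concat (map L J) @ ks)
      (pcmp P (slower f) 0 (cmp P (ssrc f) (suppers f))) (leaf_list f)"
    by (simp add: leaf_list_def comp_def)
  let ?t = "pcmp P (slower f) 0 (cmp P (ssrc f) (suppers f))"
  have n: "arity P ?t = length (leaf_list f)" using relabelled_facts[OF 1] by simp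
  have 2: "relabelled P ?t (leaf_list f) (act P ?t (leaf_list f)) [0..<arity P ?t]"
    using relabelled_facts(2)[OF 1] sym_arrowD(12)[OF f] n by (intro relabelled_act) auto
  have t: "sym_target P f = act P ?t (leaf_list f)" by (simp add: sym_target_def)
  show 3: "arity P (sym_target P f) = length (leaf_list f)" "sym_target P f \<in> Ops P"
    using relabelled_facts(2,4)[OF 2] n t by auto
  show "relabelled P (pcmp P l 0 (cmp P p (map q J))) (concat (map L J) @ ks)
    (sym_target P f) [0..<arity P (sym_target P f)]"
    using relabelled_trans[OF 1 2] 3 n t by simp
qed

end

lemma presents_unique:
  assumes "presents P p J q l L ks f" "is_sym_arrow P f" "presents P p J q l L ks f'" "is_sym_arrow P f'"
  shows "f = f'"
proof -
  note rel = presents_src[OF assms(1,2)] presents_src[OF assms(3,4)]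
  have src: "ssrc f = ssrc f'" by (rule relabelled_sorted_unique(1)[OF rel]) auto
  let ?n = "arity P (ssrc f)"
  have up: "suppers f ! j = suppers f' ! j \<and> sup_leaves f ! j = sup_leaves f' ! j" if j: "j < ?n" for j
  proof -
    have "j \<in> set J" using presents_set_J(1)[OF assms(1,2)] j by simp
    note r = presents_upper[OF assms(1,2) this] presents_upper[OF assms(3,4) this]
    show ?thesis
      using relabelled_sorted_unique[OF r] sym_arrowD(9)[OF assms(2)] sym_arrowD(9)[OF assms(4)] j src by simp
  qed
  note r = presents_lower[OF assms(1,2)] presents_lower[OF assms(3,4)]
  have s: "sorted_wrt (<) (0 # map Suc (slow_leaves f))" "sorted_wrt (<) (0 # map Suc (slow_leaves f'))"
    using sym_arrowD(10)[OF assms(2)] sym_arrowD(10)[OF assms(4)] by (auto simp: sorted_wrt_map)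
  have low: "slower f = slower f'" "slow_leaves f = slow_leaves f'"
    using relabelled_sorted_unique[OF r s] by (auto simp: inj_map_eq_map)
  have "suppers f = suppers f'" "sup_leaves f = sup_leaves f'"
    using up src sym_arrowD(5,6)[OF assms(2)] sym_arrowD(5,6)[OF assms(4)] by (auto intro!: nth_equalityI)
  then show ?thesis using src low by (intro sym_arrow.equality) auto
qed

text \<open>In \<open>sym_compo\<close> the inputs of each vertex are sorted after grafting, and the vertices of \<open>f\<close> and
  \<open>g\<close> have been sorted before.  The first sorting does not influence the result of the second, so
  the composite is presented by grafting unsorted data, without any permutation.\<close>

context
  fixes p J q l L ks f r l' M ms g
  assumes presf: "presents P p J q l L ks f" and f: "is_sym_arrow P f"
    and presg: "presents P (pcmp P l 0 (cmp P p (map q J))) (concat (map L J) @ ks) r l' M ms g"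
    and g: "is_sym_arrow P g"
begin

lemma presents_compo_children:
  "j \<in> set J \<Longrightarrow> composable P (q j) (map r (L j))"
  "composable P l (ident P (outp P p) # map r ks)"
  "list_all2 (composable P) (map q J) (map (\<lambda>j. map r (L j)) J)"
proof -
  have lp: "pcomposable P l 0 p" by (rule presents_lower_pcomposable[OF presf f])
  have pq: "composable P p (map q J)" by (rule presents_src_composable[OF presf f])
  obtain ds where ds: "inp P l = outp P p # ds" and ops: "l \<in> Ops P" "p \<in> Ops P"
    using lp by (auto simp: pcomposable_split)
  have "composable P (pcmp P l 0 (cmp P p (map q J))) (map r (concat (map L J) @ ks))"
    by (rule presents_src_composable[OF presg g])
  then have "map (outp P) (map r (concat (map L J) @ ks)) = inp P (pcmp P l 0 (cmp P p (map q J)))"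
    and r: "r ` set (concat (map L J) @ ks) \<subseteq> Ops P"
    by (auto simp: composable_def)
  moreover have "inp P (pcmp P l 0 (cmp P p (map q J))) = concat (map (\<lambda>j. inp P (q j)) J) @ ds"
    using pcmp_Ops(3)[of l "cmp P p (map q J)" "[]" ds] ds ops cmp_Ops[OF pq] outp_cmp[OF pq] inp_cmp[OF pq]
    by (simp add: comp_def)
  ultimately have e: "concat (map (\<lambda>j. map (outp P) (map r (L j))) J) @ map (outp P) (map r ks) =
      concat (map (\<lambda>j. inp P (q j)) J) @ ds"
    by (simp add: map_concat comp_def)
  have len: "length (map (outp P) (map r (L j))) = length (inp P (q j))" if "j \<in> set J" for j
    using relabelled_facts(5)[OF presents_upper[OF presf f that]] by (simp add: arity_def)
  show up: "composable P (q j) (map r (L j))" if "j \<in> set J" for j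
    using concat_map_eqD(1)[OF e len that] relabelled_facts(1)[OF presents_upper[OF presf f that]] r that
    by (auto simp: composable_def)
  show "composable P l (ident P (outp P p) # map r ks)"
    using concat_map_eqD(2)[OF e len] r ds ops by (auto simp: composable_def ident_Ops outp_Col outp_ident)
  show "list_all2 (composable P) (map q J) (map (\<lambda>j. map r (L j)) J)"
    using up by (auto simp: list_all2_conv_all_nth)
qed

lemma presents_compo:
  "presents P p J (\<lambda>j. cmp P (q j) (map r (L j)))
    (pcmp P l' 0 (cmp P l (ident P (outp P p) # map r ks)))
    (\<lambda>j. concat (map M (L j))) (concat (map M ks) @ ms) (sym_compo P g f)"
  and compo_is_sym_arrow: "is_sym_arrow P (sym_compo P g f)"
proof -
  let ?n = "arity P (ssrc f)" and ?gr = "map ((!) (suppers g))" and ?lv = "\<lambda>L. concat (map ((!) (sup_leaves g)) L)"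
  let ?K = "concat (map L J) @ ks"
  let ?KK = "?lv (slow_leaves f) @ slow_leaves g"
  let ?l = "pcmp P (slower g) 0 (cmp P (slower f) (ident P (outp P (ssrc f)) # ?gr (slow_leaves f)))"
  have compo: "ssrc (sym_compo P g f) = ssrc f" "slower (sym_compo P g f) = sort_inputs_tail P ?l ?KK"
    "slow_leaves (sym_compo P g f) = sort ?KK"
    "length (suppers (sym_compo P g f)) = ?n" "length (sup_leaves (sym_compo P g f)) = ?n"
    "\<And>j. j < ?n \<Longrightarrow> suppers (sym_compo P g f) ! j =
      sort_inputs P (cmp P (suppers f ! j) (?gr (sup_leaves f ! j))) (?lv (sup_leaves f ! j))"
    "\<And>j. j < ?n \<Longrightarrow> sup_leaves (sym_compo P g f) ! j = sort (?lv (sup_leaves f ! j))"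
    using sym_arrowD(5,6)[OF f] by (simp_all add: sym_compo_def Let_def)
  have rM: "relabelled P (r k) (M k) (suppers g ! k) (sup_leaves g ! k)" if "k \<in> set ?K" for k
    by (rule presents_upper[OF presg g that])
  have leaf_f: "is_perm (arity P (ssrc g)) (leaf_list f)"
    using presents_labels[OF presf f] presents_set_J(2)[OF presg g] by (simp add: is_perm_iff_mset)
  have mset_lv: "mset (?lv (leaf_list f)) = mset (concat (sup_leaves g))"
    using leaf_f sym_arrowD(6)[OF g] by (intro mset_concat_cong mset_map_nth_perm) simp
  have lv_leaf: "?lv (leaf_list f) = concat (map ?lv (sup_leaves f)) @ ?lv (slow_leaves f)"
    by (simp add: leaf_list_def map_concat concat_concat_map comp_def)
  have mset_all: "mset (concat (map ?lv (sup_leaves f)) @ ?KK) = mset (leaf_list g)"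
    using mset_lv unfolding lv_leaf by (simp add: leaf_list_def)
  then have dist: "distinct (concat (map ?lv (sup_leaves f)) @ ?KK)"
    using mset_eq_imp_distinct_iff[OF mset_all] sym_arrowD(12)[OF g] by (simp add: is_perm_def)
  then have dK0: "distinct ?KK" by simp
  have dup: "distinct (?lv (sup_leaves f ! j))" if "j < ?n" for j
  proof -
    have "sup_leaves f ! j \<in> set (sup_leaves f)" using that sym_arrowD(6)[OF f] by simp
    then obtain u v where "sup_leaves f = u @ (sup_leaves f ! j) # v" using split_list by metis
    then have "map ?lv (sup_leaves f) = map ?lv u @ ?lv (sup_leaves f ! j) # map ?lv v"
      by (metis (no_types, lifting) list.simps(9) map_append)
    then show ?thesis using dist by simp
  qed
  have upper: "relabelled P (cmp P (q j) (map r (L j))) (concat (map M (L j)))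
      (suppers (sym_compo P g f) ! j) (sup_leaves (sym_compo P g f) ! j)" if j: "j \<in> set J" for j
  proof -
    have jn: "j < ?n" using j presents_set_J(1)[OF presf f] by simp
    have a: "relabelled P (cmp P (q j) (map r (L j))) (concat (map M (L j)))
        (cmp P (suppers f ! j) (?gr (sup_leaves f ! j))) (?lv (sup_leaves f ! j))"
      using j by (intro relabelled_cmp[OF presents_upper[OF presf f j] presents_compo_children(1)[OF j]] rM) auto
    from relabelled_trans[OF a relabelled_sort_inputs] show ?thesis
      using compo(6,7)[OF jn] dup[OF jn] relabelled_facts(2,4,6)[OF a] by simp
  qed
  have lowK: "relabelled P l (0 # map Suc ks) (slower f) (0 # map Suc (slow_leaves f))"
    by (rule presents_lower[OF presf f])
  let ?F = "\<lambda>r k. case k of 0 \<Rightarrow> ident P (outp P p) | Suc k \<Rightarrow> r k"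
  let ?G = "\<lambda>M k. case k of 0 \<Rightarrow> [0] | Suc k \<Rightarrow> map Suc (M k)"
  have F: "map (?F r) (0 # map Suc xs) = ident P (outp P p) # map r xs" for r xs by simp
  have G: "concat (map (?G M) (0 # map Suc xs)) = 0 # map Suc (concat (map M xs))" for M xs
    by (simp add: map_concat comp_def)
  have p: "p \<in> Ops P" using relabelled_facts(1)[OF presents_src[OF presf f]] .
  have out: "outp P (ssrc f) = outp P p" using relabelled_facts(3)[OF presents_src[OF presf f]] .
  have "relabelled P (cmp P l (ident P (outp P p) # map r ks)) (0 # map Suc (concat (map M ks)))
     (cmp P (slower f) (ident P (outp P p) # ?gr (slow_leaves f))) (0 # map Suc (?lv (slow_leaves f)))"
    unfolding F[symmetric] G[symmetric]
  proof (rule relabelled_cmp[OF lowK])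
    show "composable P l (map (?F r) (0 # map Suc ks))" unfolding F by (rule presents_compo_children(2))
    fix k assume "k \<in> set (0 # map Suc ks)"
    then show "relabelled P (?F r k) (?G M k) (?F ((!) (suppers g)) k) (?G ((!) (sup_leaves g)) k)"
      using rM p by (auto intro!: relabelled_refl relabelled_map simp: ident_Ops outp_Col arity_def inp_ident)
  qed
  note low1 = this
  let ?m = "cmp P l (ident P (outp P p) # map r ks)"
  have ml: "?m \<in> Ops P" "outp P ?m = outp P (pcmp P l 0 (cmp P p (map q J)))"
  proof -
    show "?m \<in> Ops P" using cmp_Ops presents_compo_children(2) by blast
    have "pcomposable P l 0 (cmp P p (map q J))"
      using presents_lower_pcomposable[OF presf f] presents_src_composable[OF presf f] cmp_Ops outp_cmp
      by (simp add: pcomposable_def)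
    then have "outp P (pcmp P l 0 (cmp P p (map q J))) = outp P l"
      unfolding pcomposable_split using pcmp_Ops(2)[of l "cmp P p (map q J)" "[]"] by auto
    then show "outp P ?m = outp P (pcmp P l 0 (cmp P p (map q J)))"
      using outp_cmp presents_compo_children(2) by simp
  qed
  have lm: "pcomposable P l' 0 ?m"
    using presents_lower_pcomposable[OF presg g] ml by (simp add: pcomposable_def)
  from relabelled_pcmp(1)[OF presents_lower[OF presg g] presents_lower_distinct[OF presg g] low1 lm, of "\<lambda>k. k"]
  have low2: "relabelled P (pcmp P l' 0 ?m) (0 # map Suc (concat (map M ks) @ ms)) ?l (0 # map Suc ?KK)"
    by (simp add: out)
  have "relabelled P ?l (0 # map Suc ?KK) (sort_inputs P ?l (0 # map Suc ?KK)) (sort (0 # map Suc ?KK))"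
    using dK0 relabelled_facts[OF low2]
    by (intro relabelled_sort_inputs) (auto simp: distinct_map simp del: map_append)
  then have low3: "relabelled P ?l (0 # map Suc ?KK) (slower (sym_compo P g f))
      (0 # map Suc (slow_leaves (sym_compo P g f)))"
    by (simp only: sort_zero_Suc sort_inputs_tail_eq[symmetric] compo)
  have low: "relabelled P (pcmp P l' 0 ?m) (0 # map Suc (concat (map M ks) @ ms)) (slower (sym_compo P g f))
      (0 # map Suc (slow_leaves (sym_compo P g f)))"
    by (rule relabelled_trans[OF low2 low3])
  show "presents P p J (\<lambda>j. cmp P (q j) (map r (L j))) (pcmp P l' 0 ?m)
    (\<lambda>j. concat (map M (L j))) (concat (map M ks) @ ms) (sym_compo P g f)"
    unfolding presents_def using presents_src[OF presf f] upper low by (simp add: compo(1))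
  have nJ: "j \<in> set J \<longleftrightarrow> j < ?n" for j using presents_set_J(1)[OF presf f] by simp
  show "is_sym_arrow P (sym_compo P g f)"
    unfolding is_sym_arrow_def compo(1)
  proof (intro conjI)
    have "outp P (suppers (sym_compo P g f) ! j) = inp P (ssrc f) ! j" if "j < ?n" for j
    proof -
      have "outp P (suppers (sym_compo P g f) ! j) = outp P (q j)"
        using relabelled_facts(3)[OF upper] nJ that presents_compo_children(1) outp_cmp by simp
      also have "\<dots> = outp P (suppers f ! j)"
        using relabelled_facts(3)[OF presents_upper[OF presf f]] nJ that by simp
      also have "\<dots> = inp P (ssrc f) ! j"
        using sym_arrowD(3,5)[OF f] that by (metis composable_def nth_map)
      finally show ?thesis .
    qed
    moreover have "suppers (sym_compo P g f) ! j \<in> Ops P" if "j < ?n" for j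
      using relabelled_facts(2)[OF upper] nJ that by simp
    ultimately show "composable P (ssrc f) (suppers (sym_compo P g f))"
      using compo(4) sym_arrowD(1)[OF f]
      by (auto simp: composable_def arity_def in_set_conv_nth intro!: nth_equalityI)
    have "map length (sup_leaves (sym_compo P g f)) ! j = map (arity P) (suppers (sym_compo P g f)) ! j" if "j < ?n" for j
      using relabelled_facts(4,6)[OF upper] nJ that compo(4,5) by simp
    then show "map length (sup_leaves (sym_compo P g f)) = map (arity P) (suppers (sym_compo P g f))"
      using compo(4,5) by (intro nth_equalityI) auto
    show "length (slow_leaves (sym_compo P g f)) = arity P (slower (sym_compo P g f)) - 1"
      using relabelled_facts(4,6)[OF low] by simp
    show "\<forall>L \<in> set (sup_leaves (sym_compo P g f)). sorted_wrt (<) L"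
      using compo(5,7) dup by (auto simp: in_set_conv_nth strict_sorted_sort simp del: sort_append)
    show "sorted_wrt (<) (slow_leaves (sym_compo P g f))"
      unfolding compo(3) by (rule strict_sorted_sort[OF dK0])
    have "mset (concat (sup_leaves (sym_compo P g f))) = mset (concat (map ?lv (sup_leaves f)))"
    proof -
      have "map mset (sup_leaves (sym_compo P g f)) = map mset (map ?lv (sup_leaves f))"
        using compo(5,7) sym_arrowD(6)[OF f] by (intro nth_equalityI) auto
      then show ?thesis unfolding mset_concat by simp
    qed
    then have "mset (leaf_list (sym_compo P g f)) = mset (leaf_list g)"
      unfolding mset_all[symmetric] by (simp add: leaf_list_def compo(3))
    then show "is_perm (length (leaf_list (sym_compo P g f))) (leaf_list (sym_compo P g f))"
      using sym_arrowD(12)[OF g] unfolding is_perm_iff_mset by (metis size_mset)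
    have d: "distinct (0 # map Suc ?KK)" using dK0 by (simp add: distinct_map del: map_append)
    obtain c where "map c (0 # map Suc ?KK) = inp P ?l"
      using distinct_map_inverse[OF d] relabelled_facts(6)[OF low2] relabelled_facts(4)[OF low2]
      by (metis arity_def)
    then have c: "map c (0 # map Suc ?KK) = inp P ?l"
      "map c (0 # map Suc (slow_leaves (sym_compo P g f))) = inp P (slower (sym_compo P g f))"
      using relabelled_inp[OF low3, of c] by auto
    have "pcomposable P (slower g) 0 (cmp P (slower f) (ident P (outp P p) # ?gr (slow_leaves f)))"
      by (rule relabelled_pcmp(2)[OF presents_lower[OF presg g] presents_lower_distinct[OF presg g] low1 lm])
    then obtain ds where ds: "inp P (slower g) = outp P (cmp P (slower f) (ident P (outp P p) # ?gr (slow_leaves f))) # ds"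
      "slower g \<in> Ops P" "cmp P (slower f) (ident P (outp P p) # ?gr (slow_leaves f)) \<in> Ops P"
      by (auto simp: pcomposable_split)
    have "inp P (cmp P (slower f) (ident P (outp P p) # ?gr (slow_leaves f))) ! 0 = outp P p \<and>
      inp P (cmp P (slower f) (ident P (outp P p) # ?gr (slow_leaves f))) \<noteq> []"
    proof -
      have "composable P (slower f) (map (?F ((!) (suppers g))) (0 # map Suc (slow_leaves f)))"
      proof -
        have "map (outp P) (map (?F r) (0 # map Suc ks)) = inp P l"
          unfolding F using presents_compo_children(2) by (simp add: composable_def)
        then have "map (\<lambda>k. outp P (?F r k)) (0 # map Suc (slow_leaves f)) = inp P (slower f)"
          using relabelled_inp[OF lowK, of "\<lambda>k. outp P (?F r k)"] by (simp add: comp_def)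
        moreover have "r k \<in> Ops P \<and> suppers g ! k \<in> Ops P \<and> outp P (suppers g ! k) = outp P (r k)"
          if "k \<in> set (slow_leaves f)" for k
        proof -
          have "Suc k \<in> set (0 # map Suc ks)" using that relabelled_set(1)[OF lowK] by auto
          then have "k \<in> set ?K" by auto
          from relabelled_facts[OF rM[OF this]] show ?thesis by simp
        qed
        ultimately show ?thesis
          using sym_arrowD(2)[OF f] p by (auto simp: composable_def ident_Ops outp_Col comp_def cong: map_cong)
      qed
      then show ?thesis
        unfolding F using inp_cmp p by (simp add: inp_ident outp_Col)
    qed
    then have "inp P ?l ! 0 = outp P p"
      using pcmp_Ops(3)[of "slower g" "cmp P (slower f) (ident P (outp P p) # ?gr (slow_leaves f))" "[]" ds] ds
      by (simp add: out nth_append)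
    \<comment> \<open>The label \<open>0\<close> is the least one, so that sorting does not move the input of the lower vertex
      to which the source is attached.\<close>
    then have "c 0 = outp P p" using c(1) by (metis list.simps(9) nth_Cons_0)
    then show "pcomposable P (slower (sym_compo P g f)) 0 (ssrc f)"
      using c(2)[symmetric] relabelled_facts(2)[OF low] sym_arrowD(1)[OF f] out
      by (simp add: pcomposable_def arity_def)
  qed
qed

end

end

section \<open>The twisted arrow category of a symmetric operad\<close>

context symmetric_operad
begin

text \<open>An arrow from \<open>ssrc g\<close> can be regarded as an arrow from any reordering of \<open>ssrc g\<close>, in
  particular from the unsorted target of a presentation of an arrow that precedes \<open>g\<close>.\<close>

lemma presents_along:
  assumes "is_sym_arrow P g" "relabelled P p K (ssrc g) [0..<arity P (ssrc g)]"
  shows "presents P p K ((!) (suppers g)) (slower g) ((!) (sup_leaves g)) (slow_leaves g) g"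
  using assms(2) sym_arrowD[OF assms(1)] relabelled_set(1)[OF assms(2)]
  by (auto simp: presents_def intro!: relabelled_refl)

lemma presents_cong:
  assumes "presents P p J q l L ks f" "\<And>j. j \<in> set J \<Longrightarrow> q j = q' j" "\<And>j. j \<in> set J \<Longrightarrow> L j = L' j"
  shows "presents P p J q' l L' ks f"
  using assms by (simp add: presents_def)

text \<open>For unsorted data, the compatibility of targets with composition is associativity of grafting,
  as in the planar case.\<close>

lemma presented_target_compo:
  assumes presf: "presents P p J q l L ks f" and f: "is_sym_arrow P f"
    and presg: "presents P (pcmp P l 0 (cmp P p (map q J))) (concat (map L J) @ ks) r l' M ms g"
    and g: "is_sym_arrow P g"
  shows "pcmp P (pcmp P l' 0 (cmp P l (ident P (outp P p) # map r ks))) 0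
      (cmp P p (map (\<lambda>j. cmp P (q j) (map r (L j))) J)) =
    pcmp P l' 0 (cmp P (pcmp P l 0 (cmp P p (map q J))) (map r (concat (map L J) @ ks)))"
proof -
  note ch = presents_compo_children[OF assms]
  have pq: "composable P p (map q J)" by (rule presents_src_composable[OF presf f])
  let ?Y = "cmp P p (map q J)" and ?Z = "cmp P p (map (\<lambda>j. cmp P (q j) (map r (L j))) J)"
  let ?m = "cmp P l (ident P (outp P p) # map r ks)"
  have p: "p \<in> Ops P" using pq by (simp add: composable_def)
  have l: "l \<in> Ops P" "inp P l = outp P p # map (outp P) (map r ks)" "set (map r ks) \<subseteq> Ops P"
    using ch(2) p by (auto simp: composable_def outp_ident outp_Col)
  have m2: "map2 (cmp P) (map q J) (map (\<lambda>j. map r (L j)) J) = map (\<lambda>j. cmp P (q j) (map r (L j))) J"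
    by (induction J) auto
  have Z: "cmp P ?Y (concat (map (\<lambda>j. map r (L j)) J)) = ?Z"
    using cmp_assoc[OF pq ch(3)] unfolding m2 .
  have ZO: "?Z \<in> Ops P" "outp P ?Z = outp P p"
    using composable_cmp(1)[OF pq ch(3)] cmp_Ops outp_cmp unfolding m2 by auto
  have T: "pcomposable P l' 0 (pcmp P l 0 ?Y)" by (rule presents_lower_pcomposable[OF presg g])
  have "outp P (pcmp P l 0 ?Y) = outp P l"
    using pcmp_Ops(2)[of l ?Y "[]"] l cmp_Ops[OF pq] outp_cmp[OF pq] by simp
  then have m: "pcomposable P l' 0 ?m" "pcomposable P ?m 0 ?Z"
    using T cmp_Ops[OF ch(2)] outp_cmp[OF ch(2)] inp_cmp[OF ch(2)] ZO p
    by (auto simp: pcomposable_def arity_def inp_ident outp_Col)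
  have "cmp P (pcmp P l 0 ?Y) (map r (concat (map L J) @ ks)) =
      cmp P (pcmp P l (length ([] :: 'o list)) ?Y) ([] @ concat (map (\<lambda>j. map r (L j)) J) @ map r ks)"
    by (simp add: map_concat comp_def)
  also have "\<dots> = cmp P l ([] @ cmp P ?Y (concat (map (\<lambda>j. map r (L j)) J)) # map r ks)"
  proof (rule cmp_pcmp)
    show "inp P l = map (outp P) [] @ outp P ?Y # map (outp P) (map r ks)"
      using l(2) outp_cmp[OF pq] by simp
    show "composable P ?Y (concat (map (\<lambda>j. map r (L j)) J))" by (rule composable_cmp(2)[OF pq ch(3)])
  qed (use l in simp_all)
  also have "\<dots> = pcmp P ?m 0 ?Z"
    using pcmp_cmp_ident[OF _ ZO(1) ZO(2)[symmetric], of l "[]" "map r ks"] ch(2) by (simp add: Z)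
  finally show ?thesis using pcmp_pcmp[OF m] by simp
qed

lemma composite_labels:
  "concat (map (\<lambda>j. concat (map M (L j))) J) @ concat (map M ks) @ ms = concat (map M (concat (map L J) @ ks)) @ ms"
  by (simp add: map_concat concat_concat_map comp_def)

context
  fixes f g
  assumes f: "is_sym_arrow P f" and g: "is_sym_arrow P g" and fg: "sym_target P f = ssrc g"
begin

lemma presents_next:
  assumes "presents P p J q l L ks f"
  shows "presents P (pcmp P l 0 (cmp P p (map q J))) (concat (map L J) @ ks)
    ((!) (suppers g)) (slower g) ((!) (sup_leaves g)) (slow_leaves g) g"
  using presents_along[OF g] presents_target(1)[OF assms f] fg by simp

lemma sym_compo_arr: "is_sym_arrow P (sym_compo P g f)"
  by (rule compo_is_sym_arrow[OF presents_self[OF f] f presents_next[OF presents_self[OF f]] g])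

lemma sym_target_compo: "sym_target P (sym_compo P g f) = sym_target P g"
proof -
  note a = presents_self[OF f] f presents_next[OF presents_self[OF f]] g
  note c = presents_target(1)[OF presents_compo[OF a] sym_compo_arr]
  have c': "relabelled P (pcmp P (slower g) 0 (cmp P (pcmp P (slower f) 0 (cmp P (ssrc f)
        (map ((!) (suppers f)) [0..<arity P (ssrc f)])))
        (map ((!) (suppers g)) (concat (map ((!) (sup_leaves f)) [0..<arity P (ssrc f)]) @ slow_leaves f))))
     (concat (map ((!) (sup_leaves g)) (concat (map ((!) (sup_leaves f)) [0..<arity P (ssrc f)]) @ slow_leaves f)) @ slow_leaves g)
     (sym_target P (sym_compo P g f)) [0..<arity P (sym_target P (sym_compo P g f))]"
    using c unfolding presented_target_compo[OF a] composite_labels .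
  show ?thesis
    by (rule relabelled_sorted_unique(1)[OF c' presents_target(1)[OF a(3,4)]]) auto
qed

end

text \<open>Both sides are sorted arrows with the same unsorted presentation.\<close>

lemma sym_compo_assoc:
  assumes f: "is_sym_arrow P f" and g: "is_sym_arrow P g" and h: "is_sym_arrow P h"
    and fg: "sym_target P f = ssrc g" and gh: "sym_target P g = ssrc h"
  shows "sym_compo P h (sym_compo P g f) = sym_compo P (sym_compo P h g) f"
proof -
  define p J q l L ks where defs: "p = ssrc f" "J = [0..<arity P (ssrc f)]" "q = (!) (suppers f)" "l = slower f"
    "L = (!) (sup_leaves f)" "ks = slow_leaves f"
  define r l' M ms where defs': "r = (!) (suppers g)" "l' = slower g" "M = (!) (sup_leaves g)" "ms = slow_leaves g"
  define s l'' S ns where defs'': "s = (!) (suppers h)" "l'' = slower h" "S = (!) (sup_leaves h)" "ns = slow_leaves h"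
  let ?T = "pcmp P l 0 (cmp P p (map q J))" and ?K = "concat (map L J) @ ks"
  let ?X = "pcmp P l' 0 (cmp P ?T (map r ?K))" and ?N = "concat (map M ?K) @ ms"
  have pf: "presents P p J q l L ks f" using presents_self[OF f] by (simp add: defs)
  have pg: "presents P ?T ?K r l' M ms g" using presents_next[OF f g fg pf] by (simp add: defs')
  have ph: "presents P ?X ?N s l'' S ns h" using presents_next[OF g h gh pg] by (simp add: defs'')
  note gf = presents_compo[OF pf f pg g] sym_compo_arr[OF f g fg]
  note hg = presents_compo[OF pg g ph h] sym_compo_arr[OF g h gh]
  have gf_h: "sym_target P (sym_compo P g f) = ssrc h" using sym_target_compo[OF f g fg] gh by simp
  have f_hg: "sym_target P f = ssrc (sym_compo P h g)" using fg by (simp add: sym_compo_def Let_def)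
  note ph' = ph[folded presented_target_compo[OF pf f pg g] composite_labels[of M L J ks ms]]
  note lhs = presents_compo[OF gf ph' h] sym_compo_arr[OF gf(2) h gf_h]
  note rhs = presents_compo[OF pf f hg] sym_compo_arr[OF f hg(2) f_hg]
  note chg = presents_compo_children[OF pf f pg g] and chh = presents_compo_children[OF pg g ph h]
  let ?c = "outp P p"
  have up: "cmp P (cmp P (q j) (map r (L j))) (map s (concat (map M (L j)))) =
      cmp P (q j) (map (\<lambda>k. cmp P (r k) (map s (M k))) (L j))" if j: "j \<in> set J" for j
  proof -
    have "list_all2 (composable P) (map r (L j)) (map (\<lambda>k. map s (M k)) (L j))"
      using chh(1) j by (auto simp: list.rel_map intro!: list.rel_refl_strong)
    from cmp_assoc[OF chg(1)[OF j] this]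
    have "cmp P (cmp P (q j) (map r (L j))) (concat (map (\<lambda>k. map s (M k)) (L j))) =
        cmp P (q j) (map2 (cmp P) (map r (L j)) (map (\<lambda>k. map s (M k)) (L j)))" .
    moreover have "map2 (cmp P) (map r xs) (map (\<lambda>k. map s (M k)) xs) = map (\<lambda>k. cmp P (r k) (map s (M k))) xs" for xs
      by (induction xs) auto
    ultimately show ?thesis by (simp add: map_concat comp_def)
  qed
  have p: "p \<in> Ops P" using sym_arrowD(1)[OF f] by (simp add: defs)
  have out: "outp P ?T = outp P l"
  proof -
    have "composable P p (map q J)" "pcomposable P l 0 p"
      using presents_src_composable[OF pf f] presents_lower_pcomposable[OF pf f] by auto
    then show ?thesis
      using pcmp_Ops(2)[of l "cmp P p (map q J)" "[]"] cmp_Ops outp_cmp by (auto simp: pcomposable_split)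
  qed
  have low: "pcmp P l'' 0 (cmp P (pcmp P l' 0 (cmp P l (ident P ?c # map r ks)))
        (ident P ?c # map s (concat (map M ks) @ ms))) =
      pcmp P (pcmp P l'' 0 (cmp P l' (ident P (outp P ?T) # map s ms))) 0
        (cmp P l (ident P ?c # map (\<lambda>k. cmp P (r k) (map s (M k))) ks))"
  proof -
    have "map2 (cmp P) (map r ks) (map (\<lambda>k. map s (M k)) ks) = map (\<lambda>k. cmp P (r k) (map s (M k))) ks"
      by (induction ks) auto
    moreover have "pcmp P l'' 0 (cmp P (pcmp P l' (length ([] :: 'o list)) (cmp P l ([] @ ident P ?c # map r ks)))
        (([] @ concat []) @ ident P ?c # (concat (map (\<lambda>k. map s (M k)) ks) @ map s ms))) =
      pcmp P (pcmp P l'' 0 (cmp P l' ([] @ ident P (outp P l) # map s ms)))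
        (0 + sum_list (map (arity P) [])) (cmp P l (map2 (cmp P) [] [] @ ident P ?c # map2 (cmp P) (map r ks) (map (\<lambda>k. map s (M k)) ks)))"
    proof (rule lower_vertex_assoc)
      show "composable P l ([] @ ident P ?c # map r ks)" using chg(2) by simp
      show "composable P l' ([] @ ident P (outp P l) # map s ms)" using chh(2) out by simp
      have "pcomposable P l'' 0 ?X" by (rule presents_lower_pcomposable[OF ph h])
      moreover have "outp P ?X = outp P l'"
      proof -
        have "composable P ?T (map r ?K)" "pcomposable P l' 0 ?T"
          using presents_src_composable[OF pg g] presents_lower_pcomposable[OF pg g] by auto
        then show ?thesis
          using pcmp_Ops(2)[of l' "cmp P ?T (map r ?K)" "[]"] cmp_Ops outp_cmp by (auto simp: pcomposable_split)
      qed
      moreover have "l' \<in> Ops P" using chh(2) by (simp add: composable_def)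
      ultimately show "pcomposable P l'' 0 l'" by (simp add: pcomposable_def)
      show "list_all2 (composable P) [] []" by simp
      show "list_all2 (composable P) (map r ks) (map (\<lambda>k. map s (M k)) ks)"
        using chh(1) by (auto simp: list.rel_map intro!: list.rel_refl_strong)
      show "?c \<in> Col P" using outp_Col[OF p] .
    qed
    ultimately show ?thesis using out by (simp add: map_concat comp_def)
  qed
  have "presents P p J (\<lambda>j. cmp P (q j) (map (\<lambda>k. cmp P (r k) (map s (M k))) (L j)))
     (pcmp P (pcmp P l'' 0 (cmp P l' (ident P (outp P ?T) # map s ms))) 0
        (cmp P l (ident P ?c # map (\<lambda>k. cmp P (r k) (map s (M k))) ks)))
     (\<lambda>j. concat (map (\<lambda>k. concat (map S (M k))) (L j)))
     (concat (map (\<lambda>k. concat (map S (M k))) ks) @ concat (map S ms) @ ns)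
     (sym_compo P h (sym_compo P g f))"
    unfolding low[symmetric]
    using presents_cong[OF lhs(1), of "\<lambda>j. cmp P (q j) (map (\<lambda>k. cmp P (r k) (map s (M k))) (L j))"
        "\<lambda>j. concat (map (\<lambda>k. concat (map S (M k))) (L j))"] up
    by (simp add: map_concat concat_concat_map comp_def)
  then show ?thesis using presents_unique[OF _ lhs(2) rhs] by blast
qed

lemma sym_idt:
  assumes "p \<in> Ops P"
  shows "is_sym_arrow P (idt (sym_Tw P) p)" "sym_target P (idt (sym_Tw P) p) = p"
proof -
  have l: "leaf_list (idt (sym_Tw P) p) = [0..<arity P p]"
  proof -
    have "concat (map (\<lambda>j. [j]) xs) = xs" for xs :: "nat list" by (induction xs) auto
    then show ?thesis by (simp add: leaf_list_def)
  qed
  have c: "map (arity P) (map (ident P) (inp P p)) = map length (map (\<lambda>j. [j]) [0..<arity P p])"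
    using inp_ident[OF subsetD[OF inp_Col[OF assms] nth_mem]] by (intro nth_equalityI) (auto simp: arity_def)
  show "is_sym_arrow P (idt (sym_Tw P) p)"
    unfolding is_sym_arrow_def l is_perm_iff_mset
    using assms composable_idents[OF assms] outp_Col[OF assms] c
    by (simp add: pcomposable_def arity_def ident_Ops inp_ident)
  show "sym_target P (idt (sym_Tw P) p) = p"
    unfolding sym_target_def l using assms by (simp add: cmp_ident_right pcmp_ident act_id)
qed

lemma sym_compo_idt_right:
  assumes f: "is_sym_arrow P f"
  shows "sym_compo P f (idt (sym_Tw P) (ssrc f)) = f"
proof -
  let ?i = "idt (sym_Tw P) (ssrc f)" and ?n = "arity P (ssrc f)"
  have o: "ssrc f \<in> Ops P" by (rule sym_arrowD(1)[OF f])
  note i = sym_idt[OF o]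
  have "presents P (ssrc f) [0..<?n] ((!) (suppers ?i)) (slower ?i) ((!) (sup_leaves ?i)) (slow_leaves ?i) ?i"
    using presents_self[OF i(1)] by simp
  note a = this i(1) presents_next[OF i(1) f i(2) this] f
  note c = presents_compo[OF a] compo_is_sym_arrow[OF a]
  have "presents P (ssrc f) [0..<?n] ((!) (suppers f)) (slower f) ((!) (sup_leaves f)) (slow_leaves f) (sym_compo P f ?i)"
  proof -
    have "pcmp P (slower f) 0 (cmp P (slower ?i) (ident P (outp P (ssrc f)) # map ((!) (suppers f)) (slow_leaves ?i))) = slower f"
    proof -
      obtain ds where "slower f \<in> Ops P" "inp P (slower f) = [] @ outp P (ssrc f) # ds"
        using sym_arrowD(4)[OF f] by (auto simp: pcomposable_split)
      then show ?thesis
        using pcmp_ident_right[of "slower f" "[]"] outp_Col[OF o] by (simp add: cmp_ident ident_Ops outp_ident)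
    qed
    moreover have "concat (map ((!) (sup_leaves f)) (slow_leaves ?i)) @ slow_leaves f = slow_leaves f" by simp
    moreover have "cmp P (suppers ?i ! j) (map ((!) (suppers f)) (sup_leaves ?i ! j)) = suppers f ! j" if "j < ?n" for j
    proof -
      have "inp P (ssrc f) ! j = outp P (suppers f ! j)"
        using sym_arrowD(3)[OF f] that by (metis arity_def composable_def length_map nth_map)
      then show ?thesis using sym_arrowD(7)[OF f that] that by (simp add: cmp_ident arity_def)
    qed
    moreover have "concat (map ((!) (sup_leaves f)) (sup_leaves ?i ! j)) = sup_leaves f ! j" if "j < ?n" for j
      using that by simp
    ultimately show ?thesis
      using presents_cong[OF c(1), of "(!) (suppers f)" "(!) (sup_leaves f)"] by simp
  qed
  then show ?thesis using presents_unique[OF _ c(2) presents_self[OF f] f] by blast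
qed

lemma sym_compo_idt_left:
  assumes f: "is_sym_arrow P f"
  shows "sym_compo P (idt (sym_Tw P) (sym_target P f)) f = f"
proof -
  let ?t = "sym_target P f"
  let ?i = "idt (sym_Tw P) ?t" and ?n = "arity P (ssrc f)"
  define q L where qL: "q = (!) (suppers f)" "L = (!) (sup_leaves f)"
  have pf: "presents P (ssrc f) [0..<?n] q (slower f) L (slow_leaves f) f"
    using presents_self[OF f] by (simp add: qL)
  have t: "?t \<in> Ops P" by (rule presents_target(2)[OF pf f])
  note i = sym_idt[OF t]
  have fi: "sym_target P f = ssrc ?i" by simp
  note a = pf f presents_next[OF f i(1) fi pf] i(1)
  note c = presents_compo[OF a] compo_is_sym_arrow[OF a] and ch = presents_compo_children[OF a]
  have K: "set (concat (map L [0..<?n]) @ slow_leaves f) = {..<arity P ?t}"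
    using presents_set_J(1)[OF a(3,4)] by simp
  have r: "map ((!) (suppers ?i)) ks = map (ident P) (map (\<lambda>k. inp P ?t ! k) ks)"
    if "set ks \<subseteq> {..<arity P ?t}" for ks
    using that by (auto simp: arity_def)
  have lv: "concat (map ((!) (sup_leaves ?i)) ks) = ks" if "set ks \<subseteq> {..<arity P ?t}" for ks
  proof -
    have e: "map ((!) (sup_leaves ?i)) ks = map (\<lambda>k. [k]) ks" using that by auto
    have "concat (map (\<lambda>j. [j]) xs) = xs" for xs :: "nat list" by (induction xs) auto
    then show ?thesis unfolding e .
  qed
  have Lj: "set (L j) \<subseteq> {..<arity P ?t}" if "j < ?n" for j
    using that unfolding K[symmetric] by auto
  have sl: "set (slow_leaves f) \<subseteq> {..<arity P ?t}" unfolding K[symmetric] by auto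
  have cmp_idents: "cmp P x (map (ident P) cs) = x" if "composable P x (map (ident P) cs)" "set cs \<subseteq> Col P" for x cs
    using that outp_idents[OF that(2)] cmp_ident_right[of x] by (simp add: composable_def)
  have col: "set (map (\<lambda>k. inp P ?t ! k) ks) \<subseteq> Col P" if "set ks \<subseteq> {..<arity P ?t}" for ks
    using that inp_Col[OF t] unfolding arity_def by (auto simp: subset_iff)
  have up: "cmp P (q j) (map ((!) (suppers ?i)) (L j)) = q j" if j: "j < ?n" for j
  proof -
    have "composable P (q j) (map ((!) (suppers ?i)) (L j))" by (intro ch(1)) (simp add: j)
    then show ?thesis unfolding r[OF Lj[OF j]] by (rule cmp_idents[OF _ col[OF Lj[OF j]]])
  qed
  have low: "cmp P (slower f) (ident P (outp P (ssrc f)) # map ((!) (suppers ?i)) (slow_leaves f)) = slower f"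
  proof -
    let ?cs = "outp P (ssrc f) # map (\<lambda>k. inp P ?t ! k) (slow_leaves f)"
    have "set ?cs \<subseteq> Col P" using col[OF sl] outp_Col[OF sym_arrowD(1)[OF f]] by simp
    moreover have e: "ident P (outp P (ssrc f)) # map ((!) (suppers ?i)) (slow_leaves f) = map (ident P) ?cs"
      unfolding r[OF sl] by simp
    ultimately show ?thesis unfolding e by (intro cmp_idents) (use ch(2) in \<open>simp_all only: e\<close>)
  qed
  have out: "outp P ?t = outp P (slower f)"
  proof -
    have "outp P ?t = outp P (pcmp P (slower f) 0 (cmp P (ssrc f) (map q [0..<?n])))"
      using relabelled_facts(3)[OF presents_target(1)[OF pf f]] .
    also have "\<dots> = outp P (slower f)"
      using presents_src_composable[OF pf f] presents_lower_pcomposable[OF pf f]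
        pcmp_Ops(2)[of "slower f" "cmp P (ssrc f) (map q [0..<?n])" "[]"] cmp_Ops outp_cmp
      by (auto simp: pcomposable_split)
    finally show ?thesis .
  qed
  have "presents P (ssrc f) [0..<?n] q (slower f) L (slow_leaves f) (sym_compo P ?i f)"
    using presents_cong[OF c(1), of q L] up low out lv[OF sl] lv[OF Lj] pcmp_ident[OF sym_arrowD(2)[OF f]]
    by simp
  then show ?thesis using presents_unique[OF _ c(2) pf f] by blast
qed

lemma sym_Tw_category: "category (sym_Tw P)"
proof
  fix f assume "f \<in> arr (sym_Tw P)"
  then have f: "is_sym_arrow P f" by simp
  show "dom (sym_Tw P) f \<in> obj (sym_Tw P)" "cod (sym_Tw P) f \<in> obj (sym_Tw P)"
    using sym_arrowD(1)[OF f] presents_target(2)[OF presents_self[OF f] f] by auto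
next
  fix f g a b c assume "f \<in> hom (sym_Tw P) a b" "g \<in> hom (sym_Tw P) b c"
  then show "compo (sym_Tw P) g f \<in> hom (sym_Tw P) a c"
    using sym_compo_arr[of f g] sym_target_compo[of f g] by (auto simp: hom_def sym_compo_def Let_def)
next
  fix f a b assume "f \<in> hom (sym_Tw P) a b"
  then show "compo (sym_Tw P) (idt (sym_Tw P) b) f = f" "compo (sym_Tw P) f (idt (sym_Tw P) a) = f"
    using sym_compo_idt_left[of f] sym_compo_idt_right[of f] by (auto simp: hom_def)
next
  fix f g h a b c d
  assume "f \<in> hom (sym_Tw P) a b" "g \<in> hom (sym_Tw P) b c" "h \<in> hom (sym_Tw P) c d"
  then show "compo (sym_Tw P) h (compo (sym_Tw P) g f) = compo (sym_Tw P) (compo (sym_Tw P) h g) f"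
    using sym_compo_assoc[of f g h] by (auto simp: hom_def)
next
  fix a assume "a \<in> obj (sym_Tw P)"
  then show "idt (sym_Tw P) a \<in> hom (sym_Tw P) a a"
    using sym_idt[of a] by (simp add: hom_def)
qed

end

section \<open>Subcategories of the symmetric twisted arrow category\<close>

context symmetric_operad
begin

lemma ranks_singleton [simp]: "ranks [b] = [0]"
proof -
  have "{y. y = b \<and> y < b} = {}" by auto
  then show ?thesis by (simp add: ranks_def)
qed

lemma ranks_sorted: "sorted_wrt (<) K \<Longrightarrow> ranks K = [0..<length K]"
  using sorted_distinct_card_less[of K] by (intro nth_equalityI) (auto simp: ranks_def)

lemma sort_inputs_singleton: "p \<in> Ops P \<Longrightarrow> arity P p = 1 \<Longrightarrow> sort_inputs P p [b] = p"
  using act_id[of p] by (simp add: sort_inputs_def)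

lemma sort_inputs_tail_sorted:
  assumes "sorted_wrt (<) K" "p \<in> Ops P" "arity P p = Suc (length K)"
  shows "sort_inputs_tail P p K = p"
proof -
  have "0 # map Suc (ranks K) = [0..<arity P p]"
    using ranks_sorted[OF assms(1)] assms(3) by (simp add: upt_conv_Cons map_Suc_upt del: upt_Suc)
  then show ?thesis using act_id[OF assms(2)] by (simp add: sort_inputs_tail_def)
qed

lemma sym_compo_fields:
  assumes "is_sym_arrow P f"
  shows "ssrc (sym_compo P g f) = ssrc f"
    "slower (sym_compo P g f) = sort_inputs_tail P (pcmp P (slower g) 0 (cmp P (slower f)
       (ident P (outp P (ssrc f)) # map ((!) (suppers g)) (slow_leaves f))))
       (concat (map ((!) (sup_leaves g)) (slow_leaves f)) @ slow_leaves g)"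
    "slow_leaves (sym_compo P g f) = sort (concat (map ((!) (sup_leaves g)) (slow_leaves f)) @ slow_leaves g)"
    "length (suppers (sym_compo P g f)) = arity P (ssrc f)" "length (sup_leaves (sym_compo P g f)) = arity P (ssrc f)"
    "j < arity P (ssrc f) \<Longrightarrow> suppers (sym_compo P g f) ! j =
      sort_inputs P (cmp P (suppers f ! j) (map ((!) (suppers g)) (sup_leaves f ! j)))
        (concat (map ((!) (sup_leaves g)) (sup_leaves f ! j)))"
    "j < arity P (ssrc f) \<Longrightarrow> sup_leaves (sym_compo P g f) ! j =
      sort (concat (map ((!) (sup_leaves g)) (sup_leaves f ! j)))"
  using sym_arrowD(5,6)[OF assms] by (simp_all add: sym_compo_def Let_def)

lemma sup_leaves_bound:
  assumes "is_sym_arrow P f" "j < arity P (ssrc f)" "k \<in> set (sup_leaves f ! j)"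
  shows "k < arity P (sym_target P f)"
proof -
  have "sup_leaves f ! j \<in> set (sup_leaves f)" using sym_arrowD(6)[OF assms(1)] assms(2) by simp
  then have "k \<in> set (leaf_list f)" using assms(3) by (auto simp: leaf_list_def)
  then show ?thesis
    using sym_arrowD(12)[OF assms(1)] presents_target(3)[OF presents_self[OF assms(1)] assms(1)]
    by (simp add: is_perm_def)
qed

lemma sym_compo_upper:
  assumes "is_sym_arrow P f" "is_sym_arrow P g" "sym_target P f = ssrc g" "j < arity P (ssrc f)"
  shows "composable P (suppers f ! j) (map ((!) (suppers g)) (sup_leaves f ! j))"
    "arity P (suppers (sym_compo P g f) ! j) = sum_list (map (arity P) (map ((!) (suppers g)) (sup_leaves f ! j)))"
    "map ((!) (suppers g)) (sup_leaves f ! j) = rs \<Longrightarrow> set rs \<subseteq> set (suppers g)"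
    "suppers (sym_compo P g f) ! j \<in> identities P \<Longrightarrow>
      cmp P (suppers f ! j) (map ((!) (suppers g)) (sup_leaves f ! j)) \<in> identities P"
proof -
  note a = presents_self[OF assms(1)] assms(1) presents_next[OF assms(1-3) presents_self[OF assms(1)]] assms(2)
  show c: "composable P (suppers f ! j) (map ((!) (suppers g)) (sup_leaves f ! j))"
    using presents_compo_children(1)[OF a, of j] assms(4) by simp
  let ?x = "cmp P (suppers f ! j) (map ((!) (suppers g)) (sup_leaves f ! j))"
  have x: "arity P ?x = sum_list (map (arity P) (map ((!) (suppers g)) (sup_leaves f ! j)))" "?x \<in> Ops P"
    by (simp_all only: arity_def[of P ?x] inp_cmp[OF c] length_concat_inp cmp_Ops[OF c])
  have b: "\<And>k. k \<in> set (sup_leaves f ! j) \<Longrightarrow> k < arity P (ssrc g)"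
    using sup_leaves_bound[OF assms(1,4)] assms(3) by simp
  then show "map ((!) (suppers g)) (sup_leaves f ! j) = rs \<Longrightarrow> set rs \<subseteq> set (suppers g)"
    using sym_arrowD(5)[OF assms(2)] by auto
  have rel: "relabelled P ?x (concat (map ((!) (sup_leaves g)) (sup_leaves f ! j)))
      (suppers (sym_compo P g f) ! j) (sup_leaves (sym_compo P g f) ! j)"
    using presents_upper[OF presents_compo[OF a] compo_is_sym_arrow[OF a], of j] assms(4) by simp
  show "arity P (suppers (sym_compo P g f) ! j) = sum_list (map (arity P) (map ((!) (suppers g)) (sup_leaves f ! j)))"
    using relabelled_facts(4)[OF rel] x by simp
  assume i: "suppers (sym_compo P g f) ! j \<in> identities P"
  then have 1: "arity P ?x = 1" using relabelled_facts(4)[OF rel] by (auto simp: identities_def arity_ident)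
  then have "length (concat (map ((!) (sup_leaves g)) (sup_leaves f ! j))) = 1" using relabelled_facts(5)[OF rel] by simp
  then obtain b where "concat (map ((!) (sup_leaves g)) (sup_leaves f ! j)) = [b]" by (auto simp: length_Suc_conv)
  then have "suppers (sym_compo P g f) ! j = ?x"
    using sym_compo_fields(6)[OF assms(1,4)] sort_inputs_singleton[OF x(2) 1] by simp
  then show "?x \<in> identities P" using i by simp
qed

lemma sym_compo_upper_singleton:
  assumes "is_sym_arrow P f" "is_sym_arrow P g" "sym_target P f = ssrc g" "j < arity P (ssrc f)"
    and "sup_leaves f ! j = [a]" "sup_leaves g ! a = [b]"
  shows "suppers (sym_compo P g f) ! j = cmp P (suppers f ! j) [suppers g ! a]"
    "sup_leaves (sym_compo P g f) ! j = [b]" "composable P (suppers f ! j) [suppers g ! a]"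
proof -
  show c: "composable P (suppers f ! j) [suppers g ! a]"
    using sym_compo_upper(1)[OF assms(1-4)] assms(5) by simp
  have "a < arity P (ssrc g)" using sup_leaves_bound[OF assms(1,4)] assms(3,5) by simp
  then have "arity P (suppers g ! a) = 1" using sym_arrowD(8)[OF assms(2)] assms(6) by (metis length_Cons list.size(3) One_nat_def)
  then have "arity P (cmp P (suppers f ! j) [suppers g ! a]) = 1"
    using inp_cmp[OF c] by (simp add: arity_def)
  then show "suppers (sym_compo P g f) ! j = cmp P (suppers f ! j) [suppers g ! a]"
    using sym_compo_fields(6)[OF assms(1,4)] sort_inputs_singleton[OF cmp_Ops[OF c]] assms(5,6) by simp
  show "sup_leaves (sym_compo P g f) ! j = [b]"
    using sym_compo_fields(7)[OF assms(1,4)] assms(5,6) by simp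
qed

lemma unary_uppers_leaves:
  assumes "is_sym_arrow P f" "\<And>u. u \<in> set (suppers f) \<Longrightarrow> unary_iso u" "j < arity P (ssrc f)"
  obtains a where "sup_leaves f ! j = [a]"
proof -
  have "suppers f ! j \<in> set (suppers f)" using sym_arrowD(5)[OF assms(1)] assms(3) by simp
  then have "unary_iso (suppers f ! j)" by (rule assms(2))
  then have "arity P (suppers f ! j) = 1" by (rule unary_isoE) (simp add: arity_def)
  then have "length (sup_leaves f ! j) = 1" using sym_arrowD(8)[OF assms(1,3)] by simp
  then show thesis using that by (auto simp: length_Suc_conv)
qed

lemma sym_compo_unary_uppers:
  assumes f: "is_sym_arrow P f" and g: "is_sym_arrow P g" and fg: "sym_target P f = ssrc g"
    and uf: "\<And>u. u \<in> set (suppers f) \<Longrightarrow> unary_iso u" and ug: "\<And>u. u \<in> set (suppers g) \<Longrightarrow> unary_iso u"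
    and u: "u \<in> set (suppers (sym_compo P g f))"
  obtains v w where "v \<in> set (suppers f)" "w \<in> set (suppers g)" "composable P v [w]" "u = cmp P v [w]"
proof -
  obtain j where j: "j < arity P (ssrc f)" "u = suppers (sym_compo P g f) ! j"
    using u sym_compo_fields(4)[OF f] by (metis in_set_conv_nth)
  obtain a where a: "sup_leaves f ! j = [a]" using unary_uppers_leaves[OF f uf j(1)] .
  have aN: "a < arity P (ssrc g)" using sup_leaves_bound[OF f j(1)] fg a by simp
  obtain b where b: "sup_leaves g ! a = [b]" using unary_uppers_leaves[OF g ug aN] .
  show thesis
    using sym_compo_upper_singleton(1,3)[OF f g fg j(1) a b] j sym_arrowD(5)[OF f] sym_arrowD(5)[OF g] aN
    by (intro that[of "suppers f ! j" "suppers g ! a"]) auto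
qed

lemma sym_compo_identity_uppers:
  assumes f: "is_sym_arrow P f" and g: "is_sym_arrow P g" and fg: "sym_target P f = ssrc g"
    and uf: "set (suppers f) \<subseteq> identities P" and ug: "set (suppers g) \<subseteq> identities P"
  shows "set (suppers (sym_compo P g f)) \<subseteq> identities P"
proof
  fix u assume u: "u \<in> set (suppers (sym_compo P g f))"
  obtain v w where vw: "v \<in> set (suppers f)" "w \<in> set (suppers g)" "composable P v [w]" "u = cmp P v [w]"
  proof (rule sym_compo_unary_uppers[OF f g fg _ _ u])
    show "\<And>u. u \<in> set (suppers f) \<Longrightarrow> unary_iso u" "\<And>u. u \<in> set (suppers g) \<Longrightarrow> unary_iso u"
      using uf ug unary_iso_ident by auto
  qed
  then have "cmp P v [w] = w" using identity_cmp[OF _ vw(3)] uf by auto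
  then show "u \<in> identities P" using vw ug by auto
qed

lemma sym_LowerD:
  assumes "f \<in> sym_Lower P"
  shows "is_sym_arrow P f" "set (suppers f) \<subseteq> identities P" "sorted_wrt (<) (map hd (sup_leaves f))"
  using assms by (auto simp: sym_Lower_def)

lemma idents_identities: "p \<in> Ops P \<Longrightarrow> set (map (ident P) (inp P p)) \<subseteq> identities P"
  using inp_Col[of p] by (auto simp: identities_def)

lemma sym_Lower_idt: "p \<in> Ops P \<Longrightarrow> idt (sym_Tw P) p \<in> sym_Lower P"
  using sym_idt(1)[of p] idents_identities[of p]
  by (simp add: sym_Lower_def comp_def strict_sorted_iff)

lemma sym_Lower_compo:
  assumes "f \<in> sym_Lower P" "g \<in> sym_Lower P" "sym_target P f = ssrc g"
  shows "sym_compo P g f \<in> sym_Lower P"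
proof -
  note f = sym_LowerD[OF assms(1)] and g = sym_LowerD[OF assms(2)] and fg = assms(3)
  have uf: "\<And>u. u \<in> set (suppers f) \<Longrightarrow> unary_iso u" and ug: "\<And>u. u \<in> set (suppers g) \<Longrightarrow> unary_iso u"
    using f g unary_iso_ident by auto
  have hd: "hd (sup_leaves (sym_compo P g f) ! j) = hd (sup_leaves g ! hd (sup_leaves f ! j)) \<and>
      hd (sup_leaves f ! j) < arity P (ssrc g)" if j: "j < arity P (ssrc f)" for j
  proof -
    obtain a where a: "sup_leaves f ! j = [a]" using unary_uppers_leaves[OF f(1) uf j] .
    have aN: "a < arity P (ssrc g)" using sup_leaves_bound[OF f(1) j] fg a by simp
    obtain b where b: "sup_leaves g ! a = [b]" using unary_uppers_leaves[OF g(1) ug aN] .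
    show ?thesis using sym_compo_upper_singleton(2)[OF f(1) g(1) fg j a b] a b aN by simp
  qed
  have "sorted_wrt (<) (map hd (sup_leaves (sym_compo P g f)))"
    unfolding sorted_wrt_iff_nth_less
  proof (intro allI impI)
    fix i j assume "i < j" "j < length (map hd (sup_leaves (sym_compo P g f)))"
    then have ij: "i < j" "j < arity P (ssrc f)" using sym_compo_fields(5)[OF f(1)] by auto
    have "hd (sup_leaves f ! i) < hd (sup_leaves f ! j)"
      using f(3) ij sym_arrowD(6)[OF f(1)] by (auto simp: sorted_wrt_iff_nth_less)
    then have "hd (sup_leaves g ! hd (sup_leaves f ! i)) < hd (sup_leaves g ! hd (sup_leaves f ! j))"
      using g(3) hd[OF ij(2)] sym_arrowD(6)[OF g(1)] by (auto simp: sorted_wrt_iff_nth_less)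
    then show "map hd (sup_leaves (sym_compo P g f)) ! i < map hd (sup_leaves (sym_compo P g f)) ! j"
      using hd ij sym_compo_fields(5)[OF f(1)] by simp
  qed
  then show ?thesis
    using sym_compo_arr[OF f(1) g(1) fg] sym_compo_identity_uppers[OF f(1) g(1) fg f(2) g(2)]
    by (simp add: sym_Lower_def)
qed

text \<open>If the upper vertices of \<open>f\<close> are identities, one leaf \<open>a\<^sub>j\<close> sits over each input \<open>j\<close> of the source.
  Permuting the inputs of the source by the ranks of the \<open>a\<^sub>j\<close> makes the leaves over it increase.\<close>

lemma sym_composites_Lower_Perm:
  "composites (sym_Tw P) (sym_Lower P) (sym_Perm P) =
    {f \<in> arr (sym_Tw P). set (suppers f) \<subseteq> identities P}"
proof (intro equalityI subsetI)
  fix h assume "h \<in> composites (sym_Tw P) (sym_Lower P) (sym_Perm P)"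
  then obtain f g where "h = sym_compo P g f" "f \<in> sym_Perm P" "g \<in> sym_Lower P" "sym_target P f = ssrc g"
    by (auto simp: composites_def)
  then show "h \<in> {f \<in> arr (sym_Tw P). set (suppers f) \<subseteq> identities P}"
    using sym_compo_arr[of f g] sym_compo_identity_uppers[of f g] sym_LowerD[of g]
    by (auto simp: sym_Perm_def)
next
  fix f assume "f \<in> {f \<in> arr (sym_Tw P). set (suppers f) \<subseteq> identities P}"
  then have f: "is_sym_arrow P f" and uf: "set (suppers f) \<subseteq> identities P" by auto
  let ?p = "ssrc f" and ?n = "arity P (ssrc f)"
  define as where "as = map hd (sup_leaves f)"
  define \<sigma> where "\<sigma> = ranks as"
  have p: "?p \<in> Ops P" by (rule sym_arrowD(1)[OF f])
  have las: "length as = ?n" using sym_arrowD(6)[OF f] by (simp add: as_def)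
  have sup: "sup_leaves f = map (\<lambda>a. [a]) as"
  proof (rule nth_equalityI)
    fix j assume "j < length (sup_leaves f)"
    then have j: "j < ?n" using sym_arrowD(6)[OF f] by simp
    obtain a where "sup_leaves f ! j = [a]"
      using unary_uppers_leaves[OF f _ j] uf unary_iso_ident by (metis subsetD)
    then show "sup_leaves f ! j = map (\<lambda>a. [a]) as ! j" using j sym_arrowD(6)[OF f] by (simp add: as_def)
  qed (simp add: as_def)
  have single: "concat (map (\<lambda>a. [a]) xs) = xs" for xs :: "nat list" by (induction xs) auto
  have leaf: "leaf_list f = as @ slow_leaves f" by (simp add: leaf_list_def sup single)
  then have das: "distinct as" using sym_arrowD(12)[OF f] by (simp add: is_perm_def)
  have \<sigma>: "is_perm ?n \<sigma>" "map ((!) (sort as)) \<sigma> = as"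
    using ranks_perm[OF das] las by (auto simp: \<sigma>_def)
  define p' where "p' = act P ?p \<sigma>"
  have p': "p' \<in> Ops P" "arity P p' = ?n" "outp P p' = outp P ?p"
    using act_Ops[OF p \<sigma>(1)] arity_act[OF p \<sigma>(1)] outp_act[OF p \<sigma>(1)] by (auto simp: p'_def)
  have inp': "inp P p' ! (\<sigma> ! j) = inp P ?p ! j" if "j < ?n" for j
    using inp_act[OF p \<sigma>(1) that] by (simp add: p'_def)
  have col: "outp P ?p \<in> Col P" "set (inp P ?p) \<subseteq> Col P" "set (inp P p') \<subseteq> Col P"
    using outp_Col[OF p] inp_Col[OF p] inp_Col[OF p'(1)] by auto
  have ar: "map (arity P) (map (ident P) cs) = map (\<lambda>_. 1) cs" if "set cs \<subseteq> Col P" for cs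
    using that by (induction cs) (auto simp: arity_ident)
  define \<pi> where "\<pi> = \<lparr>ssrc = ?p, slower = ident P (outp P ?p), suppers = map (ident P) (inp P ?p),
    slow_leaves = [], sup_leaves = map (\<lambda>a. [a]) \<sigma>\<rparr>"
  define g where "g = \<lparr>ssrc = p', slower = slower f, suppers = map (ident P) (inp P p'),
    slow_leaves = slow_leaves f, sup_leaves = map (\<lambda>a. [a]) (sort as)\<rparr>"
  have l\<sigma>: "length \<sigma> = ?n" using is_perm_length[OF \<sigma>(1)] .
  have leaf\<pi>: "leaf_list \<pi> = \<sigma>" by (simp add: leaf_list_def \<pi>_def single)
  have leafg: "leaf_list g = sort as @ slow_leaves f" by (simp add: leaf_list_def g_def single)
  have \<pi>: "is_sym_arrow P \<pi>"
    unfolding is_sym_arrow_def leaf\<pi> using composable_idents[OF p] p col \<sigma>(1) l\<sigma> ar[OF col(2)]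
    by (auto simp: \<pi>_def pcomposable_def ident_Ops arity_ident inp_ident comp_def arity_def
        intro!: nth_equalityI)
  have t\<pi>: "sym_target P \<pi> = p'"
    unfolding sym_target_def leaf\<pi> using p by (simp add: \<pi>_def cmp_ident_right pcmp_ident p'_def)
  have "mset (leaf_list g) = mset (leaf_list f)" unfolding leaf leafg by simp
  then have permg: "is_perm (length (leaf_list g)) (leaf_list g)"
    using sym_arrowD(12)[OF f] unfolding is_perm_iff_mset by (metis size_mset)
  have g: "is_sym_arrow P g"
    unfolding is_sym_arrow_def using composable_idents[OF p'(1)] p' permg ar[OF col(3)] sym_arrowD(2,4,10,11)[OF f] las
    by (auto simp: g_def pcomposable_def comp_def arity_def intro!: nth_equalityI)
  have Lg: "g \<in> sym_Lower P"
    using g idents_identities[OF p'(1)] strict_sorted_sort[OF das] by (simp add: sym_Lower_def g_def comp_def)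
  have P\<pi>: "\<pi> \<in> sym_Perm P"
    using \<pi> idents_identities[OF p] col(1) by (auto simp: sym_Perm_def \<pi>_def identities_def)
  have \<sigma>n: "\<sigma> ! j < ?n" if "j < ?n" for j
    using \<sigma>(1) that l\<sigma> unfolding is_perm_def by (metis lessThan_iff nth_mem)
  have "sym_compo P g \<pi> = f"
  proof (rule sym_arrow.equality)
    note fl = sym_compo_fields[OF \<pi>, where g = g]
    show "ssrc (sym_compo P g \<pi>) = ssrc f" using fl(1) by (simp add: \<pi>_def)
    obtain ds where ds: "slower f \<in> Ops P" "inp P (slower f) = [] @ outp P ?p # ds"
      using sym_arrowD(4)[OF f] by (auto simp: pcomposable_split)
    have "pcmp P (slower f) 0 (ident P (outp P ?p)) = slower f"
      using pcmp_ident_right[OF ds] by simp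
    then show "slower (sym_compo P g \<pi>) = slower f"
      using fl(2) col sort_inputs_tail_sorted[of "slow_leaves f" "slower f"] sym_arrowD(2,10,11)[OF f]
      by (simp add: \<pi>_def g_def cmp_ident ident_Ops outp_ident)
    show "slow_leaves (sym_compo P g \<pi>) = slow_leaves f"
      using fl(3) sym_arrowD(10)[OF f] by (simp add: \<pi>_def g_def sorted_sort_id strict_sorted_iff)
    have s: "suppers (sym_compo P g \<pi>) ! j = suppers f ! j \<and> sup_leaves (sym_compo P g \<pi>) ! j = sup_leaves f ! j"
      if j: "j < ?n" for j
    proof -
      have 1: "sup_leaves \<pi> ! j = [\<sigma> ! j]" using j l\<sigma> by (simp add: \<pi>_def)
      have "as ! j = sort as ! (\<sigma> ! j)" using \<sigma>(2) j l\<sigma> by (metis nth_map)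
      then have 2: "sup_leaves g ! (\<sigma> ! j) = [as ! j]" using \<sigma>n[OF j] las by (simp add: g_def)
      have j': "j < arity P (ssrc \<pi>)" using j by (simp add: \<pi>_def)
      have t: "sym_target P \<pi> = ssrc g" using t\<pi> by (simp add: g_def)
      note u = sym_compo_upper_singleton[OF \<pi> g t j' 1 2]
      have c: "inp P ?p ! j \<in> Col P" using col(2) j unfolding arity_def by auto
      have "suppers \<pi> ! j = ident P (inp P ?p ! j)" "suppers g ! (\<sigma> ! j) = ident P (inp P ?p ! j)"
        using j \<sigma>n[OF j] p'(2) inp'[OF j] by (auto simp: \<pi>_def g_def arity_def)
      then have "suppers (sym_compo P g \<pi>) ! j = ident P (inp P ?p ! j)"
        using u(1) c by (simp add: cmp_ident ident_Ops outp_ident)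
      moreover have "suppers f ! j = ident P (inp P ?p ! j)"
      proof -
        have "suppers f ! j \<in> identities P" using uf sym_arrowD(5)[OF f] j by auto
        moreover have "outp P (suppers f ! j) = inp P ?p ! j"
          using sym_arrowD(3,5)[OF f] j by (metis composable_def nth_map)
        ultimately show ?thesis by (auto simp: identities_def outp_ident)
      qed
      ultimately show ?thesis using u(2) j las by (simp add: sup)
    qed
    show "suppers (sym_compo P g \<pi>) = suppers f" "sup_leaves (sym_compo P g \<pi>) = sup_leaves f"
      using s fl(4,5) sym_arrowD(5,6)[OF f] by (auto intro!: nth_equalityI simp: \<pi>_def)
  qed simp
  then have "f = compo (sym_Tw P) g \<pi>" by simp
  moreover have "cod (sym_Tw P) \<pi> = dom (sym_Tw P) g" using t\<pi> by (simp add: g_def)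
  ultimately show "f \<in> composites (sym_Tw P) (sym_Lower P) (sym_Perm P)"
    using Lg P\<pi> unfolding composites_def by blast
qed

lemma sym_input_maps_facts:
  assumes "h \<in> sym_input_maps P p"
  shows "h \<in> sym_Lower P" "sym_target P h = p" "p \<in> Ops P \<Longrightarrow> ssrc h \<in> identities P"
proof -
  obtain j where j: "j < arity P p" "h \<in> sym_Lower P" "ssrc h = ident P (inp P p ! j)" "sym_target P h = p"
    using assms by (auto simp: sym_input_maps_def)
  then show "h \<in> sym_Lower P" "sym_target P h = p" by auto
  assume "p \<in> Ops P"
  then have "inp P p ! j \<in> Col P" using inp_Col j(1) nth_mem unfolding arity_def by blast
  then show "ssrc h \<in> identities P" using j by (simp add: identities_def)
qed

lemma sym_petal_Lower:
  assumes "is_sym_arrow P f" "arity P (ssrc f) = 0"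
  shows "f \<in> sym_Lower P"
  using assms(1) sym_arrowD(5,6)[OF assms(1)] assms(2) by (simp add: sym_Lower_def)

lemma sym_target_single_upper:
  assumes f: "is_sym_arrow P f" and s: "ssrc f = ident P c" and up: "suppers f = [u]" "sup_leaves f = [[a]]"
    and u: "u \<in> Ops P" "outp P u = c" "inp P u = [d]"
  shows "sym_target P f = act P (pcmp P (slower f) 0 u) (a # slow_leaves f)"
    "a < arity P (sym_target P f)" "inp P (sym_target P f) ! a = d"
proof -
  let ?x = "pcmp P (slower f) 0 u"
  have leaf: "leaf_list f = a # slow_leaves f" by (simp add: leaf_list_def up)
  show t: "sym_target P f = act P ?x (a # slow_leaves f)"
    using u by (simp add: sym_target_def leaf s up cmp_ident)
  have "c \<in> Col P" using u outp_Col by blast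
  then obtain ds where ds: "slower f \<in> Ops P" "inp P (slower f) = [] @ outp P u # ds"
    using sym_arrowD(4)[OF f] u(2) by (auto simp: pcomposable_split s outp_ident)
  note x = pcmp_Ops[OF ds(1) u(1) ds(2)]
  have n: "arity P ?x = length (leaf_list f)"
    using x(3) ds sym_arrowD(11)[OF f] u(3) by (simp add: arity_def leaf)
  have perm: "is_perm (arity P ?x) (a # slow_leaves f)" using sym_arrowD(12)[OF f] n leaf by simp
  have "arity P (sym_target P f) = arity P ?x" using arity_act perm x(1) t by simp
  then show "a < arity P (sym_target P f)" using perm by (auto simp: is_perm_def)
  have "inp P ?x ! 0 = d" using x(3) u(3) by simp
  then show "inp P (sym_target P f) ! a = d"
    using inp_act[OF _ perm, of 0] x(1) n leaf by (simp add: t)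
qed

lemma sym_arrow_from_identity:
  assumes f: "is_sym_arrow P f" and uf: "\<And>u. u \<in> set (suppers f) \<Longrightarrow> unary_iso u" and s: "ssrc f \<in> identities P"
  obtains u a where "suppers f = [u]" "sup_leaves f = [[a]]" "ssrc f = ident P (outp P u)"
proof -
  obtain c where c: "c \<in> Col P" "ssrc f = ident P c" using s by (auto simp: identities_def)
  then have n: "arity P (ssrc f) = 1" by (simp add: arity_ident)
  obtain u where u: "suppers f = [u]" using sym_arrowD(5)[OF f] n by (auto simp: length_Suc_conv)
  obtain a where a: "sup_leaves f ! 0 = [a]" using unary_uppers_leaves[OF f uf] n by auto
  have "sup_leaves f = [[a]]" using sym_arrowD(6)[OF f] n a by (auto simp: length_Suc_conv)
  moreover have "outp P u = c" using sym_arrowD(3)[OF f] u c by (simp add: composable_def inp_ident)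
  ultimately show thesis using u c by (intro that) auto
qed

lemma sym_identity_uppers_from_identity:
  assumes f: "is_sym_arrow P f" and uf: "set (suppers f) \<subseteq> identities P" and s: "ssrc f \<in> identities P"
  shows "f \<in> sym_input_maps P (sym_target P f)"
proof -
  have "\<And>u. u \<in> set (suppers f) \<Longrightarrow> unary_iso u" using uf unary_iso_ident by blast
  then obtain u a where ua: "suppers f = [u]" "sup_leaves f = [[a]]" "ssrc f = ident P (outp P u)"
    using sym_arrow_from_identity[OF f _ s] by metis
  have "u \<in> identities P" using uf ua by simp
  then have u: "u \<in> Ops P" "inp P u = [outp P u]"
    by (auto simp: identities_def ident_Ops inp_ident outp_ident)
  have "f \<in> sym_Lower P" using f uf ua by (simp add: sym_Lower_def)
  then show ?thesis
    using sym_target_single_upper(2,3)[OF f ua(3,1,2) u(1) refl u(2)] ua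
    unfolding sym_input_maps_def by (intro CollectI exI[of _ a]) simp
qed

lemma sym_iso_uppers:
  assumes "iso (sym_Tw P) f" "q \<in> set (suppers f)"
  shows "unary_iso q"
proof -
  interpret category "sym_Tw P" by (rule sym_Tw_category)
  obtain g where g0: "g \<in> arr (sym_Tw P)" "dom (sym_Tw P) g = cod (sym_Tw P) f"
    "cod (sym_Tw P) g = dom (sym_Tw P) f"
    "compo (sym_Tw P) g f = idt (sym_Tw P) (dom (sym_Tw P) f)"
    "compo (sym_Tw P) f g = idt (sym_Tw P) (cod (sym_Tw P) f)"
    by (rule inverse_exists[OF assms(1)])
  then have g: "is_sym_arrow P f" "is_sym_arrow P g" "ssrc g = sym_target P f" "sym_target P g = ssrc f"
    "sym_compo P g f = idt (sym_Tw P) (ssrc f)" "sym_compo P f g = idt (sym_Tw P) (sym_target P f)"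
    using iso_arr[OF assms(1)] by (simp_all del: sym_Tw_simps(6))
  have key: "\<exists>rs. set rs \<subseteq> set (suppers g) \<and> composable P q rs \<and> cmp P q rs \<in> identities P"
    if f: "is_sym_arrow P f" and g: "is_sym_arrow P g" and fg: "sym_target P f = ssrc g"
      and i: "sym_compo P g f = idt (sym_Tw P) (ssrc f)" and q: "q \<in> set (suppers f)" for f g q
  proof -
    obtain j where j: "j < arity P (ssrc f)" "q = suppers f ! j"
      using q sym_arrowD(5)[OF f] by (metis in_set_conv_nth)
    have "suppers (sym_compo P g f) ! j \<in> identities P"
      unfolding i using j idents_identities[OF sym_arrowD(1)[OF f]] by (auto simp: arity_def)
    then show ?thesis
      using sym_compo_upper(1,4)[OF f g fg j(1)] sym_compo_upper(3)[OF f g fg j(1) refl] j(2) by blast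
  qed
  show ?thesis
  proof (rule mutually_right_invertible[OF _ _ assms(2)])
    show "\<exists>rs. set rs \<subseteq> set (suppers g) \<and> composable P q rs \<and> cmp P q rs \<in> identities P"
      if "q \<in> set (suppers f)" for q
      using key[OF g(1,2) g(3)[symmetric] g(5) that] .
    show "\<exists>rs. set rs \<subseteq> set (suppers f) \<and> composable P q rs \<and> cmp P q rs \<in> identities P"
      if "q \<in> set (suppers g)" for q
      using key[OF g(2,1,4) _ that] g(3,6) by simp
  qed
qed

lemma sym_Inert_uppers:
  assumes "f \<in> Inert (sym_Tw P) (sym_Lower P)"
  shows "is_sym_arrow P f \<and> (\<forall>q \<in> set (suppers f). unary_iso q)"
  using assms
proof induction
  case (lower f)
  then show ?case using sym_LowerD[of f] unary_iso_ident by blast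
next
  case (isom f)
  then show ?case using sym_iso_uppers category.iso_arr[OF sym_Tw_category isom] by auto
next
  case (compo f g)
  then have fg: "is_sym_arrow P f" "is_sym_arrow P g" "sym_target P f = ssrc g"
    and u: "\<And>q. q \<in> set (suppers f) \<Longrightarrow> unary_iso q" "\<And>q. q \<in> set (suppers g) \<Longrightarrow> unary_iso q" by auto
  have "unary_iso q" if q: "q \<in> set (suppers (sym_compo P g f))" for q
    using sym_compo_unary_uppers[OF fg u q] unary_iso_cmp u by metis
  then show ?case using sym_compo_arr[OF fg] by simp
qed

definition sym_conjugation :: "'o \<Rightarrow> 'o \<Rightarrow> 'o sym_arrow" where
  "sym_conjugation u u' = \<lparr>ssrc = ident P (outp P u), slower = u', suppers = [u],
     slow_leaves = [], sup_leaves = [[0]]\<rparr>"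

lemma sym_conjugation_arr:
  assumes "u \<in> Ops P" "u' \<in> Ops P" "inp P u = [c]" "inp P u' = [outp P u]" "outp P u' = c" "cmp P u' [u] = ident P c"
  shows "is_sym_arrow P (sym_conjugation u u')" "sym_target P (sym_conjugation u u') = ident P c"
proof -
  have leaf: "leaf_list (sym_conjugation u u') = [0]" by (simp add: sym_conjugation_def leaf_list_def)
  have c: "c \<in> Col P" "outp P u \<in> Col P" using assms outp_Col by auto
  show "is_sym_arrow P (sym_conjugation u u')"
    unfolding is_sym_arrow_def leaf using assms c
    by (auto simp: sym_conjugation_def composable_ident pcomposable_def arity_def ident_Ops outp_ident is_perm_def)
  show "sym_target P (sym_conjugation u u') = ident P c"
    unfolding sym_target_def leaf using assms c act_id[OF ident_Ops[OF c(1)]]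
    by (simp add: sym_conjugation_def cmp_ident pcmp_def arity_ident)
qed

lemma sym_conjugation_inverse:
  assumes "u \<in> Ops P" "u' \<in> Ops P" "inp P u = [c]" "inp P u' = [outp P u]" "outp P u' = c"
    "cmp P u' [u] = ident P c" "cmp P u [u'] = ident P (outp P u)"
  shows "sym_compo P (sym_conjugation u' u) (sym_conjugation u u') = idt (sym_Tw P) (ident P (outp P u))"
proof -
  have c: "c \<in> Col P" "outp P u \<in> Col P" using assms outp_Col by auto
  have "cmp P u' [ident P (outp P u)] = u'" using cmp_ident_right[OF assms(2)] assms(4) by simp
  then show ?thesis
    using assms c sort_inputs_singleton[of "ident P (outp P u)"] sort_inputs_tail_sorted[of "[]" "ident P (outp P u)"]
    by (simp add: sym_compo_def sym_conjugation_def pcmp_def outp_ident inp_ident ident_Ops arity_ident)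
qed

lemma sym_conjugation_iso:
  assumes "u \<in> Ops P" "u' \<in> Ops P" "inp P u = [c]" "inp P u' = [outp P u]" "outp P u' = c"
    "cmp P u' [u] = ident P c" "cmp P u [u'] = ident P (outp P u)"
  shows "iso (sym_Tw P) (sym_conjugation u u')"
proof -
  note a = sym_conjugation_arr[OF assms(1-6)]
  have b: "is_sym_arrow P (sym_conjugation u' u)" "sym_target P (sym_conjugation u' u) = ident P (outp P u)"
    using sym_conjugation_arr[of u' u "outp P u"] assms by auto
  have "sym_compo P (sym_conjugation u u') (sym_conjugation u' u) = idt (sym_Tw P) (ident P c)"
    using sym_conjugation_inverse[of u' u "outp P u"] assms by simp
  moreover have "ssrc (sym_conjugation u u') = ident P (outp P u)" "ssrc (sym_conjugation u' u) = ident P c"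
    using assms by (auto simp: sym_conjugation_def)
  ultimately show ?thesis
    unfolding iso_def using a b sym_conjugation_inverse[OF assms]
    by (auto simp: hom_def simp del: sym_Tw_simps(6) intro!: bexI[of _ "sym_conjugation u' u"])
qed

text \<open>The upper vertex is moved below the source as in the planar case.  The numbering of the leaves
  is not affected.\<close>

lemma sym_Inert_factor:
  assumes f: "f \<in> Inert (sym_Tw P) (sym_Lower P)" and s: "ssrc f \<in> identities P"
  shows "\<exists>h \<in> sym_input_maps P (sym_target P f). \<exists>k \<in> Inert (sym_Tw P) (sym_Lower P).
    sym_target P k = ssrc h \<and> sym_compo P h k = f"
proof -
  have f': "is_sym_arrow P f" and iso: "\<And>q. q \<in> set (suppers f) \<Longrightarrow> unary_iso q"
    using sym_Inert_uppers[OF f] by auto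
  obtain u a where ua: "suppers f = [u]" "sup_leaves f = [[a]]" "ssrc f = ident P (outp P u)"
    using sym_arrow_from_identity[OF f' iso s] by metis
  have "unary_iso u" using iso ua by simp
  then obtain c u' where uu: "u \<in> Ops P" "u' \<in> Ops P" "c \<in> Col P" "inp P u = [c]" "inp P u' = [outp P u]" "outp P u' = c"
    "cmp P u' [u] = ident P c" "cmp P u [u'] = ident P (outp P u)"
    using unary_isoE by metis
  have ou: "outp P u \<in> Col P" using outp_Col uu by blast
  obtain ds where ds: "slower f \<in> Ops P" "inp P (slower f) = [] @ outp P u # ds"
    using sym_arrowD(4)[OF f'] ou by (auto simp: pcomposable_split ua outp_ident)
  let ?l = "pcmp P (slower f) 0 u"
  have l: "?l \<in> Ops P" "inp P ?l = [] @ c # ds" using pcmp_Ops[OF ds(1) uu(1) ds(2)] uu(4) by auto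
  have nl: "arity P ?l = arity P (slower f)" using l ds by (simp add: arity_def)
  define h where "h = \<lparr>ssrc = ident P c, slower = ?l, suppers = [ident P c],
    slow_leaves = slow_leaves f, sup_leaves = [[a]]\<rparr>"
  define k where "k = sym_conjugation u u'"
  have leaf: "leaf_list h = leaf_list f" by (simp add: leaf_list_def h_def ua)
  have h: "is_sym_arrow P h"
    unfolding is_sym_arrow_def leaf
    using l nl uu(3) sym_arrowD(10,11,12)[OF f']
    by (auto simp: h_def composable_ident ident_Ops outp_ident pcomposable_def arity_def inp_ident)
  have hL: "h \<in> sym_Lower P" using h uu(3) by (auto simp: sym_Lower_def h_def identities_def)
  have th: "sym_target P h = sym_target P f"
    unfolding sym_target_def leaf using pcmp_ident_right[OF l] uu
    by (simp add: h_def ua cmp_ident ident_Ops outp_ident)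
  have "h \<in> sym_input_maps P (sym_target P f)"
    unfolding sym_input_maps_def
    using hL th sym_target_single_upper(2,3)[OF f' ua(3,1,2) uu(1) refl uu(4)]
    by (intro CollectI exI[of _ a]) (simp add: h_def)
  moreover have "k \<in> Inert (sym_Tw P) (sym_Lower P)"
    unfolding k_def using uu by (intro Inert.isom sym_conjugation_iso) auto
  moreover have "sym_target P k = ssrc h"
    using sym_conjugation_arr(2)[of u u' c] uu by (simp add: k_def h_def)
  moreover have "sym_compo P h k = f"
  proof -
    have 1: "cmp P u' [ident P (outp P u)] = u'" "cmp P u [ident P c] = u"
      using cmp_ident_right[of u'] cmp_ident_right[of u] uu by auto
    have "pcmp P ?l (0 + 0) u' = pcmp P (slower f) 0 (pcmp P u 0 u')"
      using ds uu by (intro pcmp_pcmp) (auto simp: pcomposable_def arity_def)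
    also have "pcmp P u 0 u' = ident P (outp P u)" using uu by (simp add: pcmp_def)
    finally have 2: "pcmp P ?l 0 u' = slower f" using pcmp_ident_right[OF ds] by simp
    have "sort (slow_leaves f) = slow_leaves f"
      using sym_arrowD(10)[OF f'] by (simp add: sorted_sort_id strict_sorted_iff)
    then show ?thesis
      using 1 2 uu ou ua sort_inputs_singleton[OF uu(1)] sym_arrowD(11)[OF f']
        sort_inputs_tail_sorted[OF sym_arrowD(10)[OF f'] ds(1)]
      by (intro sym_arrow.equality) (simp_all add: sym_compo_def h_def k_def sym_conjugation_def outp_ident arity_def)
  qed
  ultimately show ?thesis by blast
qed

end

section \<open>Families of arrows as elements of the universe\<close>

lemma closed_under_powers_inj:
  assumes "closed_under_powers TYPE('k) TYPE('u)" "inj (e :: 'm \<Rightarrow> 'k)"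
  obtains H :: "('m \<Rightarrow> 'u) \<Rightarrow> 'u" where "inj H"
proof -
  obtain h :: "('k \<Rightarrow> 'u) \<Rightarrow> 'u" where h: "inj h" using assms(1) by (auto simp: closed_under_powers_def)
  have "inj (\<lambda>y. h (\<lambda>k. y (inv e k)))"
  proof (rule injI)
    fix y z :: "'m \<Rightarrow> 'u" assume "h (\<lambda>k. y (inv e k)) = h (\<lambda>k. z (inv e k))"
    then have "(\<lambda>k. y (inv e k)) = (\<lambda>k. z (inv e k))" using h by (simp add: inj_eq)
    then have "y (inv e (e x)) = z (inv e (e x))" for x by meson
    then show "y = z" using assms(2) by (simp add: fun_eq_iff)
  qed
  then show thesis by (rule that)
qed

text \<open>The list is padded to a length that determines its original length and the number.  In this
  way numbers can be encoded even if \<open>'o\<close> has a single element.\<close>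

definition encode_list_nat :: "'o list \<Rightarrow> nat \<Rightarrow> 'o list" where
  "encode_list_nat xs n = xs @ replicate (prod_encode (length xs, n) - length xs) undefined"

lemma encode_list_nat_inj: "encode_list_nat xs m = encode_list_nat ys n \<longleftrightarrow> xs = ys \<and> m = n"
proof
  assume eq: "encode_list_nat xs m = encode_list_nat ys n"
  have "length (encode_list_nat xs m) = prod_encode (length xs, m)"
    "length (encode_list_nat ys n) = prod_encode (length ys, n)"
    using le_prod_encode_1[of "length xs" m] le_prod_encode_1[of "length ys" n] by (auto simp: encode_list_nat_def)
  then have "length xs = length ys \<and> m = n" using eq by (metis prod.inject prod_encode_eq)
  then show "xs = ys \<and> m = n" using eq by (simp add: encode_list_nat_def)
qed simp

lemma planar_arrow_inj:
  "inj (\<lambda>f :: 'o planar_arrow. encode_list_nat (src f # lower f # uppers f) (pos f))"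
  by (rule injI) (simp add: encode_list_nat_inj)

lemma sym_arrow_inj:
  "inj (\<lambda>f :: 'o sym_arrow. encode_list_nat (ssrc f # slower f # suppers f)
     (list_encode (list_encode (slow_leaves f) # map list_encode (sup_leaves f))))"
proof (rule injI)
  fix f g :: "'o sym_arrow"
  assume "encode_list_nat (ssrc f # slower f # suppers f) (list_encode (list_encode (slow_leaves f) # map list_encode (sup_leaves f))) =
    encode_list_nat (ssrc g # slower g # suppers g) (list_encode (list_encode (slow_leaves g) # map list_encode (sup_leaves g)))"
  then have "ssrc f = ssrc g" "slower f = slower g" "suppers f = suppers g"
    "list_encode (slow_leaves f) = list_encode (slow_leaves g)"
    "map list_encode (sup_leaves f) = map list_encode (sup_leaves g)"
    by (auto simp: encode_list_nat_inj list_encode_eq)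
  then show "f = g"
    using inj_list_encode[of UNIV] by (intro sym_arrow.equality) (auto simp: list_encode_eq inj_map_eq_map)
qed

section \<open>The Segal coverage\<close>

text \<open>An arrow from an elementary object is a petal map or starts at an identity, and in the latter
  case it factors through an input map by assumption.  Hence the Segal coverage meets the conditions
  of the comparison of presheaves on elementary objects with sheaves.\<close>

lemma segal_equivalence:
  fixes T :: "('o, 'm) category_data" and H :: "('m \<Rightarrow> 'u) \<Rightarrow> 'u"
  assumes T: "category T" and T0: "T0 \<subseteq> arr T"
    and idt: "\<And>a. a \<in> obj T \<Longrightarrow> idt T a \<in> T0"
    and compo: "\<And>f g. f \<in> T0 \<Longrightarrow> g \<in> T0 \<Longrightarrow> cod T f = dom T g \<Longrightarrow> compo T g f \<in> T0"
    and obj: "obj T = Ops P"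
    and inputs: "\<And>p h. p \<in> Ops P \<Longrightarrow> h \<in> inputs p \<Longrightarrow> h \<in> T0 \<and> cod T h = p \<and> dom T h \<in> identities P"
    and petals: "\<And>f. f \<in> arr T \<Longrightarrow> \<psi> (dom T f) = -1 \<Longrightarrow> f \<in> T0"
    and factor: "\<And>f. f \<in> T0 \<Longrightarrow> dom T f \<in> identities P \<Longrightarrow>
      \<exists>h \<in> inputs (cod T f). \<exists>k \<in> T0. cod T k = dom T h \<and> compo T h k = f"
    and H: "inj H"
  shows "let C = wide_sub T T0; El = full_sub C (elementary P \<psi>); S = segal_coverage T inputs \<psi>
    in (\<exists>(R :: ('o, 'm, 'o, 'm, 'u) psh_functor) \<epsilon>. is_right_Kan_extension El C inclusion R \<epsilon>) \<and>
       (\<forall>(R :: ('o, 'm, 'o, 'm, 'u) psh_functor) \<epsilon>.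
          is_right_Kan_extension El C inclusion R \<epsilon> \<longrightarrow> is_equivalence (Psh El) (Sh C S) R)"
proof -
  let ?C = "wide_sub T T0" and ?E = "elementary P \<psi>" and ?S = "segal_coverage T inputs \<psi>"
  interpret T: category T by (rule T)
  have C: "category ?C" by (rule T.wide_sub_category[OF T0 idt compo])
  interpret C: category_with_elementary_objects ?C ?E H
    using C H by (simp add: category_with_elementary_objects_def category_with_elementary_objects_axioms_def)
  have Cs: "arr ?C = T0" "obj ?C = Ops P" "dom ?C = dom T" "cod ?C = cod T" "compo ?C = compo T" "idt ?C = idt T"
    using T0 obj by (auto simp: wide_sub_def)
  have cov: "f \<in> C.over p" if "p \<in> obj ?C" "f \<in> ?S p" for p f
  proof -
    have "f \<in> T0 \<and> cod T f = p \<and> dom T f \<in> ?E"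
      using that inputs[of p f] petals[of f] T.dom_obj[of f]
      by (auto simp: Cs segal_coverage_def petal_maps_def elementary_def obj)
    then show ?thesis by (simp add: C.over_def Cs)
  qed
  have fac: "\<exists>h \<in> ?S p. \<exists>k \<in> C.over (dom ?C h). compo ?C h k = f" if p: "p \<in> obj ?C" and f: "f \<in> C.over p" for p f
  proof -
    have f': "f \<in> T0" "cod T f = p" "dom T f \<in> ?E" using f by (auto simp: C.over_def Cs)
    show ?thesis
    proof (cases "dom T f \<in> identities P")
      case True
      then obtain h k where h: "h \<in> inputs p" and k: "k \<in> T0" "cod T k = dom T h" "compo T h k = f"
        using factor[OF f'(1) True] f'(2) by auto
      have "dom T k = dom T f"
        using T.compo_arr(2)[of k h] k inputs[of p h] h p subsetD[OF T0] by (auto simp: Cs)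
      then have "k \<in> C.over (dom T h)" using k f'(3) by (simp add: C.over_def Cs)
      then show ?thesis using h k by (auto simp: segal_coverage_def Cs)
    next
      case False
      then have "\<psi> (dom T f) = -1" using f'(3) by (auto simp: elementary_def)
      then have "f \<in> ?S p" using f' T0 by (auto simp: segal_coverage_def petal_maps_def)
      moreover have "idt T (dom T f) \<in> C.over (dom T f)"
        using C.idt_over[of "dom T f"] C.dom_obj[of f] f' by (simp add: Cs)
      moreover have "compo T f (idt T (dom T f)) = f" using T.compo_idt_right f' T0 by auto
      ultimately show ?thesis by (auto simp: Cs)
    qed
  qed
  show ?thesis
    unfolding Let_def
    using C.ran_functor_right_Kan C.elementary_objects_equivalence[of ?S, OF cov fac] by blast
qed

lemma (in category) Inert_subset_arr:
  assumes "L \<subseteq> arr C"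
  shows "Inert C L \<subseteq> arr C"
proof
  fix f assume "f \<in> Inert C L"
  then show "f \<in> arr C"
    by induction (use assms iso_arr compo_arr(1) in auto)
qed

lemma (in planar_operad) planar_segal_equivalence:
  fixes H :: "('o planar_arrow \<Rightarrow> 'u) \<Rightarrow> 'u"
  assumes "nice P \<psi>" "inj H"
    and T0: "T0 \<in> {planar_Lower P, composites (planar_Tw P) (planar_Lower P) (planar_Perm P),
      Inert (planar_Tw P) (planar_Lower P)}"
  shows "let C = wide_sub (planar_Tw P) T0; El = full_sub C (elementary P \<psi>);
      S = segal_coverage (planar_Tw P) (planar_input_maps P) \<psi>
    in (\<exists>(R :: ('o, 'o planar_arrow, 'o, 'o planar_arrow, 'u) psh_functor) \<epsilon>.
          is_right_Kan_extension El C inclusion R \<epsilon>) \<and>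
       (\<forall>(R :: ('o, 'o planar_arrow, 'o, 'o planar_arrow, 'u) psh_functor) \<epsilon>.
          is_right_Kan_extension El C inclusion R \<epsilon> \<longrightarrow> is_equivalence (Psh El) (Sh C S) R)"
proof -
  interpret T: category "planar_Tw P" by (rule planar_Tw_category)
  let ?Inert = "Inert (planar_Tw P) (planar_Lower P)"
  have T0': "T0 = planar_Lower P \<or> T0 = ?Inert" using T0 planar_composites_Lower_Perm by auto
  have L: "planar_Lower P \<subseteq> arr (planar_Tw P)" using planar_LowerD by blast
  have LT: "planar_Lower P \<subseteq> T0" using T0' by (auto intro: Inert.lower)
  have petal: "f \<in> planar_Lower P" if "f \<in> arr (planar_Tw P)" "\<psi> (src f) = -1" for f
    using planar_petal_Lower[OF that(1)] T.dom_obj[OF that(1)] that(2) assms(1) by (simp add: nice_def)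
  show ?thesis
  proof (rule segal_equivalence[OF planar_Tw_category _ _ _ _ _ _ _ assms(2)])
    show "T0 \<subseteq> arr (planar_Tw P)" using T0' L T.Inert_subset_arr[OF L] by auto
    show "idt (planar_Tw P) a \<in> T0" if "a \<in> obj (planar_Tw P)" for a
      using planar_Lower_idt[of a] that LT by auto
    show "compo (planar_Tw P) g f \<in> T0" if "f \<in> T0" "g \<in> T0" "cod (planar_Tw P) f = dom (planar_Tw P) g" for f g
      using T0' that planar_Lower_compo[of f g] Inert.compo[of f "planar_Tw P" "planar_Lower P" g] by auto
    show "h \<in> T0 \<and> cod (planar_Tw P) h = p \<and> dom (planar_Tw P) h \<in> identities P"
      if "p \<in> Ops P" "h \<in> planar_input_maps P p" for p h
      using planar_input_maps_facts[OF that(2)] that(1) LT by auto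
    show "f \<in> T0" if "f \<in> arr (planar_Tw P)" "\<psi> (dom (planar_Tw P) f) = -1" for f
      using petal[of f] that LT by auto
    show "\<exists>h \<in> planar_input_maps P (cod (planar_Tw P) f). \<exists>k \<in> T0. cod (planar_Tw P) k = dom (planar_Tw P) h \<and>
        compo (planar_Tw P) h k = f" if f: "f \<in> T0" "dom (planar_Tw P) f \<in> identities P" for f
    proof (cases "T0 = ?Inert")
      case True
      then show ?thesis using planar_Inert_factor[of f] f by auto
    next
      case False
      then have fL: "f \<in> planar_Lower P" using T0' f by auto
      then have fa: "f \<in> arr (planar_Tw P)" using L by auto
      have "f \<in> planar_input_maps P (planar_target P f)" using planar_Lower_from_identity[OF fL] f by simp
      moreover have "idt (planar_Tw P) (src f) \<in> T0"
        using planar_Lower_idt[of "src f"] T.dom_obj[OF fa] LT by auto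
      moreover have "cod (planar_Tw P) (idt (planar_Tw P) (src f)) = src f"
        using T.cod_idt[of "src f"] T.dom_obj[OF fa] by simp
      moreover have "compo (planar_Tw P) f (idt (planar_Tw P) (src f)) = f"
        using T.compo_idt_right[OF fa] by simp
      ultimately show ?thesis by (metis planar_Tw_simps(2,3))
    qed
  qed simp
qed

lemma (in symmetric_operad) sym_segal_equivalence:
  fixes H :: "('o sym_arrow \<Rightarrow> 'u) \<Rightarrow> 'u"
  assumes "nice P \<psi>" "inj H"
    and T0: "T0 \<in> {sym_Lower P, composites (sym_Tw P) (sym_Lower P) (sym_Perm P),
      Inert (sym_Tw P) (sym_Lower P)}"
  shows "let C = wide_sub (sym_Tw P) T0; El = full_sub C (elementary P \<psi>);
      S = segal_coverage (sym_Tw P) (sym_input_maps P) \<psi>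
    in (\<exists>(R :: ('o, 'o sym_arrow, 'o, 'o sym_arrow, 'u) psh_functor) \<epsilon>.
          is_right_Kan_extension El C inclusion R \<epsilon>) \<and>
       (\<forall>(R :: ('o, 'o sym_arrow, 'o, 'o sym_arrow, 'u) psh_functor) \<epsilon>.
          is_right_Kan_extension El C inclusion R \<epsilon> \<longrightarrow> is_equivalence (Psh El) (Sh C S) R)"
proof -
  interpret T: category "sym_Tw P" by (rule sym_Tw_category)
  let ?Inert = "Inert (sym_Tw P) (sym_Lower P)" and ?Id = "{f \<in> arr (sym_Tw P). set (suppers f) \<subseteq> identities P}"
  have T0': "T0 = sym_Lower P \<or> T0 = ?Id \<or> T0 = ?Inert" using T0 sym_composites_Lower_Perm by auto
  have L: "sym_Lower P \<subseteq> arr (sym_Tw P)" using sym_LowerD by auto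
  have LT: "sym_Lower P \<subseteq> T0" using T0' sym_LowerD by (auto intro: Inert.lower)
  have petal: "f \<in> sym_Lower P" if "f \<in> arr (sym_Tw P)" "\<psi> (ssrc f) = -1" for f
    using sym_petal_Lower[of f] T.dom_obj[OF that(1)] that assms(1) by (simp add: nice_def)
  show ?thesis
  proof (rule segal_equivalence[OF sym_Tw_category _ _ _ _ _ _ _ assms(2)])
    show "T0 \<subseteq> arr (sym_Tw P)" using T0' L T.Inert_subset_arr[OF L] by auto
    show "idt (sym_Tw P) a \<in> T0" if "a \<in> obj (sym_Tw P)" for a
      using sym_Lower_idt[of a] that LT by auto
    show "compo (sym_Tw P) g f \<in> T0" if fg: "f \<in> T0" "g \<in> T0" "cod (sym_Tw P) f = dom (sym_Tw P) g" for f g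
    proof -
      consider "T0 = sym_Lower P" | "T0 = ?Id" | "T0 = ?Inert" using T0' by blast
      then show ?thesis
      proof cases
        case 1
        then show ?thesis using sym_Lower_compo[of f g] fg by simp
      next
        case 2
        then have "is_sym_arrow P f" "is_sym_arrow P g" "set (suppers f) \<subseteq> identities P" "set (suppers g) \<subseteq> identities P"
          using fg by auto
        then show ?thesis
          unfolding 2 using sym_compo_arr[of f g] sym_compo_identity_uppers[of f g] fg(3) by simp
      next
        case 3
        then show ?thesis using Inert.compo[of f "sym_Tw P" "sym_Lower P" g] fg by simp
      qed
    qed
    show "h \<in> T0 \<and> cod (sym_Tw P) h = p \<and> dom (sym_Tw P) h \<in> identities P"
      if "p \<in> Ops P" "h \<in> sym_input_maps P p" for p h
      using sym_input_maps_facts[OF that(2)] that(1) LT by auto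
    show "f \<in> T0" if "f \<in> arr (sym_Tw P)" "\<psi> (dom (sym_Tw P) f) = -1" for f
      using petal[of f] that LT by auto
    show "\<exists>h \<in> sym_input_maps P (cod (sym_Tw P) f). \<exists>k \<in> T0. cod (sym_Tw P) k = dom (sym_Tw P) h \<and>
        compo (sym_Tw P) h k = f" if f: "f \<in> T0" "dom (sym_Tw P) f \<in> identities P" for f
    proof (cases "T0 = ?Inert")
      case True
      then show ?thesis using sym_Inert_factor[of f] f by auto
    next
      case False
      then have fL: "is_sym_arrow P f" "set (suppers f) \<subseteq> identities P" using T0' f sym_LowerD[of f] by auto
      then have fa: "f \<in> arr (sym_Tw P)" by simp
      have "f \<in> sym_input_maps P (sym_target P f)" using sym_identity_uppers_from_identity[OF fL] f by simp
      moreover have "idt (sym_Tw P) (ssrc f) \<in> T0"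
        using sym_Lower_idt[of "ssrc f"] T.dom_obj[OF fa] LT by auto
      moreover have "cod (sym_Tw P) (idt (sym_Tw P) (ssrc f)) = ssrc f"
        using T.cod_idt[of "ssrc f"] T.dom_obj[OF fa] by simp
      moreover have "compo (sym_Tw P) f (idt (sym_Tw P) (ssrc f)) = f"
        using T.compo_idt_right[OF fa] by simp
      ultimately show ?thesis by (metis sym_Tw_simps(2,3))
    qed
  qed simp
qed

theorem proposition3p23:
  fixes P :: "('c, 'o) operad_data" and Q :: "('c, 'o) sym_operad_data" and \<psi> :: "'o \<Rightarrow> int"
  assumes universe: "closed_under_powers TYPE('o list) TYPE('u)"
  shows
    "(planar_operad P \<and> planar_grading P \<psi> \<and> nice P \<psi> \<and>
      (at_most_one_left_inverse (unary_category P) \<or>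
       petals_factor_through_inputs P (planar_Tw P) (planar_input_maps P) \<psi>) \<longrightarrow>
      (\<forall>T0 \<in> {planar_Lower P,
              composites (planar_Tw P) (planar_Lower P) (planar_Perm P),
              Inert (planar_Tw P) (planar_Lower P)}.
         let C = wide_sub (planar_Tw P) T0;
             El = full_sub C (elementary P \<psi>);
             S = segal_coverage (planar_Tw P) (planar_input_maps P) \<psi>
         in (\<exists>(R :: ('o, 'o planar_arrow, 'o, 'o planar_arrow, 'u) psh_functor) \<epsilon>.
               is_right_Kan_extension El C inclusion R \<epsilon>) \<and>
            (\<forall>(R :: ('o, 'o planar_arrow, 'o, 'o planar_arrow, 'u) psh_functor) \<epsilon>.
               is_right_Kan_extension El C inclusion R \<epsilon> \<longrightarrow>
               is_equivalence (Psh El) (Sh C S) R))) \<and>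
     (symmetric_operad Q \<and> symmetric_grading Q \<psi> \<and> nice Q \<psi> \<and>
      (at_most_one_left_inverse (unary_category Q) \<or>
       petals_factor_through_inputs Q (sym_Tw Q) (sym_input_maps Q) \<psi>) \<longrightarrow>
      (\<forall>T0 \<in> {sym_Lower Q,
              composites (sym_Tw Q) (sym_Lower Q) (sym_Perm Q),
              Inert (sym_Tw Q) (sym_Lower Q)}.
         let C = wide_sub (sym_Tw Q) T0;
             El = full_sub C (elementary Q \<psi>);
             S = segal_coverage (sym_Tw Q) (sym_input_maps Q) \<psi>
         in (\<exists>(R :: ('o, 'o sym_arrow, 'o, 'o sym_arrow, 'u) psh_functor) \<epsilon>.
               is_right_Kan_extension El C inclusion R \<epsilon>) \<and>
            (\<forall>(R :: ('o, 'o sym_arrow, 'o, 'o sym_arrow, 'u) psh_functor) \<epsilon>.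
               is_right_Kan_extension El C inclusion R \<epsilon> \<longrightarrow>
               is_equivalence (Psh El) (Sh C S) R)))"
proof -
  obtain H :: "('o planar_arrow \<Rightarrow> 'u) \<Rightarrow> 'u" where H: "inj H"
    by (rule closed_under_powers_inj[OF universe planar_arrow_inj])
  obtain H' :: "('o sym_arrow \<Rightarrow> 'u) \<Rightarrow> 'u" where H': "inj H'"
    by (rule closed_under_powers_inj[OF universe sym_arrow_inj])
  show ?thesis
  proof (intro conjI impI ballI, goal_cases)
    case (1 T0)
    then show ?case by (elim conjE) (rule planar_operad.planar_segal_equivalence[OF _ _ H])
  next
    case (2 T0)
    then show ?case by (elim conjE) (rule symmetric_operad.sym_segal_equivalence[OF _ _ H'])
  qed
qed

end
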